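(* Let $q\in\mathbb C$, $|q|=1$, $\eta=\Re q$, and let $\kappa>0$, where in the case $\eta<0$ additionally $\kappa^2<-1/\eta$. Let $\mathfrak R$ be the real commutative algebra generated by $\rho(\varphi)$, $\varphi\in\mathscr D$, and constants, and let $\tau:\mathfrak R\to\mathbb R$ be the (renormalized vacuum) functional, both defined in the context. Then $\tau$ is positive definite (i.e. $\tau(r^2)\ge0$ for each $r\in\mathfrak R$) if and only if $\eta\ge0$. Furthermore, if $\eta=0$, then $$\tau(\rho(f_1)\cdots\rho(f_n))=\mathbb E\big(\langle f_1,\gamma\rangle\cdots\langle f_n,\gamma\rangle\big),\qquad f_1,\dots,f_n\in\mathscr D,\qquad ( * )$$ where $\gamma$ is the Poisson point process on $X$ with intensity measure $\kappa^2m$. If $\eta>0$, then $( * )$ holds with $\gamma$ being a negative binomial point process. More precisely, $\gamma$ is the measure-valued Lévy process with Laplace transform $$\mathbb E\big(e^{\langle f,\gamma\rangle}\big)=\exp\Big[\int_X\int_{(0,\infty)}(e^{sf(x)}-1)\,\zeta(ds)\,m(dx)\Big],\qquad f\in C_0(X),\ f\le0,$$ where $$\zeta=\frac1\eta\sum_{k=1}^\infty\Big(\frac{\eta}{\eta+\kappa^{-2}}\Big)^k\frac1k\,\delta_k .$$ For each bounded Borel set $A\subset X$, the distribution of the random variable $\gamma(A)$ is the negative binomial distribution $$(1+\kappa^2\eta)^{-m(A)/\eta}\sum_{n=0}^\infty\Big(\frac{\eta}{\eta+\kappa^{-2}}\Big)^n\frac{\big(\frac{m(A)}\eta\big)^{(n)}}{n!}\,\delta_n,$$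 where $a^{(n)}=a(a+1)\cdots(a+n-1)$ is the rising factorial.
   Context: $X=\mathbb R^d$, $d\ge2$, $m$ is the Lebesgue measure, $\mathscr D$ is the space of real-valued $C^\infty$ functions on $X$ with compact support, $C_0(X)$ the space of real-valued continuous functions with compact support, $\delta_s$ the Dirac measure at $s$. $\mathscr D^{\odot_{\mathrm a}n}$ is the $n$-th symmetric algebraic tensor power of $\mathscr D$ (finite sums of functions $f_1\odot\dots\odot f_n$ on $X^n$, $\odot$ denoting symmetric tensor product), $\mathscr D^{\odot_{\mathrm a}0}=\mathbb R$, and $\mathscr F_{\mathrm{fin}}(\mathscr D)$ is the real vector space of finite sequences $F=(f^{(0)},f^{(1)},\dots,f^{(n)},0,0,\dots)$ with $f^{(i)}\in\mathscr D^{\odot_{\mathrm a}i}$. Let $\beta=\sqrt{\eta+\kappa^{-2}}$. For $\varphi\in\mathscr D$ define the linear operator on $\mathscr F_{\mathrm{fin}}(\mathscr D)$ $$\hat R(\varphi)=a^+(\varphi)+(\beta+\beta^{-1}\eta)a^0(\varphi)+a_1^-(\varphi)+\eta a_2^-(\varphi)+\beta^{-1}\int_X\varphi(x)\,m(dx),$$ where $a^+(\varphi)f^{(n)}=\varphi\odot f^{(n)}$; $a^0(\varphi)f_1\odot\dots\odot f_n=\sum_{i=1}^nf_1\odot\dots\odot(\varphi f_i)\odot\dots\odot f_n$; $a_1^-(\varphi)f_1\odot\dots\odot f_n=\sum_{i=1}^n\int_X\varphi f_i\,dm\ f_1\odot\dots\odot\check f_i\odot\dots\odot f_n$ ($\check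 f_i$: omitted); $a_2^-(\varphi)f_1\odot\dots\odot f_n=\sum_{i=1}^n\sum_{j\ne i}(\varphi f_if_j)\odot\bigodot_{l\ne i,j}f_l$. (The annihilation operators vanish on degree $0$, $a_2^-(\varphi)$ also on degree $1$, and $a^0(\varphi)$ on degree $0$.) The smeared particle density is $\rho(\varphi)=\kappa\sqrt{1+\eta\kappa^2}\,R(\varphi)$, where $R(\varphi)$ is represented on $\mathscr F_{\mathrm{fin}}(\mathscr D)$ by $\hat R(\varphi)$; the operators $\hat R(\varphi)$ commute. $\mathfrak R$ is the real commutative algebra generated by $\rho(\varphi)$, $\varphi\in\mathscr D$, and constants. For $r\in\mathfrak R$, let $F=(f^{(0)},f^{(1)},\dots)\in\mathscr F_{\mathrm{fin}}(\mathscr D)$ be the vector obtained by applying $r$ (via this representation) to $(1,0,0,\dots)$; then $\tau(r):=f^{(0)}$. Random measures: a random measure on $X$ is a random variable with values in the space of Radon measures on $X$ (with the Borel $\sigma$-algebra of the vague topology); $\langle f,\gamma\rangle=\int_Xf\,d\gamma$. It is a measure-valued Lévy process if $\gamma(A_1),\dots,\gamma(A_n)$ are independent for mutually disjoint bounded Borel sets $A_1,\dots,A_n$ and $\gamma(A_1)$, $\gamma(A_2)$ are identically distributed whenever $A_1,A_2$ are bounded Borel sets with $m(A_1)=m(A_2)$. A point process is a random measure a.s. of the form $\sum_{i\in I}s_i\delta_{x_i}$, $s_i\in\mathbb N$. The Poisson point process with intensity measure $zm$, $z>0$, has Laplace transform $\mathbb E(e^{\langle f,\gamma\rangle})=\exp[\int_X(e^{f(x)}-1)\,z\,m(dx)]$.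 *)

theory Defs
  imports "HOL-Probability.Probability"
begin

(* C^k is defined by recursion on k: a function is C^(k+1) iff it is differentiable and all its
   first order partial derivatives are C^k. *)
primrec C_k :: "nat \<Rightarrow> ('a::euclidean_space \<Rightarrow> real) \<Rightarrow> bool" where
  "C_k 0 f \<longleftrightarrow> continuous_on UNIV f"
| "C_k (Suc k) f \<longleftrightarrow> (\<forall>x. f differentiable (at x)) \<and>
     (\<forall>b\<in>Basis. C_k k (\<lambda>x. frechet_derivative f (at x) b))"

definition compactly_supported :: "('a::euclidean_space \<Rightarrow> real) \<Rightarrow> bool" where
  "compactly_supported f \<longleftrightarrow> compact (closure {x. f x \<noteq> 0})"

definition test_functions :: "('a::euclidean_space \<Rightarrow> real) set" where
  "test_functions = {f. (\<forall>k. C_k k f) \<and> compactly_supported f}"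

definition C_0 :: "('a::euclidean_space \<Rightarrow> real) set" where
  "C_0 = {f. continuous_on UNIV f \<and> compactly_supported f}"

(* A function on X^n is a function on lists which vanishes off the lists of length n.
   sym_prod [f1,...,fn] is the symmetrization of the tensor product of f1, ..., fn. *)
definition sym_prod :: "('a \<Rightarrow> real) list \<Rightarrow> 'a list \<Rightarrow> real" where
  "sym_prod fs xs = (if length xs = length fs
     then (\<Sum>\<sigma> | \<sigma> permutes {..<length fs}. \<Prod>i<length fs. (fs ! \<sigma> i) (xs ! i)) / fact (length fs)
     else 0)"

(* For n = 0 these are the multiples of sym_prod [], i.e. the functions on the one-point set X^0,
   which are identified with the reals through their value at []. *)
definition sym_tensors :: "nat \<Rightarrow> ('a::euclidean_space list \<Rightarrow> real) set" where
  "sym_tensors n = {\<lambda>xs. \<Sum>i<k. c i * sym_prod (fs i) xs | (k::nat) c fs.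
     \<forall>i<k. fs i \<in> lists test_functions \<and> length (fs i) = n}"

type_synonym 'a fock = "nat \<Rightarrow> 'a list \<Rightarrow> real"

definition fock_fin :: "('a::euclidean_space) fock set" where
  "fock_fin = {F. (\<forall>n. F n \<in> sym_tensors n) \<and> (\<exists>N. \<forall>n>N. F n = (\<lambda>_. 0))}"

definition vacuum :: "'a fock" where
  "vacuum n xs = (if n = 0 \<and> xs = [] then 1 else 0)"

(* The linear map on sym_tensors n whose value at sym_prod [f1,...,fn] is g [f1,...,fn]. *)
definition linear_extension ::
  "nat \<Rightarrow> (('a::euclidean_space \<Rightarrow> real) list \<Rightarrow> 'a list \<Rightarrow> real) \<Rightarrow> ('a list \<Rightarrow> real) \<Rightarrow> 'a list \<Rightarrow> real"
  where
  "linear_extension n g = (THE T. T \<in> extensional (sym_tensors n) \<and>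
     (\<forall>f\<in>sym_tensors n. \<forall>h\<in>sym_tensors n. \<forall>a b.
        T (\<lambda>xs. a * f xs + b * h xs) = (\<lambda>xs. a * T f xs + b * T h xs)) \<and>
     (\<forall>fs\<in>lists test_functions. length fs = n \<longrightarrow> T (sym_prod fs) = g fs))"

definition a_plus :: "('a::euclidean_space \<Rightarrow> real) \<Rightarrow> 'a fock \<Rightarrow> 'a fock" where
  "a_plus \<phi> F n = (case n of 0 \<Rightarrow> (\<lambda>_. 0)
     | Suc m \<Rightarrow> linear_extension m (\<lambda>fs. sym_prod (\<phi> # fs)) (F m))"

definition a_zero :: "('a::euclidean_space \<Rightarrow> real) \<Rightarrow> 'a fock \<Rightarrow> 'a fock" where
  "a_zero \<phi> F n = linear_extension n
     (\<lambda>fs xs. \<Sum>i<length fs. sym_prod (fs[i := (\<lambda>x. \<phi> x * (fs ! i) x)]) xs) (F n)"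

(* nths fs (- J) is the list fs with the entries at the positions in J omitted. *)
definition a_minus1 :: "('a::euclidean_space \<Rightarrow> real) \<Rightarrow> 'a fock \<Rightarrow> 'a fock" where
  "a_minus1 \<phi> F n = linear_extension (Suc n)
     (\<lambda>fs xs. \<Sum>i<length fs. (\<integral>x. \<phi> x * (fs ! i) x \<partial>lborel) * sym_prod (nths fs (- {i})) xs)
     (F (Suc n))"

definition a_minus2 :: "('a::euclidean_space \<Rightarrow> real) \<Rightarrow> 'a fock \<Rightarrow> 'a fock" where
  "a_minus2 \<phi> F n = linear_extension (Suc n)
     (\<lambda>fs xs. \<Sum>i<length fs. \<Sum>j\<in>{..<length fs} - {i}.
        sym_prod ((\<lambda>x. \<phi> x * (fs ! i) x * (fs ! j) x) # nths fs (- {i, j})) xs)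
     (F (Suc n))"

definition R_hat :: "real \<Rightarrow> real \<Rightarrow> ('a::euclidean_space \<Rightarrow> real) \<Rightarrow> 'a fock \<Rightarrow> 'a fock" where
  "R_hat \<eta> \<kappa> \<phi> = (let \<beta> = sqrt (\<eta> + 1 / \<kappa>\<^sup>2) in
     (\<lambda>F\<in>fock_fin. \<lambda>n xs.
       a_plus \<phi> F n xs + (\<beta> + \<eta> / \<beta>) * a_zero \<phi> F n xs
       + a_minus1 \<phi> F n xs + \<eta> * a_minus2 \<phi> F n xs
       + (1 / \<beta>) * (\<integral>x. \<phi> x \<partial>lborel) * F n xs))"

definition rho :: "real \<Rightarrow> real \<Rightarrow> ('a::euclidean_space \<Rightarrow> real) \<Rightarrow> 'a fock \<Rightarrow> 'a fock" where
  "rho \<eta> \<kappa> \<phi> = (\<lambda>F\<in>fock_fin. \<lambda>n xs. \<kappa> * sqrt (1 + \<eta> * \<kappa>\<^sup>2) * R_hat \<eta> \<kappa> \<phi> F n xs)"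

(* The algebra is realized by operators on fock_fin (extensional functions there), with
   composition as product. *)
inductive_set density_algebra :: "real \<Rightarrow> real \<Rightarrow> (('a::euclidean_space) fock \<Rightarrow> 'a fock) set"
  for \<eta> \<kappa> :: real where
  const: "(\<lambda>F\<in>fock_fin. \<lambda>n xs. c * F n xs) \<in> density_algebra \<eta> \<kappa>"
| gen: "\<phi> \<in> test_functions \<Longrightarrow> rho \<eta> \<kappa> \<phi> \<in> density_algebra \<eta> \<kappa>"
| add: "r \<in> density_algebra \<eta> \<kappa> \<Longrightarrow> s \<in> density_algebra \<eta> \<kappa> \<Longrightarrow>
    (\<lambda>F\<in>fock_fin. \<lambda>n xs. r F n xs + s F n xs) \<in> density_algebra \<eta> \<kappa>"
| mult: "r \<in> density_algebra \<eta> \<kappa> \<Longrightarrow> s \<in> density_algebra \<eta> \<kappa> \<Longrightarrow>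
    compose fock_fin r s \<in> density_algebra \<eta> \<kappa>"

definition rho_prod :: "real \<Rightarrow> real \<Rightarrow> ('a::euclidean_space \<Rightarrow> real) list \<Rightarrow> 'a fock \<Rightarrow> 'a fock" where
  "rho_prod \<eta> \<kappa> fs = foldr (compose fock_fin) (map (rho \<eta> \<kappa>) fs) (\<lambda>F\<in>fock_fin. F)"

definition tau :: "('a fock \<Rightarrow> 'a fock) \<Rightarrow> real" where
  "tau r = r vacuum 0 []"

(* On a Euclidean space every Borel measure that is finite on compact sets is regular. *)
definition radon_measures :: "('a::euclidean_space) measure set" where
  "radon_measures = {\<mu>. sets \<mu> = sets borel \<and> (\<forall>K. compact K \<longrightarrow> emeasure \<mu> K < \<infinity>)}"

definition vague_topology :: "('a::euclidean_space) measure topology" where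
  "vague_topology = topology_generated_by
     {{\<mu> \<in> radon_measures. (\<integral>x. f x \<partial>\<mu>) \<in> U} | f U. f \<in> C_0 \<and> open U}"

definition vague_borel :: "('a::euclidean_space) measure measure" where
  "vague_borel = sigma radon_measures {U. openin vague_topology U}"

definition random_measure :: "'w measure \<Rightarrow> ('w \<Rightarrow> ('a::euclidean_space) measure) \<Rightarrow> bool" where
  "random_measure P \<gamma> \<longleftrightarrow> prob_space P \<and> \<gamma> \<in> P \<rightarrow>\<^sub>M vague_borel"

definition measure_valued_levy_process ::
  "'w measure \<Rightarrow> ('w \<Rightarrow> ('a::euclidean_space) measure) \<Rightarrow> bool" where
  "measure_valued_levy_process P \<gamma> \<longleftrightarrow> random_measure P \<gamma> \<and>
     (\<forall>(n::nat) A. (\<forall>i<n. A i \<in> sets borel \<and> bounded (A i)) \<and> disjoint_family_on A {..<n} \<longrightarrow>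
        prob_space.indep_vars P (\<lambda>_. borel) (\<lambda>i \<omega>. measure (\<gamma> \<omega>) (A i)) {..<n}) \<and>
     (\<forall>A\<in>sets borel. \<forall>B\<in>sets borel.
        bounded A \<and> bounded B \<and> emeasure lborel A = emeasure lborel B \<longrightarrow>
        distr P borel (\<lambda>\<omega>. measure (\<gamma> \<omega>) A) = distr P borel (\<lambda>\<omega>. measure (\<gamma> \<omega>) B))"

definition dirac_sum :: "'i set \<Rightarrow> ('i \<Rightarrow> real) \<Rightarrow> ('i \<Rightarrow> 'b::topological_space) \<Rightarrow> 'b measure" where
  "dirac_sum I a x = distr (density (count_space I) (\<lambda>i. ennreal (a i))) borel x"

lemma emeasure_dirac_sum:
  assumes "B \<in> sets borel"
  shows "emeasure (dirac_sum I a x) B = (\<integral>\<^sup>+i. ennreal (a i) * indicator B (x i) \<partial>count_space I)"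
proof -
  have "emeasure (dirac_sum I a x) B
      = (\<integral>\<^sup>+i. ennreal (a i) * indicator (x -` B \<inter> I) i \<partial>count_space I)"
    using assms by (simp add: dirac_sum_def emeasure_distr emeasure_density)
  also have "\<dots> = (\<integral>\<^sup>+i. ennreal (a i) * indicator B (x i) \<partial>count_space I)"
    by (intro nn_integral_cong) (auto simp: indicator_def)
  finally show ?thesis .
qed

definition point_process :: "'w measure \<Rightarrow> ('w \<Rightarrow> ('a::euclidean_space) measure) \<Rightarrow> bool" where
  "point_process P \<gamma> \<longleftrightarrow> random_measure P \<gamma> \<and>
     (AE \<omega> in P. \<exists>(I::nat set) (s::nat \<Rightarrow> nat) x. \<gamma> \<omega> = dirac_sum I (\<lambda>i. real (s i)) x)"

(* The integrals are Bochner integrals, which are 0 for non-integrable functions; as the right-hand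
   side is positive, the equation includes the integrability of exp <f, gamma>. *)
definition poisson_point_process ::
  "real \<Rightarrow> 'w measure \<Rightarrow> ('w \<Rightarrow> ('a::euclidean_space) measure) \<Rightarrow> bool" where
  "poisson_point_process z P \<gamma> \<longleftrightarrow> point_process P \<gamma> \<and>
     (\<forall>f\<in>C_0. (\<integral>\<omega>. exp (\<integral>x. f x \<partial>\<gamma> \<omega>) \<partial>P) = exp (\<integral>x. (exp (f x) - 1) * z \<partial>lborel))"

definition zeta_measure :: "real \<Rightarrow> real \<Rightarrow> real measure" where
  "zeta_measure \<eta> \<kappa> = dirac_sum {1..} (\<lambda>k::nat. 1 / \<eta> * (\<eta> / (\<eta> + 1 / \<kappa>\<^sup>2)) ^ k * (1 / real k)) real"

definition negative_binomial_process ::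
  "real \<Rightarrow> real \<Rightarrow> 'w measure \<Rightarrow> ('w \<Rightarrow> ('a::euclidean_space) measure) \<Rightarrow> bool" where
  "negative_binomial_process \<eta> \<kappa> P \<gamma> \<longleftrightarrow> measure_valued_levy_process P \<gamma> \<and>
     (\<forall>f\<in>C_0. (\<forall>x. f x \<le> 0) \<longrightarrow>
        (\<integral>\<omega>. exp (\<integral>x. f x \<partial>\<gamma> \<omega>) \<partial>P)
          = exp (\<integral>x. (\<integral>s\<in>{0<..}. (exp (s * f x) - 1) \<partial>zeta_measure \<eta> \<kappa>) \<partial>lborel))"

(* v stands for the volume m(A). *)
definition neg_binomial_distribution :: "real \<Rightarrow> real \<Rightarrow> real \<Rightarrow> real measure" where
  "neg_binomial_distribution \<eta> \<kappa> v = dirac_sum UNIV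
     (\<lambda>n::nat. (1 + \<kappa>\<^sup>2 * \<eta>) powr (- v / \<eta>)
        * ((\<eta> / (\<eta> + 1 / \<kappa>\<^sup>2)) ^ n * (pochhammer (v / \<eta>) n / fact n))) real"

end

theory Submission
  imports Defs "HOL-Computational_Algebra.Polynomial"
begin

text \<open>Up to the factor \<open>n!\<close>, a vector of the Fock space is a function of finite multisets, and on such functions
  the insertion operator \<open>W x G M = G M + \<beta> G (M + x)\<close> satisfies
  \<open>W x \<rho>(\<phi>) = \<rho>(\<phi>) W x + \<phi>(x) W x (1 + \<eta> \<kappa>\<^sup>2 W x)\<close>. Moving \<open>W\<close> to the vacuum gives a moment-cumulant
  recursion for \<open>\<tau>\<close>. The damped moments \<open>E (\<langle>f\<^sub>1, \<gamma>\<rangle> \<dots> \<langle>f\<^sub>n, \<gamma>\<rangle> exp (- \<langle>h, \<gamma>\<rangle>))\<close> of a random measure are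
  derivatives of its Laplace transform; for the Poisson and the negative binomial process the derivative of the
  Laplace exponent solves the Riccati equation behind the cumulants of \<open>\<tau>\<close>, so that at \<open>h = 0\<close> they satisfy the same
  recursion. This identifies \<open>\<tau>\<close> with an expectation, and existence of the processes gives positivity for
  \<open>\<eta> \<ge> 0\<close>. For \<open>\<eta> < 0\<close>, the vector \<open>f \<odot> f\<close> has the form \<open>r vacuum\<close>, and \<open>\<tau> (r\<^sup>2)\<close> is a positive multiple of
  \<open>(\<integral>f\<^sup>2)\<^sup>2 + \<eta> \<integral>f\<^sup>4\<close>, which is negative for \<open>f\<close> concentrated on a small ball.\<close>

subsection \<open>Test functions and continuous functions with compact support\<close>

text \<open>Three obstacles shape the argument. First, a Fock vector has many representations as a
  sum of products, so operators prescribed on products are realised by operators on functions of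
  multisets, where well-definedness is automatic and sums over permutations become permanents.
  Second, the negative binomial Laplace transform is given only for f <= 0 and comes without any
  moments. Derivatives are therefore taken along positive increments in nonnegative directions at a
  damping h >= 0, signed directions follow by linearity, and exponential moments are extracted from
  the law of the mass of a ball. Third, the vague Borel structure speaks directly only about
  continuous functions. The construction carries a finer sigma-algebra on which masses of Borel sets
  are measurable; for a given process their measurability comes from the independence clause, and
  their law from compact boxes approximated by continuous functions. The operator W has step \<beta>
  because \<open>\<kappa>\<^sup>2 * \<beta>\<^sup>2 = 1 + \<eta> * \<kappa>\<^sup>2\<close> closes
  its commutator with the density; the vacuum is fixed by W since it vanishes on nonempty
  multisets.\<close>

lemma C_k_Suc_imp: "C_k (Suc k) f \<Longrightarrow> C_k k f"
proof (induction k arbitrary: f)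
  case 0
  then show ?case
    by (auto intro!: continuous_at_imp_continuous_on differentiable_imp_continuous_within)
next
  case (Suc k)
  then show ?case by auto
qed

lemma C_k_add: "C_k k f \<Longrightarrow> C_k k g \<Longrightarrow> C_k k (\<lambda>x. f x + g x)"
proof (induction k arbitrary: f g)
  case 0
  then show ?case by (auto intro: continuous_intros)
next
  case (Suc k)
  have "frechet_derivative (\<lambda>x. f x + g x) (at x) b
      = frechet_derivative f (at x) b + frechet_derivative g (at x) b" for x b
    by (rule frechet_derivative_at[THEN fun_cong, symmetric, OF has_derivative_add])
      (use Suc.prems in \<open>auto simp: frechet_derivative_works[symmetric]\<close>)
  with Suc show ?case by (auto intro: differentiable_add)
qed

lemma C_k_mult: "C_k k f \<Longrightarrow> C_k k g \<Longrightarrow> C_k k (\<lambda>x. f x * g x)"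
proof (induction k arbitrary: f g)
  case 0
  then show ?case by (auto intro: continuous_intros)
next
  case (Suc k)
  have *: "frechet_derivative (\<lambda>x. f x * g x) (at x) b
      = f x * frechet_derivative g (at x) b + frechet_derivative f (at x) b * g x" for x b
    by (rule frechet_derivative_at[THEN fun_cong, symmetric, OF has_derivative_mult])
      (use Suc.prems in \<open>auto simp: frechet_derivative_works[symmetric]\<close>)
  have "C_k k f" "C_k k g"
    using Suc.prems C_k_Suc_imp by blast+
  with Suc show ?case
    by (auto simp: * intro!: C_k_add)
qed

lemma compactly_supported_iff: "compactly_supported f \<longleftrightarrow> bounded {x. f x \<noteq> 0}"
  by (simp add: compactly_supported_def)

lemma C_0_iff: "f \<in> C_0 \<longleftrightarrow> continuous_on UNIV f \<and> bounded {x. f x \<noteq> 0}"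
  by (simp add: C_0_def compactly_supported_iff)

lemma test_functions_iff: "f \<in> test_functions \<longleftrightarrow> (\<forall>k. C_k k f) \<and> bounded {x. f x \<noteq> 0}"
  by (simp add: test_functions_def compactly_supported_iff)

lemma test_functions_subset_C_0: "f \<in> test_functions \<Longrightarrow> f \<in> C_0"
  by (metis C_0_iff C_k.simps(1) test_functions_iff)

lemma test_functions_mult:
  "f \<in> test_functions \<Longrightarrow> g \<in> test_functions \<Longrightarrow> (\<lambda>x. f x * g x) \<in> test_functions"
  by (auto simp: test_functions_iff C_k_mult elim!: bounded_subset)

lemma C_0_mult_left: "f \<in> C_0 \<Longrightarrow> continuous_on UNIV g \<Longrightarrow> (\<lambda>x. f x * g x) \<in> C_0"
  by (auto simp: C_0_iff intro: continuous_intros elim!: bounded_subset)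

lemma C_0_mult: "f \<in> C_0 \<Longrightarrow> g \<in> C_0 \<Longrightarrow> (\<lambda>x. f x * g x) \<in> C_0"
  by (rule C_0_mult_left) (simp_all add: C_0_iff)

lemma C_0_cmult: "f \<in> C_0 \<Longrightarrow> (\<lambda>x. c * f x) \<in> C_0"
  by (auto simp: C_0_iff intro: continuous_intros elim!: bounded_subset)

lemma C_0_add: "f \<in> C_0 \<Longrightarrow> g \<in> C_0 \<Longrightarrow> (\<lambda>x. f x + g x) \<in> C_0"
  unfolding C_0_iff
  by (auto intro: continuous_intros bounded_subset[of "{x. f x \<noteq> 0} \<union> {x. g x \<noteq> 0}"])

lemma C_0_uminus: "f \<in> C_0 \<Longrightarrow> (\<lambda>x. - f x) \<in> C_0"
  by (auto simp: C_0_iff intro: continuous_intros)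

lemma C_0_abs: "f \<in> C_0 \<Longrightarrow> (\<lambda>x. \<bar>f x\<bar>) \<in> C_0"
  by (auto simp: C_0_iff intro: continuous_intros)

lemma C_0_zero: "(\<lambda>_. 0) \<in> C_0"
  by (simp add: C_0_iff)

lemma C_0_max_0: "f \<in> C_0 \<Longrightarrow> (\<lambda>x. max 0 (f x)) \<in> C_0"
  unfolding C_0_iff
  by (auto intro!: continuous_intros bounded_subset[of "{x. f x \<noteq> 0}"])

lemma C_0_sum_list: "(\<And>f. f \<in> set fs \<Longrightarrow> f \<in> C_0) \<Longrightarrow> (\<lambda>x. \<Sum>f\<leftarrow>fs. f x) \<in> C_0"
  by (induction fs) (simp_all add: C_0_zero C_0_add)

lemma C_0_bounded:
  assumes "f \<in> C_0"
  obtains C where "C > 0" "\<And>x. \<bar>f x\<bar> \<le> C"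
proof -
  have "compact (closure {x. f x \<noteq> 0})" "continuous_on (closure {x. f x \<noteq> 0}) f"
    using assms by (auto simp: C_0_iff intro: continuous_on_subset)
  then have "compact (f ` closure {x. f x \<noteq> 0})"
    by (rule compact_continuous_image[rotated])
  then obtain C where C: "C > 0" "\<And>x. x \<in> closure {x. f x \<noteq> 0} \<Longrightarrow> \<bar>f x\<bar> \<le> C"
    unfolding real_norm_def[symmetric] by (auto dest!: compact_imp_bounded simp: bounded_pos)
  have "\<bar>f x\<bar> \<le> C" for x
    by (cases "f x = 0") (use C closure_subset[of "{x. f x \<noteq> 0}"] in auto)
  with C that show thesis by blast
qed

lemma C_0_borel_measurable [measurable_dest]: "f \<in> C_0 \<Longrightarrow> f \<in> borel_measurable borel"
  by (auto simp: C_0_iff intro: borel_measurable_continuous_onI)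

lemma C_0_integrable_radon:
  assumes f: "f \<in> C_0" and \<mu>: "\<mu> \<in> radon_measures"
  shows "integrable \<mu> f"
proof -
  obtain C where C: "C > 0" "\<And>x. \<bar>f x\<bar> \<le> C"
    using C_0_bounded[OF f] by blast
  let ?K = "closure {x. f x \<noteq> 0}"
  have K: "compact ?K" "?K \<in> sets \<mu>" "emeasure \<mu> ?K < \<infinity>" and s: "sets \<mu> = sets borel"
    using f \<mu> by (auto simp: C_0_iff radon_measures_def)
  have "integrable \<mu> (\<lambda>x. C * indicator ?K x)"
    using K by simp
  moreover have "f \<in> borel_measurable \<mu>"
    using C_0_borel_measurable[OF f] s by (simp cong: measurable_cong_sets)
  moreover have "AE x in \<mu>. norm (f x) \<le> norm (C * indicator ?K x)"
  proof (intro AE_I2)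
    fix x show "norm (f x) \<le> norm (C * indicator ?K x)"
      using C closure_subset[of "{x. f x \<noteq> 0}"] by (cases "f x = 0") auto
  qed
  ultimately show ?thesis
    by (rule Bochner_Integration.integrable_bound)
qed

lemma lborel_radon: "lborel \<in> radon_measures"
  using emeasure_bounded_finite[OF compact_imp_bounded] by (auto simp: radon_measures_def)

lemma C_0_integrable_lborel: "f \<in> C_0 \<Longrightarrow> integrable lborel f"
  by (rule C_0_integrable_radon[OF _ lborel_radon])

subsection \<open>Permanents and symmetric tensors\<close>

text \<open>The permanent of the matrix of values of the functions at the points, expanded along the
  first function. Taking the points as a multiset builds in the symmetry in the points.\<close>

primrec permanent :: "('a \<Rightarrow> real) list \<Rightarrow> 'a multiset \<Rightarrow> real" where
  "permanent [] M = (if M = {#} then 1 else 0)"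
| "permanent (f # fs) M = (\<Sum>x\<in>#M. f x * permanent fs (M - {#x#}))"

lemma permanent_eq_0: "size M \<noteq> length fs \<Longrightarrow> permanent fs M = 0"
proof (induction fs arbitrary: M)
  case (Cons f fs)
  have "(\<Sum>x\<in>#M. f x * permanent fs (M - {#x#})) = (\<Sum>x\<in>#M. 0)"
  proof (intro arg_cong[where f = sum_mset] image_mset_cong)
    fix x assume "x \<in># M"
    then show "f x * permanent fs (M - {#x#}) = 0"
      using Cons by (cases M) (auto simp: size_Diff_singleton)
  qed
  then show ?case by simp
qed auto

lemma sum_mset_diff:
  fixes f g :: "'a \<Rightarrow> 'b::ab_group_add"
  shows "(\<Sum>x\<in>#M. f x - g x) = (\<Sum>x\<in>#M. f x) - (\<Sum>x\<in>#M. g x)"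
  by (induction M) simp_all

lemma sum_mset_sum: "(\<Sum>x\<in>#M. \<Sum>i\<in>A. h x i) = (\<Sum>i\<in>A. \<Sum>x\<in>#M. h x i)"
  by (induction M) (simp_all add: sum.distrib)

text \<open>Adding the diagonal terms \<open>h x x\<close> completes both sides to full double sums,
  where the order of summation can be exchanged.\<close>

lemma sum_mset_remove_swap:
  fixes h :: "'a \<Rightarrow> 'a \<Rightarrow> real"
  shows "(\<Sum>x\<in>#M. \<Sum>y\<in>#M - {#x#}. h x y) = (\<Sum>x\<in>#M. \<Sum>y\<in>#M - {#x#}. h y x)"
proof -
  have *: "(\<Sum>x\<in>#M. \<Sum>y\<in>#M - {#x#}. h x y) = (\<Sum>x\<in>#M. \<Sum>y\<in>#M. h x y) - (\<Sum>x\<in>#M. h x x)"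
    for h :: "'a \<Rightarrow> 'a \<Rightarrow> real"
  proof -
    have "(\<Sum>x\<in>#M. \<Sum>y\<in>#M - {#x#}. h x y) = (\<Sum>x\<in>#M. (\<Sum>y\<in>#M. h x y) - h x x)"
    proof (intro arg_cong[where f = sum_mset] image_mset_cong)
      fix x assume "x \<in># M"
      then have "(\<Sum>y\<in>#M. h x y) = h x x + (\<Sum>y\<in>#M - {#x#}. h x y)"
        by (metis insert_DiffM image_mset_add_mset sum_mset.add_mset)
      then show "(\<Sum>y\<in>#M - {#x#}. h x y) = (\<Sum>y\<in>#M. h x y) - h x x" by simp
    qed
    also have "\<dots> = (\<Sum>x\<in>#M. \<Sum>y\<in>#M. h x y) - (\<Sum>x\<in>#M. h x x)"
      by (rule sum_mset_diff)
    finally show ?thesis .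
  qed
  show ?thesis
    unfolding * by (simp add: sum_mset.swap[of h])
qed

text \<open>Expansion along the last function instead of the first: this is the form that matches
  the recursion for permutations, which splits off the largest index.\<close>

lemma permanent_snoc: "permanent (fs @ [f]) M = (\<Sum>x\<in>#M. f x * permanent fs (M - {#x#}))"
proof (induction fs arbitrary: M)
  case (Cons g fs)
  have "permanent ((g # fs) @ [f]) M
      = (\<Sum>x\<in>#M. \<Sum>y\<in>#M - {#x#}. g x * f y * permanent fs (M - {#x#} - {#y#}))"
    by (simp add: Cons sum_mset_distrib_left mult.assoc)
  also have "\<dots> = (\<Sum>x\<in>#M. \<Sum>y\<in>#M - {#x#}. g y * f x * permanent fs (M - {#y#} - {#x#}))"
    by (rule sum_mset_remove_swap)
  also have "\<dots> = (\<Sum>x\<in>#M. f x * permanent (g # fs) (M - {#x#}))"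
    by (simp add: sum_mset_distrib_left mult_ac add_mset_commute)
  finally show ?case .
qed (auto simp: single_is_union)

lemma sum_mset_mset_conv_nth: "(\<Sum>x\<in>#mset xs. h x) = (\<Sum>i<length xs. h (xs ! i))"
proof -
  have "(\<Sum>x\<in>#mset xs. h x) = sum_list (map h xs)"
    by (simp flip: sum_mset_sum_list)
  then show ?thesis
    by (simp add: sum_list_sum_nth atLeast0LessThan)
qed

text \<open>Passing to inverse permutations lets them act on the points. Each permutation of
  \<open>{..<Suc m}\<close> is uniquely a transposition of \<open>m\<close> and some
  \<open>b\<close> composed with a permutation of \<open>{..<m}\<close>; here \<open>b\<close> is
  the position of the point assigned to the last function.\<close>

lemma sum_permutes_eq_permanent:
  assumes "length fs = n" "length xs = n"
  shows "(\<Sum>\<sigma> | \<sigma> permutes {..<n}. \<Prod>i<n. (fs ! \<sigma> i) (xs ! i)) = permanent fs (mset xs)"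
proof -
  have "(\<Sum>\<sigma> | \<sigma> permutes {..<n}. \<Prod>i<n. (fs ! \<sigma> i) (xs ! i))
      = (\<Sum>\<sigma> | \<sigma> permutes {..<n}. \<Prod>i<n. (fs ! inv \<sigma> i) (xs ! i))"
    by (rule sum_permutations_inverse)
  also have "\<dots> = (\<Sum>\<sigma> | \<sigma> permutes {..<n}. \<Prod>i<n. (fs ! i) (xs ! \<sigma> i))"
  proof (intro sum.cong refl)
    fix \<sigma> assume "\<sigma> \<in> {\<sigma>. \<sigma> permutes {..<n}}"
    then have s: "\<sigma> permutes {..<n}" by simp
    show "(\<Prod>i<n. (fs ! inv \<sigma> i) (xs ! i)) = (\<Prod>i<n. (fs ! i) (xs ! \<sigma> i))"
      by (subst prod.permute[OF s]) (simp add: permutes_inverses[OF s])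
  qed
  also have "\<dots> = permanent fs (mset xs)"
    using assms
  proof (induction fs arbitrary: n xs rule: rev_induct)
    case (snoc f fs)
    define m where "m = length fs"
    have n: "n = Suc m" and xs: "length xs = Suc m"
      using snoc.prems by (auto simp: m_def)
    \<comment> \<open>The points left after \<open>xs ! b\<close> is used: the last point moves into
      the vacated slot \<open>b\<close>, and the last slot is dropped.\<close>
    define ys where "ys b = take m (xs[b := xs ! m])" for b
    have mset_ys: "mset (ys b) = mset xs - {#xs ! b#}" if "b < Suc m" for b
    proof -
      have "xs[b := xs ! m] = ys b @ [xs ! m]"
        using take_Suc_conv_app_nth[of m "xs[b := xs ! m]"] that xs
        by (cases "b = m") (auto simp: ys_def)
      then have "add_mset (xs ! m) (mset (ys b)) = mset (xs[b := xs ! m])" by simp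
      also have "\<dots> = add_mset (xs ! m) (mset xs - {#xs ! b#})"
        using that xs by (simp add: mset_update)
      finally show ?thesis by simp
    qed
    have ins: "{..<Suc m} = insert m {..<m}" by auto
    have "(\<Sum>\<sigma> | \<sigma> permutes {..<n}. \<Prod>i<n. ((fs @ [f]) ! i) (xs ! \<sigma> i))
        = (\<Sum>b\<in>insert m {..<m}. \<Sum>q | q permutes {..<m}.
             \<Prod>i<Suc m. ((fs @ [f]) ! i) (xs ! (Transposition.transpose m b \<circ> q) i))"
      unfolding n ins by (rule sum_over_permutations_insert) auto
    also have "\<dots> = (\<Sum>b<Suc m. \<Sum>q | q permutes {..<m}.
             f (xs ! b) * (\<Prod>i<m. (fs ! i) (ys b ! q i)))"
      unfolding ins[symmetric]
    proof (intro sum.cong refl)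
      fix b q assume b: "b \<in> {..<Suc m}" and "q \<in> {q. q permutes {..<m}}"
      then have q: "q permutes {..<m}" by simp
      have "q m = m" using q by (simp add: permutes_def)
      moreover have "((fs @ [f]) ! i) (xs ! (Transposition.transpose m b \<circ> q) i) = (fs ! i) (ys b ! q i)"
        if "i < m" for i
      proof -
        have "q i < m" using permutes_in_image[OF q] that by auto
        then show ?thesis
          using that b xs by (auto simp: ys_def nth_append m_def Transposition.transpose_def nth_list_update)
      qed
      ultimately show "(\<Prod>i<Suc m. ((fs @ [f]) ! i) (xs ! (Transposition.transpose m b \<circ> q) i))
          = f (xs ! b) * (\<Prod>i<m. (fs ! i) (ys b ! q i))"
        by (simp add: m_def nth_append)
    qed
    also have "\<dots> = (\<Sum>b<Suc m. f (xs ! b) * permanent fs (mset (ys b)))"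
      using snoc.IH[of m] xs by (simp add: sum_distrib_left[symmetric] ys_def m_def del: sum.lessThan_Suc)
    also have "\<dots> = (\<Sum>b<Suc m. f (xs ! b) * permanent fs (mset xs - {#xs ! b#}))"
      by (intro sum.cong refl) (simp add: mset_ys)
    also have "\<dots> = permanent (fs @ [f]) (mset xs)"
      using xs by (simp add: permanent_snoc sum_mset_mset_conv_nth del: sum.lessThan_Suc)
    finally show ?case .
  qed simp
  finally show ?thesis .
qed

lemma sym_prod_eq_permanent:
  "sym_prod fs xs = (if length xs = length fs then permanent fs (mset xs) / fact (length fs) else 0)"
  unfolding sym_prod_def using sum_permutes_eq_permanent[of fs "length fs" xs] by presburger

lemma sum_mset_add_mset_remove:
  "(\<Sum>y\<in>#M. f y * h (add_mset x M - {#y#})) = (\<Sum>y\<in>#M. f y * h (add_mset x (M - {#y#})))"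
proof (intro arg_cong[where f = sum_mset] image_mset_cong)
  fix y assume "y \<in># M"
  then obtain N where N: "M = add_mset y N"
    by (rule mset_add)
  have "add_mset x M - {#y#} = add_mset x (M - {#y#})"
    unfolding N add_mset_commute[of x y] by simp
  then show "f y * h (add_mset x M - {#y#}) = f y * h (add_mset x (M - {#y#}))"
    by (rule arg_cong)
qed

text \<open>Expansion along the new point: some function takes \<open>x\<close>, the others fill
  \<open>M\<close>. Selecting by a set of positions of the original list lets the expansion be
  iterated for a second point without renumbering.\<close>

lemma permanent_nths_add_mset:
  "permanent (nths fs I) (add_mset x M)
     = (\<Sum>j | j < length fs \<and> j \<in> I. (fs ! j) x * permanent (nths fs (I - {j})) M)"
proof (induction fs arbitrary: I M)
  case (Cons f fs)
  define I' where "I' = {j. Suc j \<in> I}"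
  have I': "nths (f # fs) (I - {Suc j}) = (if 0 \<in> I then [f] else []) @ nths fs (I' - {j})"
    "{k. Suc k \<in> I - {0}} = I'" for j
    by (auto simp: nths_Cons I'_def intro!: arg_cong[where f = "nths fs"])
  have set_eq: "{j. j < length (f # fs) \<and> j \<in> I}
      = (if 0 \<in> I then {0} else {}) \<union> Suc ` {j. j < length fs \<and> j \<in> I'}"
    by (auto simp: I'_def image_iff less_Suc_eq_0_disj)
  have "(\<Sum>j | j < length (f # fs) \<and> j \<in> I. ((f # fs) ! j) x * permanent (nths (f # fs) (I - {j})) M)
      = (if 0 \<in> I then f x * permanent (nths fs I') M else 0)
        + (\<Sum>j | j < length fs \<and> j \<in> I'. (fs ! j) x
            * permanent ((if 0 \<in> I then [f] else []) @ nths fs (I' - {j})) M)"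
    unfolding set_eq by (subst sum.union_disjoint) (auto simp: sum.reindex I', simp add: nths_Cons I'_def)
  also have "\<dots> = permanent (nths (f # fs) I) (add_mset x M)"
  proof (cases "0 \<in> I")
    case True
    have "permanent (nths (f # fs) I) (add_mset x M)
        = f x * permanent (nths fs I') M + (\<Sum>y\<in>#M. f y * permanent (nths fs I') (add_mset x (M - {#y#})))"
      using True by (simp add: nths_Cons I'_def sum_mset_add_mset_remove)
    also have "(\<Sum>y\<in>#M. f y * permanent (nths fs I') (add_mset x (M - {#y#})))
       = (\<Sum>j | j < length fs \<and> j \<in> I'. (fs ! j) x * (\<Sum>y\<in>#M. f y * permanent (nths fs (I' - {j})) (M - {#y#})))"
      unfolding Cons by (simp add: sum_distrib_left sum_mset_distrib_left mult_ac sum_mset_sum)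
    finally show ?thesis using True by simp
  next
    case False
    then show ?thesis by (simp add: Cons nths_Cons I'_def)
  qed
  finally show ?case by simp
qed simp

lemma permanent_add_mset:
  "permanent fs (add_mset x M) = (\<Sum>j<length fs. (fs ! j) x * permanent (nths fs (- {j})) M)"
  using permanent_nths_add_mset[of fs UNIV] by (simp add: nths_all lessThan_def Compl_eq_Diff_UNIV)

lemma permanent_add_mset2:
  "permanent fs (add_mset x (add_mset y M)) = (\<Sum>i<length fs. \<Sum>j\<in>{..<length fs} - {i}.
     (fs ! i) x * (fs ! j) y * permanent (nths fs (- {i, j})) M)"
proof -
  have "{j. j < length fs \<and> j \<in> - {i}} = {..<length fs} - {i}" "- {i} - {j} = - {i, j}" for i j :: nat
    by auto
  then show ?thesis
    unfolding permanent_add_mset[of fs x "add_mset y M"] permanent_nths_add_mset sum_distrib_left mult.assoc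
    by simp
qed

text \<open>Each term of the permanent assigns every point to exactly one function, so the inserted
  factors \<phi> add up to the sum of \<phi> over all points.\<close>

lemma permanent_mult_each:
  "(\<Sum>i<length fs. permanent (fs[i := (\<lambda>x. \<phi> x * (fs ! i) x)]) M) = (\<Sum>x\<in>#M. \<phi> x) * permanent fs M"
proof (induction fs arbitrary: M)
  case (Cons f fs)
  have "(\<Sum>i<length (f # fs). permanent ((f # fs)[i := (\<lambda>x. \<phi> x * ((f # fs) ! i) x)]) M)
     = (\<Sum>x\<in>#M. \<phi> x * f x * permanent fs (M - {#x#}))
       + (\<Sum>x\<in>#M. f x * (\<Sum>i<length fs. permanent (fs[i := (\<lambda>x. \<phi> x * (fs ! i) x)]) (M - {#x#})))"
    by (simp add: sum.lessThan_Suc_shift sum_distrib_left sum_mset_sum del: sum.lessThan_Suc)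
  also have "\<dots> = (\<Sum>x\<in>#M. (\<phi> x + (\<Sum>y\<in>#M - {#x#}. \<phi> y)) * (f x * permanent fs (M - {#x#})))"
    by (simp add: Cons algebra_simps sum_mset.distrib)
  also have "\<dots> = (\<Sum>x\<in>#M. (\<Sum>y\<in>#M. \<phi> y) * (f x * permanent fs (M - {#x#})))"
  proof (intro arg_cong[where f = sum_mset] image_mset_cong)
    fix x assume "x \<in># M"
    then have "(\<Sum>y\<in>#M. \<phi> y) = \<phi> x + (\<Sum>y\<in>#M - {#x#}. \<phi> y)"
      by (metis insert_DiffM image_mset_add_mset sum_mset.add_mset)
    then show "(\<phi> x + (\<Sum>y\<in>#M - {#x#}. \<phi> y)) * (f x * permanent fs (M - {#x#}))
        = (\<Sum>y\<in>#M. \<phi> y) * (f x * permanent fs (M - {#x#}))" by simp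
  qed
  finally show ?case by (simp add: sum_mset_distrib_left)
qed simp

text \<open>A formal combination is a list of coefficients and indices. One and the same list can be
  evaluated on products, on permanents and on their images under an operator, and linearity
  arguments pass between these evaluations.\<close>

definition lincomb :: "(real \<times> 'b) list \<Rightarrow> ('b \<Rightarrow> 'c \<Rightarrow> real) \<Rightarrow> 'c \<Rightarrow> real" where
  "lincomb L h y = (\<Sum>(c, b)\<leftarrow>L. c * h b y)"

lemma lincomb_Nil [simp]: "lincomb [] h = (\<lambda>_. 0)"
  and lincomb_Cons [simp]: "lincomb ((c, b) # L) h = (\<lambda>y. c * h b y + lincomb L h y)"
  and lincomb_append: "lincomb (L @ L') h = (\<lambda>y. lincomb L h y + lincomb L' h y)"
  by (auto simp: lincomb_def)

lemma lincomb_scale: "lincomb (map (\<lambda>(c, b). (a * c, b)) L) h = (\<lambda>y. a * lincomb L h y)"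
  by (induction L) (auto simp: algebra_simps)

lemma snd_set_scale [simp]: "snd ` set (map (\<lambda>(c, b). (a * c, b)) L) = snd ` set L"
  by (induction L) auto

definition test_lists :: "nat \<Rightarrow> ('a::euclidean_space \<Rightarrow> real) list set" where
  "test_lists n = {fs \<in> lists test_functions. length fs = n}"

lemma sym_tensors_eq_lincomb:
  "sym_tensors n = {lincomb L sym_prod | L. snd ` set L \<subseteq> test_lists n}" (is "_ = ?R")
proof (intro equalityI subsetI)
  fix f :: "'a list \<Rightarrow> real" assume "f \<in> sym_tensors n"
  then obtain k :: nat and c fs where f: "f = (\<lambda>xs. \<Sum>i<k. c i * sym_prod (fs i) xs)"
    and fs: "\<forall>i<k. fs i \<in> lists test_functions \<and> length (fs i) = n"
    unfolding sym_tensors_def by blast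
  have "f = lincomb (map (\<lambda>i. (c i, fs i)) [0..<k]) sym_prod"
    by (auto simp: f lincomb_def o_def interv_sum_list_conv_sum_set_nat atLeast0LessThan)
  moreover have "snd ` set (map (\<lambda>i. (c i, fs i)) [0..<k]) \<subseteq> test_lists n"
    using fs by (auto simp: test_lists_def)
  ultimately show "f \<in> ?R" by blast
next
  fix f assume "f \<in> ?R"
  then obtain L where f: "f = lincomb L sym_prod" and L: "snd ` set L \<subseteq> test_lists n"
    by blast
  have "f = (\<lambda>xs. \<Sum>i<length L. fst (L ! i) * sym_prod (snd (L ! i)) xs)"
    by (auto simp: f lincomb_def sum_list_sum_nth atLeast0LessThan case_prod_beta)
  moreover have "\<forall>i<length L. snd (L ! i) \<in> lists test_functions \<and> length (snd (L ! i)) = n"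
    using L by (auto simp: test_lists_def dest!: nth_mem)
  ultimately show "f \<in> sym_tensors n"
    unfolding sym_tensors_def
    by (intro CollectI exI[of _ "length L"] exI[of _ "\<lambda>i. fst (L ! i)"] exI[of _ "\<lambda>i. snd (L ! i)"] conjI)
qed

lemma sym_tensors_lincomb_closed:
  assumes "f \<in> sym_tensors n" "h \<in> sym_tensors n"
  shows "(\<lambda>xs. a * f xs + b * h xs) \<in> sym_tensors n"
proof -
  obtain L L' where L: "f = lincomb L sym_prod" "snd ` set L \<subseteq> test_lists n"
    "h = lincomb L' sym_prod" "snd ` set L' \<subseteq> test_lists n"
    using assms unfolding sym_tensors_eq_lincomb by blast
  have "(\<lambda>xs. a * f xs + b * h xs)
      = lincomb (map (\<lambda>(c, fs). (a * c, fs)) L @ map (\<lambda>(c, fs). (b * c, fs)) L') sym_prod"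
    by (simp add: lincomb_append lincomb_scale L)
  moreover have "snd ` set (map (\<lambda>(c, fs). (a * c, fs)) L @ map (\<lambda>(c, fs). (b * c, fs)) L') \<subseteq> test_lists n"
    using L(2,4) by (simp add: image_Un del: set_map)
  ultimately show ?thesis
    unfolding sym_tensors_eq_lincomb by blast
qed

lemma zero_sym_tensors: "(\<lambda>_. 0) \<in> sym_tensors n"
  unfolding sym_tensors_eq_lincomb by (rule CollectI, rule exI[of _ "[]"]) simp

lemma sym_tensors_add: "f \<in> sym_tensors n \<Longrightarrow> h \<in> sym_tensors n \<Longrightarrow> (\<lambda>xs. f xs + h xs) \<in> sym_tensors n"
  using sym_tensors_lincomb_closed[of f n h 1 1] by simp

lemma sym_tensors_cmult: "f \<in> sym_tensors n \<Longrightarrow> (\<lambda>xs. a * f xs) \<in> sym_tensors n"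
  using sym_tensors_lincomb_closed[of f n f a 0] by simp

lemma sym_tensors_sum: "(\<And>i. i \<in> I \<Longrightarrow> f i \<in> sym_tensors n) \<Longrightarrow> (\<lambda>xs. \<Sum>i\<in>I. f i xs) \<in> sym_tensors n"
  by (induction I rule: infinite_finite_induct) (auto intro: zero_sym_tensors sym_tensors_add)

lemma sym_tensors_lincomb: "(\<And>b. b \<in> snd ` set L \<Longrightarrow> h b \<in> sym_tensors n) \<Longrightarrow> lincomb L h \<in> sym_tensors n"
  by (induction L) (auto intro!: zero_sym_tensors sym_tensors_add sym_tensors_cmult)

lemma sym_prod_in_sym_tensors: "fs \<in> test_lists n \<Longrightarrow> sym_prod fs \<in> sym_tensors n"
  unfolding sym_tensors_eq_lincomb by (rule CollectI, rule exI[of _ "[(1, fs)]"]) simp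

text \<open>The factor \<open>fact n\<close> undoes the normalisation of \<open>sym_prod\<close>, so
  that products correspond to permanents. The chosen enumeration does not matter for symmetric
  tensors, which depend on a list only through its multiset.\<close>

definition mset_fun :: "nat \<Rightarrow> ('a list \<Rightarrow> real) \<Rightarrow> 'a multiset \<Rightarrow> real" where
  "mset_fun n f M = (if size M = n then fact n * f (SOME xs. mset xs = M) else 0)"

lemma mset_fun_lincomb:
  assumes "snd ` set L \<subseteq> test_lists n"
  shows "mset_fun n (lincomb L sym_prod) = lincomb L permanent"
proof
  fix M :: "'a multiset"
  define xs where "xs = (SOME xs. mset xs = M)"
  have xs: "mset xs = M" unfolding xs_def using ex_mset[of M] by (rule someI_ex)
  then have len: "length xs = size M" by auto
  show "mset_fun n (lincomb L sym_prod) M = lincomb L permanent M"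
  proof (cases "size M = n")
    case True
    then have "fact n * lincomb L sym_prod xs = lincomb L permanent M"
      using assms by (induction L) (auto simp: sym_prod_eq_permanent len xs test_lists_def algebra_simps)
    with True show ?thesis by (simp add: mset_fun_def xs_def)
  next
    case False
    then have "lincomb L permanent M = 0"
      using assms by (induction L) (auto simp: permanent_eq_0 test_lists_def)
    with False show ?thesis by (simp add: mset_fun_def)
  qed
qed

text \<open>A map given on the products \<^term>\<open>sym_prod fs\<close> extends linearly as soon as it is induced by some
  linear operator on functions of multisets.\<close>

lemma
  fixes A :: "('a::euclidean_space multiset \<Rightarrow> real) \<Rightarrow> 'a multiset \<Rightarrow> real"
  assumes lin: "\<And>L. snd ` set L \<subseteq> test_lists n \<Longrightarrow> A (lincomb L permanent) = lincomb L (\<lambda>fs. A (permanent fs))"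
    and A: "\<And>fs xs. fs \<in> test_lists n \<Longrightarrow> g fs xs = (if length xs = m then A (permanent fs) (mset xs) / fact m else 0)"
  shows linear_extension_lincomb:
      "snd ` set L \<subseteq> test_lists n \<Longrightarrow> linear_extension n g (lincomb L sym_prod) = lincomb L g"
    and linear_extension_eq: "f \<in> sym_tensors n \<Longrightarrow>
      linear_extension n g f = (\<lambda>xs. if length xs = m then A (mset_fun n f) (mset xs) / fact m else 0)"
proof -
  \<comment> \<open>The candidate reads off \<open>f\<close> itself through \<open>mset_fun\<close>,
    so no representation of \<open>f\<close> as a combination of products has to be chosen.\<close>
  define T where "T = (\<lambda>f\<in>sym_tensors n. \<lambda>xs. if length xs = m then A (mset_fun n f) (mset xs) / fact m else 0)"
  have T: "T (lincomb L sym_prod) = lincomb L g" if L: "snd ` set L \<subseteq> test_lists n" for L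
  proof
    fix xs
    have "lincomb L sym_prod \<in> sym_tensors n"
      using L unfolding sym_tensors_eq_lincomb by blast
    then have "T (lincomb L sym_prod) xs = (if length xs = m then lincomb L (\<lambda>fs. A (permanent fs)) (mset xs) / fact m else 0)"
      by (simp add: T_def mset_fun_lincomb L lin)
    also have "\<dots> = lincomb L g xs"
      using L by (induction L) (auto simp: A add_divide_distrib split: if_splits)
    finally show "T (lincomb L sym_prod) xs = lincomb L g xs" .
  qed
  let ?P = "\<lambda>T. T \<in> extensional (sym_tensors n) \<and>
     (\<forall>f\<in>sym_tensors n. \<forall>h\<in>sym_tensors n. \<forall>a b.
        T (\<lambda>xs. a * f xs + b * h xs) = (\<lambda>xs. a * T f xs + b * T h xs)) \<and>
     (\<forall>fs\<in>lists test_functions. length fs = n \<longrightarrow> T (sym_prod fs) = g fs)"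
  have PT: "?P T"
  proof (intro conjI ballI allI impI)
    show "T \<in> extensional (sym_tensors n)" by (simp add: T_def)
  next
    fix f h :: "'a list \<Rightarrow> real" and a b :: real assume "f \<in> sym_tensors n" "h \<in> sym_tensors n"
    then obtain L L' where L: "f = lincomb L sym_prod" "snd ` set L \<subseteq> test_lists n"
      "h = lincomb L' sym_prod" "snd ` set L' \<subseteq> test_lists n"
      unfolding sym_tensors_eq_lincomb by blast
    let ?L = "map (\<lambda>(c, fs). (a * c, fs)) L @ map (\<lambda>(c, fs). (b * c, fs)) L'"
    have "(\<lambda>xs. a * f xs + b * h xs) = lincomb ?L sym_prod"
      by (simp add: lincomb_append lincomb_scale L)
    moreover have "snd ` set ?L \<subseteq> test_lists n"
      using L(2,4) by (simp add: image_Un del: set_map)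
    ultimately have "T (\<lambda>xs. a * f xs + b * h xs) = lincomb ?L g"
      by (simp only: T)
    then show "T (\<lambda>xs. a * f xs + b * h xs) = (\<lambda>xs. a * T f xs + b * T h xs)"
      using T[OF L(2)] T[OF L(4)] by (simp add: L(1,3) lincomb_append lincomb_scale)
  next
    fix fs :: "('a \<Rightarrow> real) list" assume "fs \<in> lists test_functions" "length fs = n"
    then show "T (sym_prod fs) = g fs"
      using T[of "[(1, fs)]"] by (simp add: test_lists_def)
  qed
  \<comment> \<open>Uniqueness for the definite description: linearity and the values on products
    fix the map on every combination, by induction on the list.\<close>
  have "T' = T" if P: "?P T'" for T'
  proof (rule extensionalityI)
    show "T' \<in> extensional (sym_tensors n)" "T \<in> extensional (sym_tensors n)"
      using P PT by blast+
    fix f :: "'a list \<Rightarrow> real" assume "f \<in> sym_tensors n"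
    then obtain L where L: "f = lincomb L sym_prod" "snd ` set L \<subseteq> test_lists n"
      unfolding sym_tensors_eq_lincomb by blast
    have lin': "T' (\<lambda>xs. a * f xs + b * h xs) = (\<lambda>xs. a * T' f xs + b * T' h xs)"
      if "f \<in> sym_tensors n" "h \<in> sym_tensors n" for f h a b
      using P that by blast
    have "T' (lincomb L sym_prod) = lincomb L g"
      using L(2)
    proof (induction L)
      case Nil
      then show ?case
        using lin'[OF zero_sym_tensors zero_sym_tensors, of 0 0] by simp
    next
      case (Cons p L)
      obtain c fs where p: "p = (c, fs)" by fastforce
      have fs: "fs \<in> test_lists n" and L: "snd ` set L \<subseteq> test_lists n"
        using Cons.prems by (auto simp: p)
      have "lincomb L sym_prod \<in> sym_tensors n"
        using L unfolding sym_tensors_eq_lincomb by blast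
      moreover have "T' (sym_prod fs) = g fs"
        using P fs by (auto simp: test_lists_def)
      ultimately show ?case
        using lin'[OF sym_prod_in_sym_tensors[OF fs], of "lincomb L sym_prod" c 1] Cons.IH[OF L]
        by (simp add: p)
    qed
    then show "T' f = T f" by (simp add: L T)
  qed
  with PT have eq: "linear_extension n g = T"
    unfolding linear_extension_def by (rule the_equality)
  show "linear_extension n g (lincomb L sym_prod) = lincomb L g" if "snd ` set L \<subseteq> test_lists n"
    using T[OF that] by (simp add: eq)
  show "linear_extension n g f = (\<lambda>xs. if length xs = m then A (mset_fun n f) (mset xs) / fact m else 0)"
    if "f \<in> sym_tensors n"
    using that by (simp add: eq T_def)
qed

subsection \<open>The field operators on functions of multisets\<close>

text \<open>The integrability that makes the contraction term linear, since Bochner integrals of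
  non-integrable functions are 0. Quantifying over all \<open>M\<close> makes the class stable under
  inserting a fixed point.\<close>

definition contractible :: "('a::euclidean_space multiset \<Rightarrow> real) set" where
  "contractible = {G. \<forall>M. \<forall>\<phi>\<in>C_0. integrable lborel (\<lambda>y. \<phi> y * G (add_mset y M))}"

lemma contractibleD: "G \<in> contractible \<Longrightarrow> \<phi> \<in> C_0 \<Longrightarrow> integrable lborel (\<lambda>y. \<phi> y * G (add_mset y M))"
  by (auto simp: contractible_def)

lemma contractible_lincomb: "(\<And>b. b \<in> snd ` set L \<Longrightarrow> h b \<in> contractible) \<Longrightarrow> lincomb L h \<in> contractible"
proof (induction L)
  case (Cons p L)
  obtain c b where p: "p = (c, b)" by fastforce
  have "h b \<in> contractible" "lincomb L h \<in> contractible"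
    using Cons by (auto simp: p)
  then show ?case
    by (auto simp: p contractible_def distrib_left mult.left_commute[of _ c])
qed (auto simp: contractible_def)

lemma permanent_contractible:
  assumes "fs \<in> lists test_functions"
  shows "permanent fs \<in> contractible"
  unfolding contractible_def
proof (intro CollectI allI ballI)
  fix M :: "'a multiset" and \<phi> :: "'a \<Rightarrow> real" assume \<phi>: "\<phi> \<in> C_0"
  have "integrable lborel (\<lambda>y. \<phi> y * (fs ! j) y)" if "j < length fs" for j
    using assms that by (intro C_0_integrable_lborel C_0_mult \<phi> test_functions_subset_C_0) auto
  then show "integrable lborel (\<lambda>y. \<phi> y * permanent fs (add_mset y M))"
    by (auto simp: permanent_add_mset sum_distrib_left mult.assoc[symmetric]
        intro!: Bochner_Integration.integrable_sum)
qed

text \<open>\<open>R_hat\<close> transported to functions of multisets: creation removes a point,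
  the neutral operator multiplies by the sum of \<phi>, the first annihilation operator integrates
  over an added point, and the second doubles an existing point.\<close>

definition R_mset :: "real \<Rightarrow> real \<Rightarrow> ('a::euclidean_space \<Rightarrow> real) \<Rightarrow> ('a multiset \<Rightarrow> real) \<Rightarrow> 'a multiset \<Rightarrow> real" where
  "R_mset \<eta> \<beta> \<phi> G M = (\<Sum>x\<in>#M. \<phi> x * G (M - {#x#})) + (\<beta> + \<eta> / \<beta>) * ((\<Sum>x\<in>#M. \<phi> x) * G M)
     + (\<integral>y. \<phi> y * G (add_mset y M) \<partial>lborel) + \<eta> * (\<Sum>x\<in>#M. \<phi> x * G (add_mset x M))
     + 1 / \<beta> * (\<integral>y. \<phi> y \<partial>lborel) * G M"

text \<open>The size of the multiset selects the degree, so the whole sequence becomes one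
  function.\<close>

definition on_msets :: "'a fock \<Rightarrow> 'a multiset \<Rightarrow> real" where
  "on_msets F M = mset_fun (size M) (F (size M)) M"

lemma mset_fun_eq_on_msets: "size M = n \<Longrightarrow> mset_fun n (F n) M = on_msets F M"
  by (simp add: on_msets_def)

lemma fock_fin_eq_on_msets:
  assumes "F \<in> fock_fin"
  shows "F n xs = (if length xs = n then on_msets F (mset xs) / fact n else 0)"
proof -
  obtain L where L: "F n = lincomb L sym_prod" "snd ` set L \<subseteq> test_lists n"
    using assms unfolding fock_fin_def sym_tensors_eq_lincomb by blast
  show ?thesis
  proof (cases "length xs = n")
    case True
    then have "on_msets F (mset xs) = lincomb L permanent (mset xs)"
      by (simp add: on_msets_def L mset_fun_lincomb)
    moreover have "fact n * lincomb L sym_prod xs = lincomb L permanent (mset xs)"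
      using L(2) True by (induction L) (auto simp: sym_prod_eq_permanent test_lists_def algebra_simps)
    ultimately show ?thesis using True by (simp add: L field_simps)
  next
    case False
    have "lincomb L sym_prod xs = 0"
      using L(2) False by (induction L) (auto simp: sym_prod_eq_permanent test_lists_def)
    with False show ?thesis by (simp add: L)
  qed
qed

lemma on_msets_eqI:
  assumes "\<And>n xs. length xs = n \<Longrightarrow> F n xs = G (mset xs) / fact n"
  shows "on_msets F = G"
proof
  fix M :: "'a multiset"
  define xs where "xs = (SOME xs. mset xs = M)"
  have xs: "mset xs = M" unfolding xs_def using ex_mset[of M] by (rule someI_ex)
  then have "length xs = size M" by auto
  with assms[of xs] show "on_msets F M = G M"
    by (simp add: on_msets_def mset_fun_def xs_def[symmetric] xs)
qed

lemma on_msets_contractible: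
  assumes "F \<in> fock_fin"
  shows "on_msets F \<in> contractible"
  unfolding contractible_def
proof (intro CollectI allI ballI)
  fix M :: "'a multiset" and \<phi> :: "'a \<Rightarrow> real" assume \<phi>: "\<phi> \<in> C_0"
  obtain L where L: "F (Suc (size M)) = lincomb L sym_prod" "snd ` set L \<subseteq> test_lists (Suc (size M))"
    using assms unfolding fock_fin_def sym_tensors_eq_lincomb by blast
  have "lincomb L permanent \<in> contractible"
    using L by (intro contractible_lincomb permanent_contractible) (auto simp: test_lists_def)
  from contractibleD[OF this \<phi>, of M]
  show "integrable lborel (\<lambda>y. \<phi> y * on_msets F (add_mset y M))"
    by (simp add: on_msets_def L mset_fun_lincomb)
qed

lemma length_nths_Compl:
  assumes "finite J" "J \<subseteq> {..<length fs}"
  shows "length (nths fs (- J)) = length fs - card J"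
proof -
  have "{i. i < length fs \<and> i \<in> - J} = {..<length fs} - J" by auto
  then show ?thesis using assms by (simp add: length_nths card_Diff_subset)
qed

section \<open>The four field operators: linear extension and multiset form\<close>

context
  fixes \<phi> :: "'a::euclidean_space \<Rightarrow> real"
  assumes \<phi>: "\<phi> \<in> test_functions"
begin

lemma integral_lincomb_permanent:
  assumes "snd ` set L \<subseteq> test_lists n"
  shows "(\<integral>y. \<phi> y * lincomb L permanent (add_mset y M) \<partial>lborel)
    = lincomb L (\<lambda>fs M. \<integral>y. \<phi> y * permanent fs (add_mset y M) \<partial>lborel) M"
  using assms
proof (induction L)
  case (Cons p L)
  obtain c fs where p: "p = (c, fs)" by fastforce
  have fs: "fs \<in> lists test_functions" and L: "snd ` set L \<subseteq> test_lists n"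
    using Cons.prems by (auto simp: p test_lists_def)
  have "integrable lborel (\<lambda>y. \<phi> y * permanent fs (add_mset y M))"
    by (intro contractibleD permanent_contractible fs test_functions_subset_C_0 \<phi>)
  moreover have "integrable lborel (\<lambda>y. \<phi> y * lincomb L permanent (add_mset y M))"
    using L by (intro contractibleD contractible_lincomb permanent_contractible test_functions_subset_C_0 \<phi>)
      (auto simp: test_lists_def)
  ultimately show ?case
    using Cons.IH[OF L] by (simp add: p distrib_left mult.left_commute[of _ c])
qed simp

text \<open>As for the three operators that follow, the first statement keeps the image a
  combination of products, from which membership in \<open>sym_tensors\<close> is read off; the
  second gives the operator on functions of multisets.\<close>

lemma a_plus_lincomb:
    "snd ` set L \<subseteq> test_lists n \<Longrightarrow> linear_extension n (\<lambda>fs. sym_prod (\<phi> # fs)) (lincomb L sym_prod)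
      = lincomb L (\<lambda>fs. sym_prod (\<phi> # fs))"
  and a_plus_eq: "f \<in> sym_tensors n \<Longrightarrow> linear_extension n (\<lambda>fs. sym_prod (\<phi> # fs)) f
      = (\<lambda>xs. if length xs = Suc n then (\<Sum>x\<in>#mset xs. \<phi> x * mset_fun n f (mset xs - {#x#})) / fact (Suc n) else 0)"
proof -
  let ?A = "\<lambda>G M. \<Sum>x\<in>#M. \<phi> x * G (M - {#x#})"
  have 1: "?A (lincomb L permanent) = lincomb L (\<lambda>fs. ?A (permanent fs))" for L
    by (induction L) (auto simp: fun_eq_iff sum_mset.distrib distrib_left sum_mset_distrib_left mult.left_commute)
  have 2: "sym_prod (\<phi> # fs) xs = (if length xs = Suc n then ?A (permanent fs) (mset xs) / fact (Suc n) else 0)"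
    if "fs \<in> test_lists n" for fs xs
    using that by (auto simp: sym_prod_eq_permanent test_lists_def)
  show "snd ` set L \<subseteq> test_lists n \<Longrightarrow> linear_extension n (\<lambda>fs. sym_prod (\<phi> # fs)) (lincomb L sym_prod)
      = lincomb L (\<lambda>fs. sym_prod (\<phi> # fs))"
    by (rule linear_extension_lincomb[where A = ?A, OF 1 2])
  show "f \<in> sym_tensors n \<Longrightarrow> linear_extension n (\<lambda>fs. sym_prod (\<phi> # fs)) f
      = (\<lambda>xs. if length xs = Suc n then ?A (mset_fun n f) (mset xs) / fact (Suc n) else 0)"
    by (rule linear_extension_eq[where A = ?A, OF 1 2])
qed

lemma a_zero_lincomb:
    "snd ` set L \<subseteq> test_lists n \<Longrightarrow> linear_extension n (\<lambda>fs xs. \<Sum>i<length fs. sym_prod (fs[i := (\<lambda>x. \<phi> x * (fs ! i) x)]) xs) (lincomb L sym_prod)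
      = lincomb L (\<lambda>fs xs. \<Sum>i<length fs. sym_prod (fs[i := (\<lambda>x. \<phi> x * (fs ! i) x)]) xs)"
  and a_zero_eq: "f \<in> sym_tensors n \<Longrightarrow> linear_extension n (\<lambda>fs xs. \<Sum>i<length fs. sym_prod (fs[i := (\<lambda>x. \<phi> x * (fs ! i) x)]) xs) f
      = (\<lambda>xs. if length xs = n then (\<Sum>x\<in>#mset xs. \<phi> x) * mset_fun n f (mset xs) / fact n else 0)"
proof -
  let ?g = "\<lambda>fs xs. \<Sum>i<length fs. sym_prod (fs[i := (\<lambda>x. \<phi> x * (fs ! i) x)]) xs"
  let ?A = "\<lambda>G M. (\<Sum>x\<in>#M. \<phi> x) * G M"
  have 1: "?A (lincomb L permanent) = lincomb L (\<lambda>fs. ?A (permanent fs))" for L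
    by (induction L) (auto simp: fun_eq_iff algebra_simps)
  have 2: "?g fs xs = (if length xs = n then ?A (permanent fs) (mset xs) / fact n else 0)"
    if "fs \<in> test_lists n" for fs xs
    using that by (auto simp: sym_prod_eq_permanent test_lists_def sum_divide_distrib[symmetric]
        permanent_mult_each)
  show "snd ` set L \<subseteq> test_lists n \<Longrightarrow> linear_extension n ?g (lincomb L sym_prod) = lincomb L ?g"
    by (rule linear_extension_lincomb[where A = ?A, OF 1 2])
  show "f \<in> sym_tensors n \<Longrightarrow> linear_extension n ?g f
      = (\<lambda>xs. if length xs = n then ?A (mset_fun n f) (mset xs) / fact n else 0)"
    by (rule linear_extension_eq[where A = ?A, OF 1 2])
qed

lemma a_minus1_lincomb:
    "snd ` set L \<subseteq> test_lists (Suc n) \<Longrightarrow> linear_extension (Suc n) (\<lambda>fs xs. \<Sum>i<length fs. (\<integral>x. \<phi> x * (fs ! i) x \<partial>lborel) * sym_prod (nths fs (- {i})) xs) (lincomb L sym_prod)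
      = lincomb L (\<lambda>fs xs. \<Sum>i<length fs. (\<integral>x. \<phi> x * (fs ! i) x \<partial>lborel) * sym_prod (nths fs (- {i})) xs)"
  and a_minus1_eq: "f \<in> sym_tensors (Suc n) \<Longrightarrow> linear_extension (Suc n) (\<lambda>fs xs. \<Sum>i<length fs. (\<integral>x. \<phi> x * (fs ! i) x \<partial>lborel) * sym_prod (nths fs (- {i})) xs) f
      = (\<lambda>xs. if length xs = n then (\<integral>y. \<phi> y * mset_fun (Suc n) f (add_mset y (mset xs)) \<partial>lborel) / fact n else 0)"
proof -
  let ?g = "\<lambda>fs xs. \<Sum>i<length fs. (\<integral>x. \<phi> x * (fs ! i) x \<partial>lborel) * sym_prod (nths fs (- {i})) xs"
  let ?A = "\<lambda>G M. \<integral>y. \<phi> y * G (add_mset y M) \<partial>lborel"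
  have 1: "?A (lincomb L permanent) = lincomb L (\<lambda>fs. ?A (permanent fs))"
    if "snd ` set L \<subseteq> test_lists (Suc n)" for L
    using integral_lincomb_permanent[OF that] by (simp add: fun_eq_iff)
  have 2: "?g fs xs = (if length xs = n then ?A (permanent fs) (mset xs) / fact n else 0)"
    if fs: "fs \<in> test_lists (Suc n)" for fs xs
  proof -
    have int: "integrable lborel (\<lambda>y. \<phi> y * (fs ! j) y)" if "j < Suc n" for j
      using fs that by (intro C_0_integrable_lborel C_0_mult test_functions_subset_C_0 \<phi>) (auto simp: test_lists_def)
    have "?A (permanent fs) (mset xs) = (\<Sum>j<Suc n. (\<integral>y. \<phi> y * (fs ! j) y \<partial>lborel) * permanent (nths fs (- {j})) (mset xs))"
      using fs int by (simp add: permanent_add_mset sum_distrib_left mult.assoc[symmetric] test_lists_def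
          Bochner_Integration.integral_sum del: sum.lessThan_Suc)
    then show ?thesis
      using fs by (simp add: sym_prod_eq_permanent test_lists_def length_nths_Compl sum_divide_distrib del: sum.lessThan_Suc)
  qed
  show "snd ` set L \<subseteq> test_lists (Suc n) \<Longrightarrow> linear_extension (Suc n) ?g (lincomb L sym_prod) = lincomb L ?g"
    by (rule linear_extension_lincomb[where A = ?A, OF 1 2])
  show "f \<in> sym_tensors (Suc n) \<Longrightarrow> linear_extension (Suc n) ?g f
      = (\<lambda>xs. if length xs = n then ?A (mset_fun (Suc n) f) (mset xs) / fact n else 0)"
    by (rule linear_extension_eq[where A = ?A, OF 1 2])
qed

lemma a_minus2_lincomb:
    "snd ` set L \<subseteq> test_lists (Suc n) \<Longrightarrow> linear_extension (Suc n) (\<lambda>fs xs. \<Sum>i<length fs. \<Sum>j\<in>{..<length fs} - {i}.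
        sym_prod ((\<lambda>x. \<phi> x * (fs ! i) x * (fs ! j) x) # nths fs (- {i, j})) xs) (lincomb L sym_prod)
      = lincomb L (\<lambda>fs xs. \<Sum>i<length fs. \<Sum>j\<in>{..<length fs} - {i}.
        sym_prod ((\<lambda>x. \<phi> x * (fs ! i) x * (fs ! j) x) # nths fs (- {i, j})) xs)"
  and a_minus2_eq: "f \<in> sym_tensors (Suc n) \<Longrightarrow> linear_extension (Suc n) (\<lambda>fs xs. \<Sum>i<length fs. \<Sum>j\<in>{..<length fs} - {i}.
        sym_prod ((\<lambda>x. \<phi> x * (fs ! i) x * (fs ! j) x) # nths fs (- {i, j})) xs) f
      = (\<lambda>xs. if length xs = n then (\<Sum>x\<in>#mset xs. \<phi> x * mset_fun (Suc n) f (add_mset x (mset xs))) / fact n else 0)"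
proof -
  let ?g = "\<lambda>fs xs. \<Sum>i<length fs. \<Sum>j\<in>{..<length fs} - {i}.
        sym_prod ((\<lambda>x. \<phi> x * (fs ! i) x * (fs ! j) x) # nths fs (- {i, j})) xs"
  let ?A = "\<lambda>G M. \<Sum>x\<in>#M. \<phi> x * G (add_mset x M)"
  have 1: "?A (lincomb L permanent) = lincomb L (\<lambda>fs. ?A (permanent fs))" for L
    by (induction L) (auto simp: fun_eq_iff sum_mset.distrib distrib_left sum_mset_distrib_left mult.left_commute)
  have 2: "?g fs xs = (if length xs = n then ?A (permanent fs) (mset xs) / fact n else 0)"
    if fs: "fs \<in> test_lists (Suc n)" for fs xs
  proof -
    have len: "length (nths fs (- {i, j})) = n - 1" "n \<noteq> 0" if "i < length fs" "j \<in> {..<length fs} - {i}" for i j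
      using that fs by (auto simp: length_nths_Compl test_lists_def)
    have "?A (permanent fs) M = (\<Sum>i<length fs. \<Sum>j\<in>{..<length fs} - {i}.
        permanent ((\<lambda>x. \<phi> x * (fs ! i) x * (fs ! j) x) # nths fs (- {i, j})) M)" for M
    proof -
      \<comment> \<open>A point \<open>x\<close> of \<open>M\<close> occurs twice in
        \<open>add_mset x M\<close>. Expanding along both copies gives two different functions
        evaluated at \<open>x\<close>, which together with \<phi> form the merged factor.\<close>
      have "?A (permanent fs) M = (\<Sum>x\<in>#M. \<phi> x * permanent fs (add_mset x (add_mset x (M - {#x#}))))"
        by (intro arg_cong[where f = sum_mset] image_mset_cong) simp
      also have "\<dots> = (\<Sum>x\<in>#M. \<Sum>i<length fs. \<Sum>j\<in>{..<length fs} - {i}.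
          \<phi> x * (fs ! i) x * (fs ! j) x * permanent (nths fs (- {i, j})) (M - {#x#}))"
        by (simp only: permanent_add_mset2 sum_distrib_left mult.assoc)
      finally show ?thesis by (simp add: sum_mset_sum)
    qed
    moreover have "?g fs xs = (\<Sum>i<length fs. \<Sum>j\<in>{..<length fs} - {i}. if length xs = n then
       permanent ((\<lambda>x. \<phi> x * (fs ! i) x * (fs ! j) x) # nths fs (- {i, j})) (mset xs) / fact n else 0)"
      by (intro sum.cong refl) (use len in \<open>auto simp: sym_prod_eq_permanent simp del: permanent.simps\<close>)
    ultimately show ?thesis
      by (simp add: sum_divide_distrib del: permanent.simps)
  qed
  show "snd ` set L \<subseteq> test_lists (Suc n) \<Longrightarrow> linear_extension (Suc n) ?g (lincomb L sym_prod) = lincomb L ?g"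
    by (rule linear_extension_lincomb[where A = ?A, OF 1 2])
  show "f \<in> sym_tensors (Suc n) \<Longrightarrow> linear_extension (Suc n) ?g f
      = (\<lambda>xs. if length xs = n then ?A (mset_fun (Suc n) f) (mset xs) / fact n else 0)"
    by (rule linear_extension_eq[where A = ?A, OF 1 2])
qed

lemma fock_fin_component:
  assumes "F \<in> fock_fin"
  obtains L where "F n = lincomb L sym_prod" "snd ` set L \<subseteq> test_lists n"
  using assms unfolding fock_fin_def sym_tensors_eq_lincomb by blast

lemma a_plus_sym_tensors:
  assumes F: "F \<in> fock_fin"
  shows "a_plus \<phi> F n \<in> sym_tensors n"
proof (cases n)
  case (Suc m)
  obtain L where L: "F m = lincomb L sym_prod" "snd ` set L \<subseteq> test_lists m"
    by (rule fock_fin_component[OF F])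
  have "sym_prod (\<phi> # fs) \<in> sym_tensors n" if "fs \<in> snd ` set L" for fs
    using that L(2) \<phi> by (intro sym_prod_in_sym_tensors) (auto simp: test_lists_def Suc)
  then show ?thesis
    by (simp add: a_plus_def Suc L(1) a_plus_lincomb[OF L(2)] sym_tensors_lincomb)
qed (simp add: a_plus_def zero_sym_tensors)

lemma a_zero_sym_tensors:
  assumes F: "F \<in> fock_fin"
  shows "a_zero \<phi> F n \<in> sym_tensors n"
proof -
  obtain L where L: "F n = lincomb L sym_prod" "snd ` set L \<subseteq> test_lists n"
    by (rule fock_fin_component[OF F])
  have "fs[i := (\<lambda>x. \<phi> x * (fs ! i) x)] \<in> test_lists n" if "fs \<in> test_lists n" "i < length fs" for fs i
    using that \<phi> set_update_subset_insert[of fs i "\<lambda>x. \<phi> x * (fs ! i) x"]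
    by (fastforce simp: test_lists_def intro!: test_functions_mult)
  then have "(\<lambda>xs. \<Sum>i<length fs. sym_prod (fs[i := (\<lambda>x. \<phi> x * (fs ! i) x)]) xs) \<in> sym_tensors n"
    if "fs \<in> snd ` set L" for fs
    using that L(2) by (intro sym_tensors_sum sym_prod_in_sym_tensors) auto
  then show ?thesis
    by (simp add: a_zero_def L(1) a_zero_lincomb[OF L(2)] sym_tensors_lincomb)
qed

lemma a_minus1_sym_tensors:
  assumes F: "F \<in> fock_fin"
  shows "a_minus1 \<phi> F n \<in> sym_tensors n"
proof -
  obtain L where L: "F (Suc n) = lincomb L sym_prod" "snd ` set L \<subseteq> test_lists (Suc n)"
    by (rule fock_fin_component[OF F])
  have "nths fs (- {i}) \<in> test_lists n" if "fs \<in> test_lists (Suc n)" "i < length fs" for fs i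
    using that set_nths_subset[of fs "- {i}"] by (auto simp: test_lists_def length_nths_Compl)
  then have "(\<lambda>xs. \<Sum>i<length fs. (\<integral>x. \<phi> x * (fs ! i) x \<partial>lborel) * sym_prod (nths fs (- {i})) xs) \<in> sym_tensors n"
    if "fs \<in> snd ` set L" for fs
    using that L(2) by (intro sym_tensors_sum sym_tensors_cmult sym_prod_in_sym_tensors) auto
  then show ?thesis
    by (simp add: a_minus1_def L(1) a_minus1_lincomb[OF L(2)] sym_tensors_lincomb)
qed

lemma a_minus2_sym_tensors:
  assumes F: "F \<in> fock_fin"
  shows "a_minus2 \<phi> F n \<in> sym_tensors n"
proof -
  obtain L where L: "F (Suc n) = lincomb L sym_prod" "snd ` set L \<subseteq> test_lists (Suc n)"
    by (rule fock_fin_component[OF F])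
  have "(\<lambda>x. \<phi> x * (fs ! i) x * (fs ! j) x) # nths fs (- {i, j}) \<in> test_lists n"
    if "fs \<in> test_lists (Suc n)" "i < length fs" "j \<in> {..<length fs} - {i}" for fs i j
    using that set_nths_subset[of fs "- {i, j}"] \<phi>
    by (auto simp: test_lists_def length_nths_Compl intro!: test_functions_mult)
  then have "(\<lambda>xs. \<Sum>i<length fs. \<Sum>j\<in>{..<length fs} - {i}.
        sym_prod ((\<lambda>x. \<phi> x * (fs ! i) x * (fs ! j) x) # nths fs (- {i, j})) xs) \<in> sym_tensors n"
    if "fs \<in> snd ` set L" for fs
    using that L(2) by (intro sym_tensors_sum sym_prod_in_sym_tensors) auto
  then show ?thesis
    by (simp add: a_minus2_def L(1) a_minus2_lincomb[OF L(2)] sym_tensors_lincomb)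
qed

lemma R_hat_fock_fin:
  assumes F: "F \<in> fock_fin"
  shows "R_hat \<eta> \<kappa> \<phi> F \<in> fock_fin"
proof -
  define \<beta> where "\<beta> = sqrt (\<eta> + 1 / \<kappa>\<^sup>2)"
  have R: "R_hat \<eta> \<kappa> \<phi> F = (\<lambda>n xs. a_plus \<phi> F n xs + (\<beta> + \<eta> / \<beta>) * a_zero \<phi> F n xs
       + a_minus1 \<phi> F n xs + \<eta> * a_minus2 \<phi> F n xs
       + (1 / \<beta>) * (\<integral>x. \<phi> x \<partial>lborel) * F n xs)"
    using F by (simp add: R_hat_def \<beta>_def Let_def)
  obtain N where N: "F n = (\<lambda>_. 0)" if "n > N" for n
    using F by (auto simp: fock_fin_def)
  have "R_hat \<eta> \<kappa> \<phi> F n \<in> sym_tensors n" for n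
    using F unfolding R
    by (intro sym_tensors_add sym_tensors_cmult a_plus_sym_tensors a_zero_sym_tensors
        a_minus1_sym_tensors a_minus2_sym_tensors) (auto simp: fock_fin_def)
  \<comment> \<open>Creation raises the degree by one, so the bound grows from \<open>N\<close> to
    \<open>Suc N\<close>.\<close>
  moreover have "R_hat \<eta> \<kappa> \<phi> F n = (\<lambda>_. 0)" if n: "n > Suc N" for n
  proof -
    obtain m where m: "n = Suc m" "m > N" using n by (cases n) auto
    show ?thesis
      using a_plus_lincomb[of "[]" m] a_zero_lincomb[of "[]" n] a_minus1_lincomb[of "[]" n] a_minus2_lincomb[of "[]" n] m
      by (simp add: R a_plus_def a_zero_def a_minus1_def a_minus2_def N)
  qed
  ultimately show ?thesis
    unfolding fock_fin_def by blast
qed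

lemma on_msets_R_hat:
  assumes F: "F \<in> fock_fin"
  shows "on_msets (R_hat \<eta> \<kappa> \<phi> F) = R_mset \<eta> (sqrt (\<eta> + 1 / \<kappa>\<^sup>2)) \<phi> (on_msets F)"
proof (rule on_msets_eqI)
  fix n and xs :: "'a list" assume n: "length xs = n"
  let ?M = "mset xs"
  have sym: "F k \<in> sym_tensors k" for k using F by (simp add: fock_fin_def)
  have "a_plus \<phi> F n xs = (\<Sum>x\<in>#?M. \<phi> x * on_msets F (?M - {#x#})) / fact n"
  proof (cases n)
    case 0
    then show ?thesis using n by (simp add: a_plus_def)
  next
    case (Suc m)
    have "(\<Sum>x\<in>#?M. \<phi> x * mset_fun m (F m) (?M - {#x#})) = (\<Sum>x\<in>#?M. \<phi> x * on_msets F (?M - {#x#}))"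
      by (intro arg_cong[where f = sum_mset] image_mset_cong)
        (use n Suc in \<open>simp add: mset_fun_eq_on_msets size_Diff_singleton del: set_mset_mset\<close>)
    then show ?thesis using n Suc by (simp add: a_plus_def a_plus_eq[OF sym])
  qed
  moreover have "a_zero \<phi> F n xs = (\<Sum>x\<in>#?M. \<phi> x) * on_msets F ?M / fact n"
    using n by (simp add: a_zero_def a_zero_eq[OF sym] mset_fun_eq_on_msets)
  moreover have "a_minus1 \<phi> F n xs = (\<integral>y. \<phi> y * on_msets F (add_mset y ?M) \<partial>lborel) / fact n"
    using n by (simp add: a_minus1_def a_minus1_eq[OF sym] mset_fun_eq_on_msets)
  moreover have "a_minus2 \<phi> F n xs = (\<Sum>x\<in>#?M. \<phi> x * on_msets F (add_mset x ?M)) / fact n"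
    using n by (simp add: a_minus2_def a_minus2_eq[OF sym] mset_fun_eq_on_msets)
  moreover have "F n xs = on_msets F ?M / fact n"
    using n fock_fin_eq_on_msets[OF F] by simp
  ultimately show "R_hat \<eta> \<kappa> \<phi> F n xs = R_mset \<eta> (sqrt (\<eta> + 1 / \<kappa>\<^sup>2)) \<phi> (on_msets F) ?M / fact n"
    using F by (simp add: R_hat_def Let_def R_mset_def add_divide_distrib)
qed

end

lemma fock_fin_lincomb_closed:
  assumes "F \<in> fock_fin" "F' \<in> fock_fin"
  shows "(\<lambda>n xs. a * F n xs + b * F' n xs) \<in> fock_fin"
proof -
  obtain N N' where N: "\<forall>n>N. F n = (\<lambda>_. 0)" "\<forall>n>N'. F' n = (\<lambda>_. 0)"
    using assms unfolding fock_fin_def by blast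
  then have "\<forall>n>max N N'. (\<lambda>xs. a * F n xs + b * F' n xs) = (\<lambda>_. 0)" by simp
  then show ?thesis
    using assms unfolding fock_fin_def by (blast intro: sym_tensors_lincomb_closed)
qed

lemma fock_fin_cmult: "F \<in> fock_fin \<Longrightarrow> (\<lambda>n xs. a * F n xs) \<in> fock_fin"
  using fock_fin_lincomb_closed[of F F a 0] by simp

lemma fock_fin_add: "F \<in> fock_fin \<Longrightarrow> F' \<in> fock_fin \<Longrightarrow> (\<lambda>n xs. F n xs + F' n xs) \<in> fock_fin"
  using fock_fin_lincomb_closed[of F F' 1 1] by simp

lemma vacuum_fock_fin: "(vacuum :: 'a::euclidean_space fock) \<in> fock_fin"
proof -
  have "(vacuum n :: 'a list \<Rightarrow> real) \<in> sym_tensors n" for n :: nat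
  proof (cases n)
    case 0
    have "sym_prod [] = (vacuum 0 :: 'a list \<Rightarrow> real)"
      by (auto simp: fun_eq_iff vacuum_def sym_prod_eq_permanent)
    then show ?thesis using sym_prod_in_sym_tensors[of "[] :: ('a \<Rightarrow> real) list" 0] by (simp add: 0 test_lists_def)
  next
    case (Suc m)
    then have "vacuum n = (\<lambda>_ :: 'a list. 0)" by (auto simp: vacuum_def)
    then show ?thesis by (simp add: zero_sym_tensors)
  qed
  then show ?thesis
    unfolding fock_fin_def by (auto simp: vacuum_def fun_eq_iff)
qed

lemma on_msets_vacuum: "on_msets vacuum = (\<lambda>M. if M = {#} then 1 else 0)"
  by (rule on_msets_eqI) (auto simp: vacuum_def)

lemma on_msets_add: "on_msets (\<lambda>n xs. F n xs + F' n xs) = (\<lambda>M. on_msets F M + on_msets F' M)"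
  and on_msets_cmult: "on_msets (\<lambda>n xs. a * F n xs) = (\<lambda>M. a * on_msets F M)"
  by (auto simp: on_msets_def mset_fun_def algebra_simps)

lemma on_msets_empty: "on_msets F {#} = F 0 []"
  by (simp add: on_msets_def mset_fun_def)

lemma rho_eq: "F \<in> fock_fin \<Longrightarrow> rho \<eta> \<kappa> \<phi> F = (\<lambda>n xs. \<kappa> * sqrt (1 + \<eta> * \<kappa>\<^sup>2) * R_hat \<eta> \<kappa> \<phi> F n xs)"
  by (simp add: rho_def)

lemma rho_fock_fin: "\<phi> \<in> test_functions \<Longrightarrow> F \<in> fock_fin \<Longrightarrow> rho \<eta> \<kappa> \<phi> F \<in> fock_fin"
  by (simp add: rho_eq fock_fin_cmult R_hat_fock_fin)

subsection \<open>Vacuum moments and cumulants\<close>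

text \<open>The commutator of \<open>R_mset\<close> with insertion of \<open>x\<close>: the new
  point can be removed by creation, counted by the neutral operator or doubled by the second
  annihilation operator. Contraction and the scalar term commute with insertion.\<close>

lemma R_mset_add_mset:
  "R_mset \<eta> \<beta> \<phi> G (add_mset x M) = R_mset \<eta> \<beta> \<phi> (\<lambda>M. G (add_mset x M)) M
     + \<phi> x * (G M + (\<beta> + \<eta> / \<beta>) * G (add_mset x M) + \<eta> * G (add_mset x (add_mset x M)))"
proof -
  have "G (add_mset y (add_mset x M)) = G (add_mset x (add_mset y M))" for y
    by (simp only: add_mset_commute)
  then have "(\<integral>y. \<phi> y * G (add_mset y (add_mset x M)) \<partial>lborel) = (\<integral>y. \<phi> y * G (add_mset x (add_mset y M)) \<partial>lborel)"
    and "(\<Sum>y\<in>#M. \<phi> y * G (add_mset y (add_mset x M))) = (\<Sum>y\<in>#M. \<phi> y * G (add_mset x (add_mset y M)))"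
    by presburger+
  then show ?thesis
    by (simp add: R_mset_def sum_mset_add_mset_remove distrib_left distrib_right add_ac mult.assoc mult.left_commute)
qed

lemma R_mset_linear:
  assumes "\<phi> \<in> C_0" "G \<in> contractible" "H \<in> contractible"
  shows "R_mset \<eta> \<beta> \<phi> (\<lambda>M. a * G M + b * H M) M = a * R_mset \<eta> \<beta> \<phi> G M + b * R_mset \<eta> \<beta> \<phi> H M"
proof -
  have "(\<Sum>x\<in>#N. \<phi> x * (a * G (k x) + b * H (k x)))
      = a * (\<Sum>x\<in>#N. \<phi> x * G (k x)) + b * (\<Sum>x\<in>#N. \<phi> x * H (k x))" for N k
    by (simp add: sum_mset_distrib_left sum_mset.distrib[symmetric] algebra_simps)
  moreover have "(\<integral>y. \<phi> y * (a * G (add_mset y M) + b * H (add_mset y M)) \<partial>lborel)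
      = a * (\<integral>y. \<phi> y * G (add_mset y M) \<partial>lborel) + b * (\<integral>y. \<phi> y * H (add_mset y M) \<partial>lborel)"
    using contractibleD[OF assms(2,1), of M] contractibleD[OF assms(3,1), of M]
    by (simp add: distrib_left mult.left_commute[of _ a] mult.left_commute[of _ b])
  ultimately show ?thesis
    unfolding R_mset_def by (simp add: algebra_simps)
qed

lemma contractible_lin:
  assumes "G \<in> contractible" "H \<in> contractible"
  shows "(\<lambda>M. a * G M + b * H M) \<in> contractible"
  using assms unfolding contractible_def
  by (auto simp: distrib_left mult.left_commute[of _ a] mult.left_commute[of _ b])

lemma contractible_shift: "G \<in> contractible \<Longrightarrow> (\<lambda>M. G (add_mset x M)) \<in> contractible"
  by (auto simp: contractible_def add_mset_commute[of x])

text \<open>With this normalisation the value of the density applied to \<open>G\<close> at the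
  empty multiset is \<open>\<kappa>\<^sup>2\<close> times the integral of
  \<open>\<phi> x * insert_pt \<beta> x G {#}\<close>, so moments can be computed by commuting this
  operator to the vacuum.\<close>

definition insert_pt :: "real \<Rightarrow> 'a \<Rightarrow> ('a multiset \<Rightarrow> real) \<Rightarrow> 'a multiset \<Rightarrow> real" where
  "insert_pt \<beta> x G M = G M + \<beta> * G (add_mset x M)"

text \<open>The polynomial \<open>p\<close> evaluated at the operator
  \<open>insert_pt \<beta> x\<close> by Horner's scheme, applied to \<open>G\<close>.\<close>

definition insert_poly :: "real \<Rightarrow> 'a \<Rightarrow> real poly \<Rightarrow> ('a multiset \<Rightarrow> real) \<Rightarrow> 'a multiset \<Rightarrow> real" where
  "insert_poly \<beta> x p G = fold_coeffs (\<lambda>c H M. c * G M + insert_pt \<beta> x H M) p (\<lambda>_. 0)"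

lemma insert_poly_0 [simp]: "insert_poly \<beta> x 0 G = (\<lambda>_. 0)"
  by (simp add: insert_poly_def)

lemma insert_poly_pCons [simp]:
  "insert_poly \<beta> x (pCons c p) G = (\<lambda>M. c * G M + insert_pt \<beta> x (insert_poly \<beta> x p G) M)"
  by (cases "c = 0 \<and> p = 0") (auto simp: insert_poly_def insert_pt_def)

lemma insert_poly_add: "insert_poly \<beta> x (p + q) G M = insert_poly \<beta> x p G M + insert_poly \<beta> x q G M"
  by (induction p q arbitrary: M rule: poly_induct2) (auto simp: insert_pt_def algebra_simps)

lemma insert_poly_smult: "insert_poly \<beta> x (smult a p) G M = a * insert_poly \<beta> x p G M"
  by (induction p arbitrary: M) (auto simp: insert_pt_def algebra_simps)

lemma insert_pt_contractible: "G \<in> contractible \<Longrightarrow> insert_pt \<beta> x G \<in> contractible"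
  using contractible_lin[OF _ contractible_shift, of G G 1 \<beta> x] by (simp add: insert_pt_def[abs_def])

lemma insert_poly_contractible: "G \<in> contractible \<Longrightarrow> insert_poly \<beta> x p G \<in> contractible"
proof (induction p)
  case 0
  then show ?case by (simp add: contractible_def)
next
  case (pCons c p)
  then show ?case
    using contractible_lin[OF _ insert_pt_contractible, of G "insert_poly \<beta> x p G" c 1 \<beta> x] by simp
qed

text \<open>All ways of distributing the entries over two sublists, each keeping the order. Equal
  entries at different positions are distributed separately, so the list has length
  \<open>2 ^ length xs\<close>.\<close>

primrec splits :: "'b list \<Rightarrow> ('b list \<times> 'b list) list" where
  "splits [] = [([], [])]"
| "splits (x # xs) = map (\<lambda>(as, bs). (x # as, bs)) (splits xs) @ map (\<lambda>(as, bs). (as, x # bs)) (splits xs)"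

lemma splits_subset: "(as, bs) \<in> set (splits xs) \<Longrightarrow> set as \<subseteq> set xs \<and> set bs \<subseteq> set xs"
  by (induction xs arbitrary: as bs) fastforce+

lemma splits_length: "(as, bs) \<in> set (splits xs) \<Longrightarrow> length bs \<le> length xs"
  by (induction xs arbitrary: as bs) fastforce+

text \<open>The cumulants of order \<open>Suc j\<close> are the values at \<open>1\<close> of these polynomials; they are also obtained by
  iterating the derivation \<open>w (1 + \<eta> \<kappa>\<^sup>2 w) d/dw\<close>, which is \<open>d/ds\<close> in the variable with
  \<open>dw/ds = w (1 + \<eta> \<kappa>\<^sup>2 w)\<close>.\<close>

primrec cumulant_poly :: "real \<Rightarrow> real \<Rightarrow> nat \<Rightarrow> real poly" where
  "cumulant_poly \<eta> \<kappa> 0 = [:0, \<kappa>\<^sup>2:]"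
| "cumulant_poly \<eta> \<kappa> (Suc j) = pderiv (cumulant_poly \<eta> \<kappa> j) * [:0, 1, \<eta> * \<kappa>\<^sup>2:]"

lemma rho_prod_Nil: "F \<in> fock_fin \<Longrightarrow> rho_prod \<eta> \<kappa> [] F = F"
  and rho_prod_Cons: "F \<in> fock_fin \<Longrightarrow> rho_prod \<eta> \<kappa> (f # fs) F = rho \<eta> \<kappa> f (rho_prod \<eta> \<kappa> fs F)"
  by (simp_all add: rho_prod_def compose_def)

lemma rho_prod_fock_fin:
  "F \<in> fock_fin \<Longrightarrow> fs \<in> lists test_functions \<Longrightarrow> rho_prod \<eta> \<kappa> fs F \<in> fock_fin"
  by (induction fs) (auto simp: rho_prod_Nil rho_prod_Cons intro: rho_fock_fin)

context
  fixes \<eta> \<kappa> \<beta> :: real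
  assumes kappa: "\<kappa> > 0" and beta: "\<eta> + 1 / \<kappa>\<^sup>2 > 0" "\<beta> = sqrt (\<eta> + 1 / \<kappa>\<^sup>2)"
begin

lemma beta_pos: "\<beta> > 0" and beta_sq: "\<kappa>\<^sup>2 * \<beta>\<^sup>2 = 1 + \<eta> * \<kappa>\<^sup>2"
  and rho_factor: "\<kappa> * sqrt (1 + \<eta> * \<kappa>\<^sup>2) = \<kappa>\<^sup>2 * \<beta>"
proof -
  show "\<beta> > 0" using beta by simp
  have "\<beta>\<^sup>2 = \<eta> + 1 / \<kappa>\<^sup>2" using beta by simp
  then show *: "\<kappa>\<^sup>2 * \<beta>\<^sup>2 = 1 + \<eta> * \<kappa>\<^sup>2" using kappa by (simp add: field_simps)
  have "sqrt (1 + \<eta> * \<kappa>\<^sup>2) = \<kappa> * \<beta>"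
    using kappa \<open>\<beta> > 0\<close> by (simp add: *[symmetric] real_sqrt_mult)
  then show "\<kappa> * sqrt (1 + \<eta> * \<kappa>\<^sup>2) = \<kappa>\<^sup>2 * \<beta>" by (simp add: power2_eq_square)
qed

definition rho_mset :: "('a::euclidean_space \<Rightarrow> real) \<Rightarrow> ('a multiset \<Rightarrow> real) \<Rightarrow> 'a multiset \<Rightarrow> real" where
  "rho_mset \<phi> G M = \<kappa>\<^sup>2 * \<beta> * R_mset \<eta> \<beta> \<phi> G M"

lemma on_msets_rho:
  "\<phi> \<in> test_functions \<Longrightarrow> F \<in> fock_fin \<Longrightarrow> on_msets (rho \<eta> \<kappa> \<phi> F) = rho_mset \<phi> (on_msets F)"
  unfolding rho_eq rho_factor on_msets_cmult on_msets_R_hat beta(2)[symmetric] rho_mset_def[abs_def] ..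

lemma rho_mset_linear:
  assumes "\<phi> \<in> C_0" "G \<in> contractible" "H \<in> contractible"
  shows "rho_mset \<phi> (\<lambda>M. a * G M + b * H M) M = a * rho_mset \<phi> G M + b * rho_mset \<phi> H M"
  by (simp add: rho_mset_def R_mset_linear[OF assms] algebra_simps)

text \<open>Write S for insertion of \<open>x\<close> and W = 1 + \<beta> S. The commutator
  contributes \<open>\<kappa>\<^sup>2 * \<beta>\<^sup>2\<close> times 1 + (\<beta> + \<eta>/\<beta>)
  S + \<eta> S^2, and \<open>\<kappa>\<^sup>2 * \<beta>\<^sup>2 = 1 + \<eta> *
  \<kappa>\<^sup>2\<close> makes this equal to W + \<eta> \<kappa>^2 W^2.\<close>

lemma insert_pt_rho_mset:
  assumes "\<phi> \<in> C_0" "G \<in> contractible"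
  shows "insert_pt \<beta> x (rho_mset \<phi> G) M = rho_mset \<phi> (insert_pt \<beta> x G) M
     + \<phi> x * insert_poly \<beta> x [:0, 1, \<eta> * \<kappa>\<^sup>2:] G M"
proof -
  have "insert_pt \<beta> x (rho_mset \<phi> G) M = rho_mset \<phi> (insert_pt \<beta> x G) M
     + \<kappa>\<^sup>2 * \<beta>\<^sup>2 * \<phi> x * (G M + (\<beta> + \<eta> / \<beta>) * G (add_mset x M) + \<eta> * G (add_mset x (add_mset x M)))"
    using rho_mset_linear[OF assms(1,2) contractible_shift[OF assms(2)], of 1 \<beta> x M]
    by (simp add: insert_pt_def[abs_def] rho_mset_def R_mset_add_mset algebra_simps power2_eq_square)
  also have "\<kappa>\<^sup>2 * \<beta>\<^sup>2 * \<phi> x * (G M + (\<beta> + \<eta> / \<beta>) * G (add_mset x M) + \<eta> * G (add_mset x (add_mset x M)))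
     = \<phi> x * (\<kappa>\<^sup>2 * \<beta>\<^sup>2 * G M + \<beta> * (\<kappa>\<^sup>2 * \<beta>\<^sup>2 + \<eta> * \<kappa>\<^sup>2) * G (add_mset x M)
          + \<eta> * \<kappa>\<^sup>2 * \<beta>\<^sup>2 * G (add_mset x (add_mset x M)))"
    using beta_pos by (simp add: field_simps power2_eq_square)
  also have "\<dots> = \<phi> x * insert_poly \<beta> x [:0, 1, \<eta> * \<kappa>\<^sup>2:] G M"
    unfolding beta_sq by (simp add: insert_pt_def algebra_simps power2_eq_square)
  finally show ?thesis .
qed

text \<open>Leibniz rule: powers of W at the same point commute with each other, so commuting with
  the density acts on polynomials in W as the derivation that sends W to W (1 + \<eta> \<kappa>^2
  W).\<close>

lemma insert_poly_rho_mset: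
  assumes \<phi>: "\<phi> \<in> C_0" and G: "G \<in> contractible"
  shows "insert_poly \<beta> x p (rho_mset \<phi> G) M = rho_mset \<phi> (insert_poly \<beta> x p G) M
     + \<phi> x * insert_poly \<beta> x (pderiv p * [:0, 1, \<eta> * \<kappa>\<^sup>2:]) G M"
proof (induction p arbitrary: M)
  case 0
  show ?case by (simp add: rho_mset_def R_mset_def)
next
  case (pCons c p)
  let ?s = "[:0, 1, \<eta> * \<kappa>\<^sup>2:]"
  let ?I = "insert_poly \<beta> x p G"
  have I: "?I \<in> contractible" by (rule insert_poly_contractible[OF G])
  have "insert_pt \<beta> x (insert_poly \<beta> x p (rho_mset \<phi> G)) M
     = insert_pt \<beta> x (rho_mset \<phi> ?I) M + \<phi> x * insert_pt \<beta> x (insert_poly \<beta> x (pderiv p * ?s) G) M"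
    unfolding insert_pt_def pCons.IH by (simp add: algebra_simps)
  also have "insert_pt \<beta> x (rho_mset \<phi> ?I) M = rho_mset \<phi> (insert_pt \<beta> x ?I) M + \<phi> x * insert_poly \<beta> x ?s ?I M"
    by (rule insert_pt_rho_mset[OF \<phi> I])
  also have "insert_poly \<beta> x ?s ?I M = insert_poly \<beta> x (p * ?s) G M"
    by (simp add: insert_poly_add insert_poly_smult insert_pt_def algebra_simps)
  finally have 1: "insert_pt \<beta> x (insert_poly \<beta> x p (rho_mset \<phi> G)) M
     = rho_mset \<phi> (insert_pt \<beta> x ?I) M + \<phi> x * insert_poly \<beta> x (p * ?s) G M
       + \<phi> x * insert_pt \<beta> x (insert_poly \<beta> x (pderiv p * ?s) G) M" .
  have 2: "rho_mset \<phi> (insert_poly \<beta> x (pCons c p) G) M = c * rho_mset \<phi> G M + rho_mset \<phi> (insert_pt \<beta> x ?I) M"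
    using rho_mset_linear[OF \<phi> G insert_pt_contractible[OF I], of c 1 \<beta> x M] by simp
  have "pderiv (pCons c p) * ?s = p * ?s + pCons 0 (pderiv p * ?s)"
    unfolding pderiv_pCons distrib_right mult_pCons_left[of 0] by simp
  then have 3: "insert_poly \<beta> x (pderiv (pCons c p) * ?s) G M
      = insert_poly \<beta> x (p * ?s) G M + insert_pt \<beta> x (insert_poly \<beta> x (pderiv p * ?s) G) M"
    by (simp only: insert_poly_add insert_poly_pCons)
  have 4: "\<phi> x * insert_poly \<beta> x (pderiv (pCons c p) * ?s) G M
      = \<phi> x * insert_poly \<beta> x (p * ?s) G M + \<phi> x * insert_pt \<beta> x (insert_poly \<beta> x (pderiv p * ?s) G) M"
    by (simp only: 3 distrib_left)
  have "insert_poly \<beta> x (pCons c p) (rho_mset \<phi> G) M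
      = c * rho_mset \<phi> G M + insert_pt \<beta> x (insert_poly \<beta> x p (rho_mset \<phi> G)) M"
    by (simp only: insert_poly_pCons)
  with 1 2 4 show ?case by linarith
qed

text \<open>Inserting a point annihilates the vacuum, so W acts on it as the number 1.\<close>

lemma insert_poly_vacuum: "insert_poly \<beta> x p (on_msets vacuum) M = poly p 1 * on_msets vacuum M"
  by (induction p arbitrary: M) (auto simp: insert_pt_def on_msets_vacuum)

lemma rho_mset_sum_list:
  assumes \<phi>: "\<phi> \<in> C_0" and G: "\<And>b. b \<in> set L \<Longrightarrow> G b \<in> contractible"
  shows "rho_mset \<phi> (\<lambda>M. \<Sum>b\<leftarrow>L. c b * G b M) M = (\<Sum>b\<leftarrow>L. c b * rho_mset \<phi> (G b) M)
     \<and> (\<lambda>M. \<Sum>b\<leftarrow>L. c b * G b M) \<in> contractible"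
  using G
proof (induction L arbitrary: M)
  case Nil
  then show ?case by (simp add: rho_mset_def R_mset_def contractible_def)
next
  case (Cons b L)
  then have b: "G b \<in> contractible" and IH: "rho_mset \<phi> (\<lambda>M. \<Sum>b\<leftarrow>L. c b * G b M) M = (\<Sum>b\<leftarrow>L. c b * rho_mset \<phi> (G b) M)"
     "(\<lambda>M. \<Sum>b\<leftarrow>L. c b * G b M) \<in> contractible" by auto
  show ?case
    using rho_mset_linear[OF \<phi> b IH(2), of "c b" 1] contractible_lin[OF b IH(2), of "c b" 1] IH(1) by simp
qed

abbreviation rho_vac :: "('a::euclidean_space \<Rightarrow> real) list \<Rightarrow> 'a multiset \<Rightarrow> real" where
  "rho_vac fs \<equiv> on_msets (rho_prod \<eta> \<kappa> fs vacuum)"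

lemma rho_vac_Cons:
  "f \<in> test_functions \<Longrightarrow> fs \<in> lists test_functions \<Longrightarrow> rho_vac (f # fs) = rho_mset f (rho_vac fs)"
  by (simp add: rho_prod_Cons vacuum_fock_fin on_msets_rho rho_prod_fock_fin)

lemma rho_vac_contractible: "fs \<in> lists test_functions \<Longrightarrow> rho_vac fs \<in> contractible"
  by (intro on_msets_contractible rho_prod_fock_fin vacuum_fock_fin)

text \<open>Moving the polynomial in W past each density, one either leaves that density in place
  (\<open>f\<close> goes to \<open>bs\<close>) or lets the derivation consume it (\<open>f\<close>
  goes to \<open>as\<close>, the order rises by one and a factor \<open>f x\<close> appears). On
  reaching the vacuum, W becomes 1.\<close>

lemma insert_cumulant_poly_rho_vac:
  assumes "fs \<in> lists test_functions"
  shows "insert_poly \<beta> x (cumulant_poly \<eta> \<kappa> j) (rho_vac fs) M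
    = (\<Sum>(as, bs)\<leftarrow>splits fs. poly (cumulant_poly \<eta> \<kappa> (j + length as)) 1 * (\<Prod>f\<leftarrow>as. f x) * rho_vac bs M)"
  using assms
proof (induction fs arbitrary: j M)
  case Nil
  show ?case by (simp add: rho_prod_Nil vacuum_fock_fin insert_poly_vacuum)
next
  case (Cons f fs)
  then have f: "f \<in> test_functions" "f \<in> C_0" and fs: "fs \<in> lists test_functions"
    by (auto intro: test_functions_subset_C_0)
  let ?c = "\<lambda>j (as, bs). poly (cumulant_poly \<eta> \<kappa> (j + length as)) 1 * (\<Prod>f\<leftarrow>as. f x)"
  have IH: "insert_poly \<beta> x (cumulant_poly \<eta> \<kappa> j) (rho_vac fs) = (\<lambda>M. \<Sum>p\<leftarrow>splits fs. ?c j p * rho_vac (snd p) M)" for j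
    using Cons.IH by (simp add: fun_eq_iff case_prod_unfold)
  have bs: "snd p \<in> lists test_functions" if "p \<in> set (splits fs)" for p
    using splits_subset[of "fst p" "snd p" fs] that fs by auto
  have "insert_poly \<beta> x (cumulant_poly \<eta> \<kappa> j) (rho_vac (f # fs)) M
     = rho_mset f (insert_poly \<beta> x (cumulant_poly \<eta> \<kappa> j) (rho_vac fs)) M
       + f x * insert_poly \<beta> x (cumulant_poly \<eta> \<kappa> (Suc j)) (rho_vac fs) M"
    using insert_poly_rho_mset[OF f(2) rho_vac_contractible[OF fs]] by (simp add: rho_vac_Cons f fs)
  also have "rho_mset f (insert_poly \<beta> x (cumulant_poly \<eta> \<kappa> j) (rho_vac fs)) M
     = (\<Sum>p\<leftarrow>splits fs. ?c j p * rho_mset f (rho_vac (snd p)) M)"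
    unfolding IH
    using rho_mset_sum_list[OF f(2), of "splits fs" "\<lambda>p. rho_vac (snd p)"] rho_vac_contractible[OF bs] by blast
  also have "\<dots> = (\<Sum>p\<leftarrow>splits fs. ?c j p * rho_vac (f # snd p) M)"
    by (intro arg_cong[where f = sum_list] map_cong refl) (simp add: rho_vac_Cons f bs)
  also have "f x * insert_poly \<beta> x (cumulant_poly \<eta> \<kappa> (Suc j)) (rho_vac fs) M
     = (\<Sum>p\<leftarrow>splits fs. f x * (?c (Suc j) p * rho_vac (snd p) M))"
    unfolding IH by (simp add: sum_list_const_mult)
  finally show ?case
    by (simp add: case_prod_unfold o_def mult_ac)
qed

text \<open>The moment-cumulant recursion. At the empty multiset only contraction and the scalar
  term of the outermost density survive; together they are the integral of \<open>g y\<close>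
  against \<open>\<kappa>\<^sup>2\<close> W at \<open>y\<close>, and \<open>\<kappa>\<^sup>2\<close>
  W is the cumulant polynomial of index 0.\<close>

lemma tau_rho_prod_Cons:
  assumes g: "g \<in> test_functions" and fs: "fs \<in> lists test_functions"
  shows "tau (rho_prod \<eta> \<kappa> (g # fs)) = (\<Sum>(as, bs)\<leftarrow>splits fs.
     poly (cumulant_poly \<eta> \<kappa> (length as)) 1 * (\<integral>x. g x * (\<Prod>f\<leftarrow>as. f x) \<partial>lborel) * tau (rho_prod \<eta> \<kappa> bs))"
proof -
  have tau: "tau (rho_prod \<eta> \<kappa> fs) = rho_vac fs {#}" for fs :: "('a \<Rightarrow> real) list"
    by (simp add: tau_def on_msets_empty)
  have g0: "g \<in> C_0" by (rule test_functions_subset_C_0[OF g])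
  have C: "(\<lambda>x. g x * (\<Prod>f\<leftarrow>as. f x)) \<in> C_0" if "set as \<subseteq> test_functions" for as
    using that
  proof (induction as)
    case (Cons a as)
    then show ?case
      using C_0_mult[of "\<lambda>x. g x * (\<Prod>f\<leftarrow>as. f x)" a] test_functions_subset_C_0[of a] by (simp add: mult_ac)
  qed (simp add: g0)
  have int: "integrable lborel (\<lambda>x. g x * (\<Prod>f\<leftarrow>fst p. f x))" if "p \<in> set (splits fs)" for p
    using splits_subset[of "fst p" "snd p" fs] that fs by (intro C_0_integrable_lborel C) auto
  have i: "integrable lborel (\<lambda>y. g y * rho_vac fs (add_mset y {#}))"
    using contractibleD[OF rho_vac_contractible[OF fs] g0] .
  have "rho_vac (g # fs) {#} = \<kappa>\<^sup>2 * (\<integral>y. g y * rho_vac fs {#} + \<beta> * (g y * rho_vac fs {#y#}) \<partial>lborel)"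
    using i beta_pos C_0_integrable_lborel[OF g0]
    by (simp add: rho_vac_Cons g fs rho_mset_def R_mset_def algebra_simps)
  also have "\<dots> = (\<integral>y. g y * insert_poly \<beta> y (cumulant_poly \<eta> \<kappa> 0) (rho_vac fs) {#} \<partial>lborel)"
    unfolding integral_mult_right_zero[symmetric]
    by (intro Bochner_Integration.integral_cong refl) (simp add: insert_pt_def algebra_simps)
  also have "\<dots> = (\<integral>y. (\<Sum>p\<leftarrow>splits fs. poly (cumulant_poly \<eta> \<kappa> (length (fst p))) 1 * (g y * (\<Prod>f\<leftarrow>fst p. f y)) * rho_vac (snd p) {#}) \<partial>lborel)"
    unfolding insert_cumulant_poly_rho_vac[OF fs]
    by (simp add: case_prod_unfold sum_list_const_mult[symmetric] mult_ac)
  also have "\<dots> = (\<Sum>p\<leftarrow>splits fs. poly (cumulant_poly \<eta> \<kappa> (length (fst p))) 1 * (\<integral>x. g x * (\<Prod>f\<leftarrow>fst p. f x) \<partial>lborel) * rho_vac (snd p) {#})"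
  proof -
    have "set L \<subseteq> set (splits fs) \<Longrightarrow>
      integrable lborel (\<lambda>y. \<Sum>p\<leftarrow>L. poly (cumulant_poly \<eta> \<kappa> (length (fst p))) 1 * (g y * (\<Prod>f\<leftarrow>fst p. f y)) * rho_vac (snd p) {#})
      \<and> (\<integral>y. (\<Sum>p\<leftarrow>L. poly (cumulant_poly \<eta> \<kappa> (length (fst p))) 1 * (g y * (\<Prod>f\<leftarrow>fst p. f y)) * rho_vac (snd p) {#}) \<partial>lborel)
        = (\<Sum>p\<leftarrow>L. poly (cumulant_poly \<eta> \<kappa> (length (fst p))) 1 * (\<integral>x. g x * (\<Prod>f\<leftarrow>fst p. f x) \<partial>lborel) * rho_vac (snd p) {#})" for L
      by (induction L) (auto simp: int)
    then show ?thesis by blast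
  qed
  finally show ?thesis by (simp add: tau case_prod_unfold)
qed

end

subsection \<open>Concentrated bump functions\<close>

text \<open>For \<open>j = 0\<close> this is the standard smooth function that is flat at 0; the
  powers of \<open>1 / t\<close> close the family under differentiation.\<close>

definition flat_exp :: "nat \<Rightarrow> real \<Rightarrow> real" where
  "flat_exp j t = (if t > 0 then exp (- 1 / t) / t ^ j else 0)"

lemma flat_exp_tendsto_0: "((\<lambda>t. exp (- 1 / t) / t ^ j :: real) \<longlongrightarrow> 0) (at_right 0)"
proof -
  have "((\<lambda>t::real. (inverse t) ^ j / exp (inverse t)) \<longlongrightarrow> 0) (at_right 0)"
    using tendsto_power_div_exp_0 filterlim_inverse_at_top_right by (rule filterlim_compose)
  then show ?thesis
    by (simp add: exp_minus field_simps power_inverse)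
qed

text \<open>Only \<open>t = 0\<close> is delicate: for \<open>t > 0\<close> the difference quotient
  there is the expression with exponent \<open>Suc j\<close>, which tends to 0 because the
  exponential beats every power.\<close>

lemma flat_exp_has_derivative:
  "(flat_exp j has_real_derivative flat_exp (j + 2) t - real j * flat_exp (j + 1) t) (at t)"
proof -
  consider "t > 0" | "t < 0" | "t = 0" by linarith
  then show ?thesis
  proof cases
    case 1
    have "((\<lambda>t. exp (- 1 / t) / t ^ j) has_real_derivative flat_exp (j + 2) t - real j * flat_exp (j + 1) t) (at t)"
    proof (rule DERIV_cong)
      show "((\<lambda>t. exp (- 1 / t) / t ^ j) has_real_derivative
          (exp (- 1 / t) * (1 / (t * t)) * t ^ j - exp (- 1 / t) * (real j * t ^ (j - 1))) / (t ^ j * t ^ j)) (at t)"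
        using 1 by (auto intro!: derivative_eq_intros)
      have "real j * t ^ (j - 1) = real j * (t ^ j / t)" using 1 by (cases j) auto
      then show "(exp (- 1 / t) * (1 / (t * t)) * t ^ j - exp (- 1 / t) * (real j * t ^ (j - 1))) / (t ^ j * t ^ j)
          = flat_exp (j + 2) t - real j * flat_exp (j + 1) t"
        using 1 by (simp add: flat_exp_def diff_divide_distrib power_add power2_eq_square)
    qed
    then show ?thesis
      by (rule has_field_derivative_transform_within_open[of _ _ _ "{0<..}"]) (use 1 in \<open>auto simp: flat_exp_def\<close>)
  next
    case 2
    have "((\<lambda>t. 0) has_real_derivative flat_exp (j + 2) t - real j * flat_exp (j + 1) t) (at t)"
      using 2 by (simp add: flat_exp_def)
    then show ?thesis
      by (rule has_field_derivative_transform_within_open[of _ _ _ "{..<0}"]) (use 2 in \<open>auto simp: flat_exp_def\<close>)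
  next
    case 3
    have "((\<lambda>y. flat_exp j y / y) \<longlongrightarrow> 0) (at_right 0)"
    proof (rule Lim_transform_eventually[OF flat_exp_tendsto_0[of "Suc j"]])
      show "\<forall>\<^sub>F t in at_right 0. exp (- 1 / t) / t ^ Suc j = flat_exp j t / t"
        by (auto simp: eventually_at_right_field flat_exp_def intro!: exI[of _ 1])
    qed
    moreover have "((\<lambda>y. flat_exp j y / y) \<longlongrightarrow> 0) (at_left 0)"
    proof (rule Lim_transform_eventually[OF tendsto_const])
      show "\<forall>\<^sub>F t in at_left 0. 0 = flat_exp j t / t"
        by (auto simp: eventually_at_left_field flat_exp_def intro!: exI[of _ "-1"])
    qed
    ultimately have "((\<lambda>y. flat_exp j y / y) \<longlongrightarrow> 0) (at 0)"
      by (simp add: filterlim_split_at)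
    then show ?thesis
      by (simp add: 3 has_field_derivative_iff flat_exp_def)
  qed
qed

text \<open>A ring containing the bump and closed under partial derivatives; smoothness of all
  orders then follows by induction on \<open>k\<close> without computing higher derivatives. The
  linear functions enter through the derivative of \<open>x \<bullet> x\<close>.\<close>

inductive_set smooth_ring :: "real \<Rightarrow> ('a::euclidean_space \<Rightarrow> real) set" for e where
  const: "(\<lambda>_. c) \<in> smooth_ring e"
| inner: "(\<lambda>x. x \<bullet> b) \<in> smooth_ring e"
| flat: "(\<lambda>x. flat_exp j (e - x \<bullet> x)) \<in> smooth_ring e"
| add: "f \<in> smooth_ring e \<Longrightarrow> g \<in> smooth_ring e \<Longrightarrow> (\<lambda>x. f x + g x) \<in> smooth_ring e"
| mult: "f \<in> smooth_ring e \<Longrightarrow> g \<in> smooth_ring e \<Longrightarrow> (\<lambda>x. f x * g x) \<in> smooth_ring e"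

lemma smooth_ring_derivative:
  assumes "f \<in> smooth_ring e"
  shows "\<exists>D. (\<forall>x. (f has_derivative D x) (at x)) \<and> (\<forall>b. (\<lambda>x. D x b) \<in> smooth_ring e)"
  using assms
proof induction
  case (const c)
  then show ?case
    by (intro exI[of _ "\<lambda>_ _. 0"]) (auto intro: smooth_ring.const)
next
  case (inner b)
  have "(\<lambda>x::'a. h \<bullet> b) \<in> smooth_ring e" for h by (rule smooth_ring.const)
  then show ?case
    by (intro exI[of _ "\<lambda>x h. h \<bullet> b"]) (auto intro!: derivative_eq_intros)
next
  case (flat j)
  define d where "d = (\<lambda>t. flat_exp (j + 2) t - real j * flat_exp (j + 1) t)"
  define D where "D = (\<lambda>x h :: 'a. d (e - x \<bullet> x) * (- 2 * (x \<bullet> h)))"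
  have "((\<lambda>x. flat_exp j (e - x \<bullet> x)) has_derivative D x) (at x)" for x
  proof -
    have g: "((\<lambda>x::'a. e - x \<bullet> x) has_derivative (\<lambda>h. - 2 * (x \<bullet> h))) (at x)"
      by (auto intro!: derivative_eq_intros simp: inner_commute)
    have "(flat_exp j has_derivative (\<lambda>h. d (e - x \<bullet> x) * h)) (at (e - x \<bullet> x))"
      using flat_exp_has_derivative unfolding d_def has_field_derivative_def .
    from has_derivative_compose[OF g this] show ?thesis
      by (simp add: D_def)
  qed
  moreover have "(\<lambda>x. D x b) \<in> smooth_ring e" for b
  proof -
    have "(\<lambda>x. (flat_exp (j + 2) (e - x \<bullet> x) + (- real j) * flat_exp (j + 1) (e - x \<bullet> x)) * ((- 2) * (x \<bullet> b))) \<in> smooth_ring e"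
      by (intro smooth_ring.intros)
    then show ?thesis by (simp add: D_def d_def)
  qed
  ultimately show ?case by blast
next
  case (add f g)
  then obtain D E where *: "\<And>x. (f has_derivative D x) (at x)" "\<And>b. (\<lambda>x. D x b) \<in> smooth_ring e"
    "\<And>x. (g has_derivative E x) (at x)" "\<And>b. (\<lambda>x. E x b) \<in> smooth_ring e" by metis
  show ?case
    by (rule exI[of _ "\<lambda>x h. D x h + E x h"]) (auto intro: has_derivative_add * smooth_ring.intros)
next
  case (mult f g)
  then obtain D E where *: "\<And>x. (f has_derivative D x) (at x)" "\<And>b. (\<lambda>x. D x b) \<in> smooth_ring e"
    "\<And>x. (g has_derivative E x) (at x)" "\<And>b. (\<lambda>x. E x b) \<in> smooth_ring e" by metis
  show ?case
    by (rule exI[of _ "\<lambda>x h. f x * E x h + D x h * g x"])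
      (auto intro!: has_derivative_mult * smooth_ring.add smooth_ring.mult mult.hyps)
qed

lemma smooth_ring_C_k: "f \<in> smooth_ring e \<Longrightarrow> C_k k f"
proof (induction k arbitrary: f)
  case 0
  then obtain D where "\<And>x. (f has_derivative D x) (at x)"
    using smooth_ring_derivative by blast
  then show ?case
    by (auto intro!: continuous_at_imp_continuous_on has_derivative_continuous)
next
  case (Suc k)
  then obtain D where D: "\<And>x. (f has_derivative D x) (at x)" "\<And>b. (\<lambda>x. D x b) \<in> smooth_ring e"
    using smooth_ring_derivative by metis
  have "frechet_derivative f (at x) = D x" for x
    using frechet_derivative_at[OF D(1)] by simp
  then show ?case
    using D Suc.IH by (auto simp: differentiable_def)
qed

lemma bump_test_function: "(\<lambda>x. flat_exp 0 (e - x \<bullet> x)) \<in> test_functions"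
proof -
  have "{x :: 'a. flat_exp 0 (e - x \<bullet> x) \<noteq> 0} \<subseteq> cball 0 (sqrt \<bar>e\<bar>)"
    by (auto simp: flat_exp_def norm_eq_sqrt_inner)
  then have "bounded {x :: 'a. flat_exp 0 (e - x \<bullet> x) \<noteq> 0}"
    using bounded_cball bounded_subset by blast
  then show ?thesis
    unfolding test_functions_iff using smooth_ring_C_k[OF smooth_ring.flat] by blast
qed

text \<open>Cauchy-Schwarz on a ball of radius \<open>r\<close> containing the support gives
  (\<integral>f^2)^2 <= V(r) \<integral>f^4, and the volume V(r) shrinks to 0 with \<open>r\<close>.
  Strictness comes from V(r) < \<open>c\<close> and \<integral>f^4 > 0.\<close>

lemma concentrated_bump:
  assumes "c > 0"
  obtains f :: "'a::euclidean_space \<Rightarrow> real" where "f \<in> test_functions"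
    "(\<integral>x. f x * f x \<partial>lborel)\<^sup>2 < c * (\<integral>x. f x * f x * (f x * f x) \<partial>lborel)"
proof -
  define V where "V r = measure lborel (cball (0::'a) r)" for r
  have "(\<lambda>n. V (1 / Suc n)) \<longlonglongrightarrow> measure lborel (\<Inter>n. cball (0::'a) (1 / Suc n))"
    unfolding V_def
  proof (rule Lim_measure_decseq)
    show "decseq (\<lambda>n. cball (0::'a) (1 / real (Suc n)))"
      unfolding decseq_def by (intro allI impI subset_cball) (simp add: frac_le)
    show "emeasure lborel (cball (0::'a) (1 / real (Suc n))) \<noteq> \<infinity>" for n
      using emeasure_lborel_cball_finite[of "0::'a"] by (metis less_irrefl)
  qed auto
  moreover have "(\<Inter>n. cball (0::'a) (1 / Suc n)) = {0}"
  proof (intro equalityI subsetI)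
    fix x :: 'a assume "x \<in> (\<Inter>n. cball 0 (1 / Suc n))"
    then have "norm x \<le> 1 / Suc n" for n by simp
    then have "norm x \<le> 0"
      using LIMSEQ_le_const[OF LIMSEQ_inverse_real_of_nat, of "norm x"] by (auto simp: inverse_eq_divide)
    then show "x \<in> {0}" by simp
  qed auto
  ultimately have "(\<lambda>n. V (1 / Suc n)) \<longlonglongrightarrow> 0" by simp
  then obtain n where n: "V (1 / Suc n) < c"
    using assms order_tendstoD(2) eventually_happens'[OF sequentially_bot] by blast
  define r where "r = 1 / real (Suc n)"
  define f where "f = (\<lambda>x::'a. flat_exp 0 (r\<^sup>2 - x \<bullet> x))"
  let ?B = "cball (0::'a) r"
  have r: "r > 0" by (simp add: r_def)
  have f: "f \<in> test_functions" unfolding f_def by (rule bump_test_function)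
  have f0: "f x = 0" if "x \<notin> ?B" for x
    using that r by (auto simp: f_def flat_exp_def norm_eq_sqrt_inner dest!: real_sqrt_less_mono[of "x \<bullet> x"])
  have pos: "f x > 0" if "norm x < r" for x
  proof -
    have "x \<bullet> x < r\<^sup>2" using that r by (metis norm_ge_zero power2_norm_eq_inner power_strict_mono pos2)
    then show ?thesis by (simp add: f_def flat_exp_def)
  qed
  let ?I2 = "\<integral>x. f x * f x \<partial>lborel" and ?I4 = "\<integral>x. f x * f x * (f x * f x) \<partial>lborel"
  have i2: "integrable lborel (\<lambda>x. f x * f x)" and i4: "integrable lborel (\<lambda>x. f x * f x * (f x * f x))"
    using f by (intro C_0_integrable_lborel C_0_mult test_functions_subset_C_0; simp)+
  have B: "emeasure lborel ?B < \<infinity>" by (rule emeasure_lborel_cball_finite)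
  have Vpos: "V r > 0"
    using r by (simp add: V_def content_cball_pos)
  \<comment> \<open>The mean of \<open>f x * f x\<close> over the ball; expanding the integral of
    the squared deviation from it proves Cauchy-Schwarz.\<close>
  define a where "a = ?I2 / V r"
  have iB: "integrable lborel (\<lambda>x. indicator ?B x :: real)"
    using B by simp
  have "0 \<le> (\<integral>x. indicator ?B x * (f x * f x - a)\<^sup>2 \<partial>lborel)"
    by simp
  also have "\<dots> = (\<integral>x. f x * f x * (f x * f x) - 2 * a * (f x * f x) + a\<^sup>2 * indicator ?B x \<partial>lborel)"
    by (intro Bochner_Integration.integral_cong refl)
      (auto simp: indicator_def f0 power2_eq_square algebra_simps)
  also have "\<dots> = ?I4 - 2 * a * ?I2 + a\<^sup>2 * V r"
    using i2 i4 iB by (simp add: V_def)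
  also have "\<dots> = ?I4 - ?I2\<^sup>2 / V r"
    using Vpos by (simp add: a_def power2_eq_square field_simps)
  finally have CS: "?I2\<^sup>2 \<le> V r * ?I4"
    using Vpos by (simp add: field_simps)
  have "?I4 \<noteq> 0"
  proof
    assume "?I4 = 0"
    then have "AE x in lborel. f x * f x * (f x * f x) = 0"
      using i4 by (subst (asm) integral_nonneg_eq_0_iff_AE) auto
    then have "AE x in lborel. x \<notin> ball (0::'a) r"
      by eventually_elim (use pos in fastforce)
    then have "emeasure lborel (ball (0::'a) r) = 0"
      by (subst (asm) AE_iff_measurable[of "ball 0 r"]) auto
    then show False
      using content_ball_pos[OF r, of "0::'a"] by (simp add: measure_def)
  qed
  moreover have "?I4 \<ge> 0" by simp
  ultimately have "?I4 > 0" by linarith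
  moreover have "V r < c" using n by (simp only: r_def)
  ultimately have "V r * ?I4 < c * ?I4"
    by (rule mult_strict_right_mono[rotated])
  with CS have "?I2\<^sup>2 < c * ?I4" by linarith
  then show thesis using that f by blast
qed

subsection \<open>Positivity of the vacuum functional\<close>

lemma fock_fin_eqI:
  assumes "F \<in> fock_fin" "F' \<in> fock_fin" "on_msets F = on_msets F'"
  shows "F = F'"
  by (intro ext) (simp add: fock_fin_eq_on_msets[OF assms(1)] fock_fin_eq_on_msets[OF assms(2)] assms(3))

text \<open>A polynomial in the densities, written as a list of coefficients and words. It serves as
  a normal form for elements of the algebra on which \<tau> is computed word by word.\<close>

definition op_comb :: "real \<Rightarrow> real \<Rightarrow> (real \<times> ('a::euclidean_space \<Rightarrow> real) list) list \<Rightarrow> 'a fock \<Rightarrow> 'a fock" where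
  "op_comb \<eta> \<kappa> L F = (\<lambda>n xs. \<Sum>(c, fs)\<leftarrow>L. c * rho_prod \<eta> \<kappa> fs F n xs)"

lemma op_comb_Nil: "op_comb \<eta> \<kappa> [] F = (\<lambda>n xs. 0)"
  and op_comb_Cons: "op_comb \<eta> \<kappa> ((c, fs) # L) F = (\<lambda>n xs. c * rho_prod \<eta> \<kappa> fs F n xs + op_comb \<eta> \<kappa> L F n xs)"
  and op_comb_append: "op_comb \<eta> \<kappa> (L @ L') F = (\<lambda>n xs. op_comb \<eta> \<kappa> L F n xs + op_comb \<eta> \<kappa> L' F n xs)"
  by (simp_all add: op_comb_def)

lemma op_comb_fock_fin:
  assumes "F \<in> fock_fin" "snd ` set L \<subseteq> lists test_functions"
  shows "op_comb \<eta> \<kappa> L F \<in> fock_fin"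
  using assms(2)
proof (induction L)
  case Nil
  then show ?case using fock_fin_cmult[OF assms(1), of 0] by (simp add: op_comb_Nil)
next
  case (Cons p L)
  then show ?case
    by (cases p) (simp add: op_comb_Cons fock_fin_add fock_fin_cmult rho_prod_fock_fin assms(1))
qed

lemma op_comb_in_density_algebra:
  assumes "snd ` set L \<subseteq> lists test_functions"
  shows "(\<lambda>F\<in>fock_fin. op_comb \<eta> \<kappa> L F) \<in> density_algebra \<eta> \<kappa>"
  using assms
proof (induction L)
  case Nil
  show ?case
    using density_algebra.const[of 0 \<eta> \<kappa>] by (simp add: op_comb_Nil restrict_def)
next
  case (Cons p L)
  obtain c fs where p: "p = (c, fs)" by fastforce
  have "rho_prod \<eta> \<kappa> fs \<in> density_algebra \<eta> \<kappa>" if "fs \<in> lists test_functions" for fs :: "('a \<Rightarrow> real) list"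
    using that
  proof (induction fs)
    case Nil
    show ?case using density_algebra.const[of 1 \<eta> \<kappa>] by (simp add: rho_prod_def restrict_def)
  next
    case (Cons f fs)
    then show ?case
      using density_algebra.mult[OF density_algebra.gen] by (simp add: rho_prod_def)
  qed
  then have fs: "rho_prod \<eta> \<kappa> fs \<in> density_algebra \<eta> \<kappa>"
    using Cons.prems by (simp add: p)
  have IH: "(\<lambda>F\<in>fock_fin. op_comb \<eta> \<kappa> L F) \<in> density_algebra \<eta> \<kappa>"
    by (rule Cons.IH) (use Cons.prems in simp)
  have eq: "(\<lambda>F\<in>fock_fin. op_comb \<eta> \<kappa> (p # L) F) = (\<lambda>F\<in>fock_fin. \<lambda>n xs.
      compose fock_fin (\<lambda>F\<in>fock_fin. \<lambda>n xs. c * F n xs) (rho_prod \<eta> \<kappa> fs) F n xs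
      + (\<lambda>F\<in>fock_fin. op_comb \<eta> \<kappa> L F) F n xs)"
    using Cons.prems by (auto simp: p op_comb_Cons compose_def rho_prod_fock_fin fun_eq_iff restrict_def)
  show ?case
    unfolding eq by (rule density_algebra.add[OF density_algebra.mult[OF density_algebra.const fs] IH])
qed

context
  fixes \<eta> \<kappa> \<beta> :: real
  assumes kappa: "\<kappa> > 0" and beta: "\<eta> + 1 / \<kappa>\<^sup>2 > 0" "\<beta> = sqrt (\<eta> + 1 / \<kappa>\<^sup>2)"
begin

text \<open>Fock vectors are determined by their functions of multisets, where linearity is that of
  \<open>rho_mset\<close>.\<close>

lemma rho_linear:
  assumes "\<phi> \<in> test_functions" "F \<in> fock_fin" "F' \<in> fock_fin"
  shows "rho \<eta> \<kappa> \<phi> (\<lambda>n xs. a * F n xs + b * F' n xs) = (\<lambda>n xs. a * rho \<eta> \<kappa> \<phi> F n xs + b * rho \<eta> \<kappa> \<phi> F' n xs)"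
proof (rule fock_fin_eqI)
  note lin = fock_fin_lincomb_closed[OF assms(2,3), of a b]
  show "rho \<eta> \<kappa> \<phi> (\<lambda>n xs. a * F n xs + b * F' n xs) \<in> fock_fin"
    "(\<lambda>n xs. a * rho \<eta> \<kappa> \<phi> F n xs + b * rho \<eta> \<kappa> \<phi> F' n xs) \<in> fock_fin"
    by (intro rho_fock_fin fock_fin_lincomb_closed assms lin)+
  show "on_msets (rho \<eta> \<kappa> \<phi> (\<lambda>n xs. a * F n xs + b * F' n xs))
      = on_msets (\<lambda>n xs. a * rho \<eta> \<kappa> \<phi> F n xs + b * rho \<eta> \<kappa> \<phi> F' n xs)"
    using rho_mset_linear[OF kappa beta test_functions_subset_C_0[OF assms(1)] on_msets_contractible[OF assms(2)] on_msets_contractible[OF assms(3)]]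
    by (simp add: on_msets_rho[OF kappa beta] assms lin on_msets_add on_msets_cmult fun_eq_iff)
qed

lemma rho_op_comb:
  assumes "\<phi> \<in> test_functions" "F \<in> fock_fin" "snd ` set L \<subseteq> lists test_functions"
  shows "rho \<eta> \<kappa> \<phi> (op_comb \<eta> \<kappa> L F) = op_comb \<eta> \<kappa> (map (\<lambda>(c, fs). (c, \<phi> # fs)) L) F"
  using assms(3)
proof (induction L)
  case Nil
  show ?case using rho_linear[OF assms(1,2,2), of 0 0] by (simp add: op_comb_Nil)
next
  case (Cons p L)
  obtain c fs where p: "p = (c, fs)" by fastforce
  have "rho_prod \<eta> \<kappa> fs F \<in> fock_fin" "op_comb \<eta> \<kappa> L F \<in> fock_fin"
    using Cons.prems assms(2) by (auto simp: p intro!: rho_prod_fock_fin op_comb_fock_fin)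
  from rho_linear[OF assms(1) this, of c 1] show ?case
    using Cons by (simp add: p op_comb_Cons rho_prod_Cons assms)
qed

lemma rho_prod_op_comb:
  assumes "fs \<in> lists test_functions" "F \<in> fock_fin" "snd ` set L \<subseteq> lists test_functions"
  shows "rho_prod \<eta> \<kappa> fs (op_comb \<eta> \<kappa> L F) = op_comb \<eta> \<kappa> (map (\<lambda>(c, gs). (c, fs @ gs)) L) F"
  using assms(1)
proof (induction fs)
  case Nil
  show ?case by (simp add: rho_prod_Nil op_comb_fock_fin assms)
next
  case (Cons f fs)
  have "snd ` set (map (\<lambda>(c, gs). (c, fs @ gs)) L) \<subseteq> lists test_functions"
    using Cons.hyps assms(3) by fastforce
  then show ?case
    using Cons by (simp add: rho_prod_Cons op_comb_fock_fin assms rho_op_comb o_def case_prod_unfold)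
qed

definition comb_mult :: "(real \<times> 'b list) list \<Rightarrow> (real \<times> 'b list) list \<Rightarrow> (real \<times> 'b list) list" where
  "comb_mult L L' = concat (map (\<lambda>(c, fs). map (\<lambda>(d, gs). (c * d, fs @ gs)) L') L)"

lemma op_comb_mult:
  assumes "F \<in> fock_fin" "snd ` set L \<subseteq> lists test_functions" "snd ` set L' \<subseteq> lists test_functions"
  shows "op_comb \<eta> \<kappa> L (op_comb \<eta> \<kappa> L' F) = op_comb \<eta> \<kappa> (comb_mult L L') F"
  using assms(2)
proof (induction L)
  case Nil
  show ?case by (simp add: op_comb_Nil comb_mult_def)
next
  case (Cons p L)
  obtain c fs where p: "p = (c, fs)" by fastforce
  have "(\<lambda>n xs. c * op_comb \<eta> \<kappa> (map (\<lambda>(c, gs). (c, fs @ gs)) L') F n xs)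
      = op_comb \<eta> \<kappa> (map (\<lambda>(d, gs). (c * d, fs @ gs)) L') F"
    by (simp add: op_comb_def o_def case_prod_unfold sum_list_const_mult[symmetric] mult.assoc)
  then show ?case
    using Cons assms by (simp add: p op_comb_Cons rho_prod_op_comb comb_mult_def op_comb_append fun_eq_iff)
qed

lemma comb_mult_lists:
  "snd ` set L \<subseteq> lists A \<Longrightarrow> snd ` set L' \<subseteq> lists A \<Longrightarrow> snd ` set (comb_mult L L') \<subseteq> lists A"
  by (fastforce simp: comb_mult_def)

lemma density_algebra_op_comb:
  assumes "r \<in> density_algebra \<eta> \<kappa>"
  shows "\<exists>L. snd ` set L \<subseteq> lists test_functions \<and> (\<forall>F\<in>fock_fin. r F = op_comb \<eta> \<kappa> L F)"
  using assms
proof induction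
  case (const c)
  show ?case by (rule exI[of _ "[(c, [])]"]) (simp add: op_comb_def rho_prod_Nil)
next
  case (gen \<phi>)
  then show ?case by (intro exI[of _ "[(1, [\<phi>])]"]) (simp add: op_comb_def rho_prod_Nil rho_prod_Cons)
next
  case (add r s)
  then obtain L L' where "snd ` set L \<subseteq> lists test_functions" "\<forall>F\<in>fock_fin. r F = op_comb \<eta> \<kappa> L F"
    "snd ` set L' \<subseteq> lists test_functions" "\<forall>F\<in>fock_fin. s F = op_comb \<eta> \<kappa> L' F" by blast
  then show ?case by (intro exI[of _ "L @ L'"]) (simp add: op_comb_append image_Un)
next
  case (mult r s)
  then obtain L L' where "snd ` set L \<subseteq> lists test_functions" "\<forall>F\<in>fock_fin. r F = op_comb \<eta> \<kappa> L F"
    "snd ` set L' \<subseteq> lists test_functions" "\<forall>F\<in>fock_fin. s F = op_comb \<eta> \<kappa> L' F" by blast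
  then show ?case
    by (intro exI[of _ "comb_mult L L'"]) (simp add: comb_mult_lists compose_def op_comb_fock_fin op_comb_mult)
qed

text \<open>Replacing each density by its random variable turns an algebra element into a random
  variable \<open>Y L\<close>. Concatenation of words becomes multiplication, so \<tau> of the
  square is the expectation of a square.\<close>

lemma tau_nonneg_of_moments:
  fixes X :: "('a::euclidean_space \<Rightarrow> real) \<Rightarrow> 'w \<Rightarrow> real"
  assumes moments: "\<And>fs. fs \<in> lists test_functions \<Longrightarrow> integrable P (\<lambda>\<omega>. \<Prod>f\<leftarrow>fs. X f \<omega>) \<and>
      tau (rho_prod \<eta> \<kappa> fs) = (\<integral>\<omega>. (\<Prod>f\<leftarrow>fs. X f \<omega>) \<partial>P)"
    and r: "(r :: 'a fock \<Rightarrow> 'a fock) \<in> density_algebra \<eta> \<kappa>"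
  shows "tau (compose fock_fin r r) \<ge> 0"
proof -
  obtain L where L: "snd ` set L \<subseteq> lists test_functions" "\<forall>F\<in>fock_fin. r F = op_comb \<eta> \<kappa> L F"
    using density_algebra_op_comb[OF r] by blast
  define Y where "Y L \<omega> = (\<Sum>(c, fs)\<leftarrow>L. c * (\<Prod>f\<leftarrow>fs. X f \<omega>))" for L \<omega>
  have E: "integrable P (Y L) \<and> op_comb \<eta> \<kappa> L vacuum 0 [] = (\<integral>\<omega>. Y L \<omega> \<partial>P)"
    if "snd ` set L \<subseteq> lists test_functions" for L
    using that
  proof (induction L)
    case Nil
    show ?case by (simp add: Y_def[abs_def] op_comb_Nil)
  next
    case (Cons p L)
    obtain c fs where p: "p = (c, fs)" by fastforce
    have "Y (p # L) = (\<lambda>\<omega>. c * (\<Prod>f\<leftarrow>fs. X f \<omega>) + Y L \<omega>)"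
      by (simp add: Y_def[abs_def] p)
    then show ?case
      using Cons moments[of fs] by (simp add: p op_comb_Cons tau_def)
  qed
  have 1: "Y (map (\<lambda>(d, gs). (c * d, fs @ gs)) L') \<omega> = c * (\<Prod>f\<leftarrow>fs. X f \<omega>) * Y L' \<omega>" for c fs L' \<omega>
    by (simp add: Y_def o_def case_prod_unfold sum_list_const_mult[symmetric] mult_ac)
  have "Y (comb_mult L L') \<omega> = Y L \<omega> * Y L' \<omega>" for L L' \<omega>
  proof (induction L)
    case (Cons p L)
    obtain c fs where p: "p = (c, fs)" by fastforce
    have "Y (comb_mult (p # L) L') \<omega> = Y (map (\<lambda>(d, gs). (c * d, fs @ gs)) L') \<omega> + Y (comb_mult L L') \<omega>"
      by (simp add: Y_def comb_mult_def p)
    also have "\<dots> = (c * (\<Prod>f\<leftarrow>fs. X f \<omega>) + Y L \<omega>) * Y L' \<omega>"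
      unfolding 1 Cons by (simp add: distrib_right)
    finally show ?case by (simp add: Y_def p)
  qed (simp add: Y_def comb_mult_def)
  then have "tau (compose fock_fin r r) = (\<integral>\<omega>. Y L \<omega> * Y L \<omega> \<partial>P)"
    using E[OF comb_mult_lists[OF L(1) L(1)]] L
    by (simp add: tau_def compose_def vacuum_fock_fin op_comb_fock_fin op_comb_mult)
  then show ?thesis by simp
qed

text \<open>The element \<open>r\<close> is the square of the density at \<open>f\<close> minus
  corrections that leave a purely two-particle vector when applied to the vacuum. From such a vector
  only the word \<open>[f, f]\<close> reaches degree 0, which gives \<tau> of the square
  explicitly.\<close>

lemma tau_negative:
  assumes "\<eta> < 0"
  shows "\<exists>r \<in> (density_algebra \<eta> \<kappa> :: (('a::euclidean_space) fock \<Rightarrow> 'a fock) set). tau (compose fock_fin r r) < 0"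
proof -
  obtain f :: "'a \<Rightarrow> real" where f: "f \<in> test_functions"
    and I: "(\<integral>x. f x * f x \<partial>lborel)\<^sup>2 < - \<eta> * (\<integral>x. f x * f x * (f x * f x) \<partial>lborel)"
    using concentrated_bump[of "- \<eta>"] assms by auto
  have f2: "(\<lambda>x. f x * f x) \<in> test_functions" by (intro test_functions_mult f)
  let ?J = "\<integral>x. f x \<partial>lborel" and ?J2 = "\<integral>x. f x * f x \<partial>lborel" and ?J4 = "\<integral>x. f x * f x * (f x * f x) \<partial>lborel"
  \<comment> \<open>The coefficients cancel, in this order, the \<open>f x * f x\<close> part and
    the \<open>f x\<close> part of the degree 1 component, and the degree 0 component, of two
    densities applied to the vacuum.\<close>
  define a b c where "a = \<kappa>\<^sup>2 * (\<beta>\<^sup>2 + \<eta>)" and "b = 2 * \<kappa>\<^sup>2 * ?J"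
    and "c = a * \<kappa>\<^sup>2 * ?J2 + b * \<kappa>\<^sup>2 * ?J - (\<kappa>^4 * \<beta>\<^sup>2 * ?J2 + \<kappa>^4 * ?J\<^sup>2)"
  define L where "L = [(1, [f, f]), (- a, [\<lambda>x. f x * f x]), (- b, [f]), (c, [])]"
  have L: "snd ` set L \<subseteq> lists test_functions" using f f2 by (simp add: L_def)
  define r where "r = (\<lambda>F\<in>fock_fin. op_comb \<eta> \<kappa> L F)"
  define F where "F = r vacuum"
  have F: "F \<in> fock_fin" by (simp add: F_def r_def vacuum_fock_fin op_comb_fock_fin L)
  note rho' = on_msets_rho[OF kappa beta] 
  note bp = beta_pos[OF kappa beta]
  have M2: "M = {#} \<or> (\<exists>x. M = {#x#}) \<or> (\<exists>x y N. M = add_mset x (add_mset y N))" for M :: "'a multiset"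
    by (metis multiset_cases)
  have G1: "on_msets (rho \<eta> \<kappa> \<phi> vacuum) = (\<lambda>M. if M = {#} then \<kappa>\<^sup>2 * (\<integral>x. \<phi> x \<partial>lborel)
      else if size M = 1 then \<kappa>\<^sup>2 * \<beta> * (\<Sum>x\<in>#M. \<phi> x) else 0)" if "\<phi> \<in> test_functions" for \<phi> :: "'a \<Rightarrow> real"
  proof
    fix M :: "'a multiset"
    consider "M = {#}" | x where "M = {#x#}" | x y N where "M = add_mset x (add_mset y N)" using M2 by blast
    then show "on_msets (rho \<eta> \<kappa> \<phi> vacuum) M = (if M = {#} then \<kappa>\<^sup>2 * (\<integral>x. \<phi> x \<partial>lborel)
      else if size M = 1 then \<kappa>\<^sup>2 * \<beta> * (\<Sum>x\<in>#M. \<phi> x) else 0)"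
    proof cases
      case 3
      then have "on_msets vacuum (M - {#z#}) = 0" for z
      proof -
        have "size (M - {#z#}) \<noteq> 0" by (simp add: 3 size_Diff_singleton_if)
        then show ?thesis by (auto simp: on_msets_vacuum simp del: size_eq_0_iff_empty)
      qed
      then show ?thesis using 3
        by (simp add: rho' that vacuum_fock_fin rho_mset_def[OF kappa beta] R_mset_def on_msets_vacuum)
    qed (use bp in \<open>auto simp: rho' that vacuum_fock_fin rho_mset_def[OF kappa beta] R_mset_def on_msets_vacuum\<close>)
  qed
  define G2 where "G2 = on_msets (rho \<eta> \<kappa> f (rho \<eta> \<kappa> f vacuum))"
  have G2: "G2 M = rho_mset \<eta> \<kappa> \<beta> f (on_msets (rho \<eta> \<kappa> f vacuum)) M" for M
    unfolding G2_def by (simp add: rho' f rho_fock_fin vacuum_fock_fin)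
  note simps = rho_mset_def[OF kappa beta] R_mset_def G1[OF f]
  have G2_0: "G2 {#} = \<kappa>^4 * \<beta>\<^sup>2 * ?J2 + \<kappa>^4 * ?J\<^sup>2"
    using bp by (simp add: G2 simps mult.left_commute[of "f _"] field_simps power2_eq_square power4_eq_xxxx)
  have G2_1: "G2 {#x#} = \<kappa>^4 * (2 * \<beta> * ?J * f x + \<beta> * (\<beta>\<^sup>2 + \<eta>) * (f x * f x))" for x
    using bp by (simp add: G2 simps field_simps power2_eq_square power4_eq_xxxx)
  have G2_2: "G2 {#x, y#} = 2 * \<kappa>^4 * \<beta>\<^sup>2 * (f x * f y)" for x y
    by (simp add: G2 simps field_simps power2_eq_square power4_eq_xxxx)
  define G where "G = on_msets F"
  have G: "G M = G2 M - a * on_msets (rho \<eta> \<kappa> (\<lambda>x. f x * f x) vacuum) M - b * on_msets (rho \<eta> \<kappa> f vacuum) M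
      + c * on_msets vacuum M" for M
    by (simp add: G_def F_def r_def vacuum_fock_fin L_def op_comb_def rho_prod_Nil rho_prod_Cons
        G2_def on_msets_def mset_fun_def algebra_simps)
  have G_0: "G {#} = 0"
    by (simp add: G G2_0 G1 f f2 on_msets_vacuum c_def)
  have G_1: "G {#x#} = 0" for x
    by (simp add: G G2_1 G1 f f2 on_msets_vacuum a_def b_def algebra_simps power2_eq_square power4_eq_xxxx)
  have G_2: "G {#x, y#} = 2 * \<kappa>^4 * \<beta>\<^sup>2 * (f x * f y)" for x y
    by (simp add: G G2_2 G1 f f2 on_msets_vacuum)
  have rho_F: "on_msets (rho \<eta> \<kappa> \<phi> F) M = rho_mset \<eta> \<kappa> \<beta> \<phi> G M" if "\<phi> \<in> test_functions" for \<phi> M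
    by (simp add: rho' that F G_def)
  note simps = rho_F rho_mset_def[OF kappa beta] R_mset_def G_0 G_1 G_2
  have rho_F_0: "on_msets (rho \<eta> \<kappa> \<phi> F) {#} = 0" if "\<phi> \<in> test_functions" for \<phi>
    by (simp add: simps that)
  \<comment> \<open>Of the two contributions, contraction yields \<open>?J2\<close>, and doubling
    the point yields the cubic term with its factor \<eta>; integrated against \<open>f\<close> the
    latter becomes the negative fourth moment.\<close>
  have rho_F_1: "on_msets (rho \<eta> \<kappa> f F) {#y#} = 2 * \<kappa>^6 * \<beta>^3 * (f y * ?J2 + \<eta> * (f y * (f y * f y)))" for y
  proof -
    have "(\<integral>z. f z * (2 * \<kappa>^4 * \<beta>\<^sup>2 * (f z * f y)) \<partial>lborel) = 2 * \<kappa>^4 * \<beta>\<^sup>2 * f y * ?J2"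
      unfolding integral_mult_right_zero[symmetric] by (simp add: mult_ac)
    then show ?thesis
      by (simp add: simps f algebra_simps eval_nat_numeral)
  qed
  have "integrable lborel (\<lambda>y. f y * f y)" "integrable lborel (\<lambda>x. f x * f x * (f x * f x))"
    using f by (intro C_0_integrable_lborel C_0_mult test_functions_subset_C_0; simp)+
  then have int: "(\<integral>y. 2 * \<kappa>^6 * \<beta>^3 * (?J2 * (f y * f y) + \<eta> * (f y * f y * (f y * f y))) \<partial>lborel)
      = 2 * \<kappa>^6 * \<beta>^3 * (?J2\<^sup>2 + \<eta> * ?J4)"
    by (simp add: power2_eq_square)
  have "on_msets (rho \<eta> \<kappa> f (rho \<eta> \<kappa> f F)) {#} = \<kappa>\<^sup>2 * \<beta> * (\<integral>y. f y * on_msets (rho \<eta> \<kappa> f F) {#y#} \<partial>lborel)"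
    using rho_F_0[OF f] by (simp add: rho'[OF f rho_fock_fin[OF f F]] rho_mset_def[OF kappa beta] R_mset_def)
  also have "(\<integral>y. f y * on_msets (rho \<eta> \<kappa> f F) {#y#} \<partial>lborel) = 2 * \<kappa>^6 * \<beta>^3 * (?J2\<^sup>2 + \<eta> * ?J4)"
    unfolding int[symmetric] rho_F_1 by (intro Bochner_Integration.integral_cong refl) (simp add: algebra_simps)
  finally have "on_msets (rho \<eta> \<kappa> f (rho \<eta> \<kappa> f F)) {#} < 0"
    using I kappa bp by (simp add: mult_pos_neg)
  moreover have "tau (compose fock_fin r r) = on_msets (rho \<eta> \<kappa> f (rho \<eta> \<kappa> f F)) {#}"
  proof -
    have "tau (compose fock_fin r r) = op_comb \<eta> \<kappa> L F 0 []"
      using F by (simp add: tau_def compose_def vacuum_fock_fin r_def F_def)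
    also have "\<dots> = on_msets (rho \<eta> \<kappa> f (rho \<eta> \<kappa> f F)) {#} - a * on_msets (rho \<eta> \<kappa> (\<lambda>x. f x * f x) F) {#}
       - b * on_msets (rho \<eta> \<kappa> f F) {#} + c * on_msets F {#}"
      using F by (simp add: L_def op_comb_def rho_prod_Nil rho_prod_Cons on_msets_empty)
    finally show ?thesis
      using rho_F_0[OF f] rho_F_0[OF f2] G_0 by (simp add: G_def)
  qed
  ultimately have "tau (compose fock_fin r r) < 0" by simp
  moreover have "r \<in> density_algebra \<eta> \<kappa>"
    unfolding r_def by (rule op_comb_in_density_algebra[OF L])
  ultimately show ?thesis by blast
qed

end

subsection \<open>Moments of random measures\<close>

text \<open>Derivatives are taken along the increments 1/(n+1): dominated convergence then applies
  to a sequence, and a perturbation of a nonnegative damping in a nonnegative direction stays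
  nonnegative.\<close>

lemma LIMSEQ_difference_quotient:
  assumes "(f has_real_derivative D) (at 0)"
  shows "(\<lambda>n. (f (1 / real (Suc n)) - f 0) * real (Suc n)) \<longlonglongrightarrow> D"
proof -
  have "((\<lambda>t. (f t - f 0) / t) \<longlongrightarrow> D) (at 0)"
    using assms by (simp add: has_field_derivative_iff)
  moreover have "filterlim (\<lambda>n. 1 / real (Suc n)) (at 0) sequentially"
    using LIMSEQ_inverse_real_of_nat by (auto simp: filterlim_at inverse_eq_divide)
  ultimately have "(\<lambda>n. (f (1 / real (Suc n)) - f 0) / (1 / real (Suc n))) \<longlonglongrightarrow> D"
    by (rule filterlim_compose)
  then show ?thesis by simp
qed

lemma LIMSEQ_of_difference_quotient:
  fixes a :: "nat \<Rightarrow> real"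
  assumes "(\<lambda>n. (a n - A) * real (Suc n)) \<longlonglongrightarrow> D"
  shows "a \<longlonglongrightarrow> A"
proof -
  have "(\<lambda>n. (a n - A) * real (Suc n) * inverse (real (Suc n))) \<longlonglongrightarrow> D * 0"
    by (rule tendsto_mult[OF assms LIMSEQ_inverse_real_of_nat])
  then have "(\<lambda>n. a n - A) \<longlonglongrightarrow> 0" by (simp add: mult.assoc del: of_nat_Suc)
  then show ?thesis by (simp add: LIM_zero_iff)
qed

lemma LIMSEQ_difference_quotient_mult:
  fixes a b :: "nat \<Rightarrow> real"
  assumes a: "(\<lambda>n. (a n - A) * real (Suc n)) \<longlonglongrightarrow> A'" and b: "(\<lambda>n. (b n - B) * real (Suc n)) \<longlonglongrightarrow> B'"
  shows "(\<lambda>n. (a n * b n - A * B) * real (Suc n)) \<longlonglongrightarrow> A' * B + A * B'"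
proof -
  have "(\<lambda>n. ((a n - A) * real (Suc n)) * b n + A * ((b n - B) * real (Suc n))) \<longlonglongrightarrow> A' * B + A * B'"
    by (intro tendsto_intros a b LIMSEQ_of_difference_quotient[OF b])
  then show ?thesis by (simp add: algebra_simps)
qed

text \<open>Caratheodory's form of the derivative avoids dividing by \<open>a n - A\<close>, which
  may vanish.\<close>

lemma LIMSEQ_difference_quotient_compose:
  fixes a :: "nat \<Rightarrow> real"
  assumes a: "(\<lambda>n. (a n - A) * real (Suc n)) \<longlonglongrightarrow> A'" and f: "(f has_real_derivative D) (at A)"
  shows "(\<lambda>n. (f (a n) - f A) * real (Suc n)) \<longlonglongrightarrow> D * A'"
proof -
  obtain g where g: "\<And>z. f z - f A = g z * (z - A)" "isCont g A" "g A = D"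
    using f unfolding CARAT_DERIV by blast
  have "(\<lambda>n. g (a n) * ((a n - A) * real (Suc n))) \<longlonglongrightarrow> g A * A'"
    by (intro tendsto_mult a isCont_tendsto_compose[OF g(2)] LIMSEQ_of_difference_quotient[OF a])
  then show ?thesis by (simp add: g mult.assoc)
qed

lemma LIMSEQ_difference_quotient_sum_list:
  fixes a :: "'b \<Rightarrow> nat \<Rightarrow> real"
  assumes "\<And>i. i \<in> set L \<Longrightarrow> (\<lambda>n. (a i n - A i) * real (Suc n)) \<longlonglongrightarrow> D i"
  shows "(\<lambda>n. ((\<Sum>i\<leftarrow>L. a i n) - (\<Sum>i\<leftarrow>L. A i)) * real (Suc n)) \<longlonglongrightarrow> (\<Sum>i\<leftarrow>L. D i)"
  using assms
proof (induction L)
  case (Cons i L)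
  have "(\<lambda>n. (a i n - A i) * real (Suc n) + ((\<Sum>i\<leftarrow>L. a i n) - (\<Sum>i\<leftarrow>L. A i)) * real (Suc n)) \<longlonglongrightarrow> D i + (\<Sum>i\<leftarrow>L. D i)"
    using Cons by (intro tendsto_add) auto
  then show ?case by (simp add: algebra_simps)
qed simp

text \<open>Differentiation under the integral: the mean value inequality on the half-line bounds
  the difference quotients by a constant multiple of \<open>g\<close>, which is integrable.\<close>

lemma LIMSEQ_difference_quotient_integral:
  fixes F g h :: "'a::euclidean_space \<Rightarrow> real"
  assumes k: "\<And>y. y \<ge> 0 \<Longrightarrow> (k has_real_derivative k' y) (at y)" "\<And>y. y \<ge> 0 \<Longrightarrow> \<bar>k' y\<bar> \<le> L"
    and h: "h \<in> C_0" "\<And>x. h x \<ge> 0" and g: "g \<in> C_0" "\<And>x. g x \<ge> 0"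
    and F: "F \<in> borel_measurable borel" "\<And>x. \<bar>F x\<bar> \<le> B"
    and int: "\<And>h. h \<in> C_0 \<Longrightarrow> (\<And>x. h x \<ge> 0) \<Longrightarrow> integrable lborel (\<lambda>x. F x * k (h x))"
  shows "(\<lambda>n. ((\<integral>x. F x * k (h x + 1 / real (Suc n) * g x) \<partial>lborel) - (\<integral>x. F x * k (h x) \<partial>lborel)) * real (Suc n))
      \<longlonglongrightarrow> (\<integral>x. F x * (g x * k' (h x)) \<partial>lborel)"
proof -
  have hg: "(\<lambda>x. h x + t * g x) \<in> C_0" for t
    by (intro C_0_add C_0_cmult h g)
  let ?d = "\<lambda>n x. F x * ((k (h x + 1 / real (Suc n) * g x) - k (h x)) * real (Suc n))"
  have int_n: "integrable lborel (\<lambda>x. F x * k (h x + 1 / real (Suc n) * g x))" for n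
    using h(2) g(2) by (intro int hg) auto
  have eq: "((\<integral>x. F x * k (h x + 1 / real (Suc n) * g x) \<partial>lborel) - (\<integral>x. F x * k (h x) \<partial>lborel)) * real (Suc n)
      = (\<integral>x. ?d n x \<partial>lborel)" for n
  proof -
    have "(\<integral>x. ?d n x \<partial>lborel) = (\<integral>x. (F x * k (h x + 1 / real (Suc n) * g x) - F x * k (h x)) * real (Suc n) \<partial>lborel)"
      by (intro Bochner_Integration.integral_cong refl) (simp add: algebra_simps)
    also have "\<dots> = ((\<integral>x. F x * k (h x + 1 / real (Suc n) * g x) \<partial>lborel) - (\<integral>x. F x * k (h x) \<partial>lborel)) * real (Suc n)"
      using int_n[of n] int[OF h] by (simp del: of_nat_Suc)
    finally show ?thesis ..
  qed
  have lim: "(\<lambda>n. ?d n x) \<longlonglongrightarrow> F x * (g x * k' (h x))" for x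
  proof (rule tendsto_mult[OF tendsto_const])
    have "((\<lambda>t. k (h x + t * g x)) has_real_derivative k' (h x) * g x) (at 0)"
    proof (rule DERIV_chain2[where f = k and g = "\<lambda>t. h x + t * g x"])
      show "(k has_real_derivative k' (h x)) (at (h x + 0 * g x))" using k(1)[OF h(2)] by simp
    qed (auto intro!: derivative_eq_intros)
    from LIMSEQ_difference_quotient[OF this]
    show "(\<lambda>n. (k (h x + 1 / real (Suc n) * g x) - k (h x)) * real (Suc n)) \<longlonglongrightarrow> g x * k' (h x)"
      by (simp add: mult.commute)
  qed
  have bound: "norm (?d n x) \<le> B * (L * g x)" for n x
  proof -
    let ?t = "1 / real (Suc n) * g x"
    have t: "?t \<ge> 0" using g(2) by simp
    have "norm (k (h x + ?t) - k (h x)) \<le> L * norm (h x + ?t - h x)"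
    proof (rule field_differentiable_bound[where S = "{0..}" and f = k and f' = k'])
      show "(k has_field_derivative k' z) (at z within {0..})" if "z \<in> {0..}" for z
        using k(1)[of z] that by (auto intro: has_field_derivative_at_within)
    qed (use k(2) h(2)[of x] t in auto)
    moreover have "norm (h x + ?t - h x) = ?t"
      using g(2)[of x] by (simp del: of_nat_Suc)
    ultimately have "\<bar>k (h x + ?t) - k (h x)\<bar> \<le> L * ?t"
      by (simp only: real_norm_def)
    then have "\<bar>k (h x + ?t) - k (h x)\<bar> * real (Suc n) \<le> L * ?t * real (Suc n)"
      by (rule mult_right_mono) simp
    then have *: "\<bar>(k (h x + ?t) - k (h x)) * real (Suc n)\<bar> \<le> L * g x"
      by (simp add: abs_mult)
    have "\<bar>F x\<bar> * \<bar>(k (h x + ?t) - k (h x)) * real (Suc n)\<bar> \<le> B * (L * g x)"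
      by (rule mult_mono[OF F(2) *]) (use F(2)[of x] in linarith, rule abs_ge_zero)
    then show ?thesis
      by (simp only: real_norm_def abs_mult[of "F x"])
  qed
  have "(\<lambda>n. \<integral>x. ?d n x \<partial>lborel) \<longlonglongrightarrow> (\<integral>x. F x * (g x * k' (h x)) \<partial>lborel)"
  proof (rule integral_dominated_convergence)
    show "integrable lborel (\<lambda>x. B * (L * g x))"
      using C_0_integrable_lborel[OF g(1)] by simp
    have m: "?d n \<in> borel_measurable lborel" for n
    proof -
      have "?d n = (\<lambda>x. (F x * k (h x + 1 / real (Suc n) * g x) - F x * k (h x)) * real (Suc n))"
        by (simp add: algebra_simps fun_eq_iff)
      then show ?thesis
        using int_n[of n] int[OF h] by (auto intro!: borel_measurable_times borel_measurable_diff dest: borel_measurable_integrable)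
    qed
    then show "?d n \<in> borel_measurable lborel" for n .
    show "(\<lambda>x. F x * (g x * k' (h x))) \<in> borel_measurable lborel"
      by (rule borel_measurable_LIMSEQ_real[OF lim m])
  qed (use lim bound in auto)
  then show ?thesis unfolding eq .
qed

lemma power_le_fact_exp:
  fixes x :: real
  assumes "x \<ge> 0"
  shows "x ^ n \<le> fact n * exp x"
proof -
  have "(\<Sum>k\<in>{n}. x ^ k /\<^sub>R fact k) \<le> (\<Sum>k. x ^ k /\<^sub>R fact k)"
    by (rule sum_le_suminf) (use assms summable_exp_generic[of x] in auto)
  then show ?thesis by (simp add: exp_def field_simps)
qed

text \<open>\<open>X f\<close> stands for the integral of \<open>f\<close> against the random
  measure. The exponent \<epsilon> may depend on \<open>f\<close>, because negative binomial masses
  have only small exponential moments.\<close>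

locale linear_statistics = prob_space P for P :: "'w measure" +
  fixes X :: "('a::euclidean_space \<Rightarrow> real) \<Rightarrow> 'w \<Rightarrow> real"
  assumes X_measurable: "f \<in> C_0 \<Longrightarrow> X f \<in> borel_measurable P"
    and X_add: "f \<in> C_0 \<Longrightarrow> g \<in> C_0 \<Longrightarrow> \<omega> \<in> space P \<Longrightarrow> X (\<lambda>x. f x + g x) \<omega> = X f \<omega> + X g \<omega>"
    and X_cmult: "f \<in> C_0 \<Longrightarrow> \<omega> \<in> space P \<Longrightarrow> X (\<lambda>x. c * f x) \<omega> = c * X f \<omega>"
    and X_nonneg: "f \<in> C_0 \<Longrightarrow> (\<And>x. f x \<ge> 0) \<Longrightarrow> \<omega> \<in> space P \<Longrightarrow> X f \<omega> \<ge> 0"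
    and exponential_moment: "f \<in> C_0 \<Longrightarrow> (\<And>x. f x \<ge> 0) \<Longrightarrow> \<exists>\<epsilon>>0. integrable P (\<lambda>\<omega>. exp (\<epsilon> * X f \<omega>))"
begin

definition damped_moment :: "('a \<Rightarrow> real) \<Rightarrow> ('a \<Rightarrow> real) list \<Rightarrow> real" where
  "damped_moment h fs = (\<integral>\<omega>. (\<Prod>f\<leftarrow>fs. X f \<omega>) * exp (- X h \<omega>) \<partial>P)"

lemma X_abs_le:
  assumes "f \<in> C_0" "g \<in> C_0" "\<And>x. \<bar>f x\<bar> \<le> g x" "\<omega> \<in> space P"
  shows "\<bar>X f \<omega>\<bar> \<le> X g \<omega>"
proof -
  have "X (\<lambda>x. g x + c * f x) \<omega> \<ge> 0" if "c = 1 \<or> c = -1" for c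
    using assms(3) that by (intro X_nonneg C_0_add C_0_cmult assms) (auto simp: abs_le_iff, smt (verit))
  \<comment> \<open>Nonnegativity of \<open>X\<close> at \<open>g + f\<close> and at
    \<open>g - f\<close> gives the two one-sided bounds.\<close>
  then have "X g \<omega> + c * X f \<omega> \<ge> 0" if "c = 1 \<or> c = -1" for c
    using that X_add[OF assms(2) C_0_cmult[OF assms(1), of c] assms(4)] X_cmult[OF assms(1,4)] by metis
  from this[of 1] this[of "-1"] show ?thesis by simp
qed

text \<open>All factors are dominated by \<open>X s\<close> with \<open>s\<close> the sum of the
  absolute values, and a power of \<open>X s\<close> is dominated by its exponential.\<close>

lemma integrable_prod_X:
  assumes "fs \<in> lists C_0"
  shows "integrable P (\<lambda>\<omega>. \<Prod>f\<leftarrow>fs. X f \<omega>)"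
proof -
  define s where "s = (\<lambda>x. \<Sum>f\<leftarrow>fs. \<bar>f x\<bar>)"
  have "(\<lambda>x. \<Sum>f\<leftarrow>map (\<lambda>f x. \<bar>f x\<bar>) fs. f x) \<in> C_0"
    using assms by (intro C_0_sum_list) (auto intro: C_0_abs)
  then have s: "s \<in> C_0" "\<And>x. s x \<ge> 0"
    by (auto simp: s_def o_def intro!: sum_list_nonneg)
  obtain \<epsilon> where e: "\<epsilon> > 0" "integrable P (\<lambda>\<omega>. exp (\<epsilon> * X s \<omega>))"
    using exponential_moment[OF s] by blast
  have "\<bar>f x\<bar> \<le> s x" if "f \<in> set fs" for f x
    unfolding s_def using that by (intro member_le_sum_list) auto
  then have Xs: "\<bar>X f \<omega>\<bar> \<le> X s \<omega>" if "f \<in> set fs" "\<omega> \<in> space P" for f \<omega>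
    using that assms by (intro X_abs_le s) auto
  have "\<bar>\<Prod>f\<leftarrow>gs. X f \<omega>\<bar> \<le> X s \<omega> ^ length gs" if "set gs \<subseteq> set fs" "\<omega> \<in> space P" for gs \<omega>
    using that(1)
  proof (induction gs)
    case (Cons g gs)
    then show ?case
      using Xs[OF _ that(2)] X_nonneg[OF s that(2)] by (auto simp: abs_mult intro!: mult_mono)
  qed simp
  then have "AE \<omega> in P. norm (\<Prod>f\<leftarrow>fs. X f \<omega>) \<le> norm (fact (length fs) / \<epsilon> ^ length fs * exp (\<epsilon> * X s \<omega>))"
  proof (intro AE_I2)
    fix \<omega> assume *: "\<And>gs \<omega>. set gs \<subseteq> set fs \<Longrightarrow> \<omega> \<in> space P \<Longrightarrow> \<bar>\<Prod>f\<leftarrow>gs. X f \<omega>\<bar> \<le> X s \<omega> ^ length gs"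
      and w: "\<omega> \<in> space P"
    have "(\<epsilon> * X s \<omega>) ^ length fs \<le> fact (length fs) * exp (\<epsilon> * X s \<omega>)"
      using e X_nonneg[OF s w] by (intro power_le_fact_exp) simp
    then have "X s \<omega> ^ length fs \<le> fact (length fs) / \<epsilon> ^ length fs * exp (\<epsilon> * X s \<omega>)"
      using e by (simp add: power_mult_distrib field_simps)
    with *[of fs \<omega>] w show "norm (\<Prod>f\<leftarrow>fs. X f \<omega>) \<le> norm (fact (length fs) / \<epsilon> ^ length fs * exp (\<epsilon> * X s \<omega>))"
      using e by simp
  qed
  moreover have "(\<lambda>\<omega>. \<Prod>f\<leftarrow>fs. X f \<omega>) \<in> borel_measurable P"
    using assms by (induction fs) (auto intro: borel_measurable_times X_measurable)
  moreover have "integrable P (\<lambda>\<omega>. fact (length fs) / \<epsilon> ^ length fs * exp (\<epsilon> * X s \<omega>))"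
    using e by simp
  ultimately show ?thesis
    using Bochner_Integration.integrable_bound by blast
qed

lemma integrable_damped:
  assumes "fs \<in> lists C_0" "h \<in> C_0" "\<And>x. h x \<ge> 0"
  shows "integrable P (\<lambda>\<omega>. (\<Prod>f\<leftarrow>fs. X f \<omega>) * exp (- X h \<omega>))"
proof (rule Bochner_Integration.integrable_bound[OF integrable_prod_X[OF assms(1)]])
  show "(\<lambda>\<omega>. (\<Prod>f\<leftarrow>fs. X f \<omega>) * exp (- X h \<omega>)) \<in> borel_measurable P"
    using integrable_prod_X[OF assms(1)] X_measurable[OF assms(2)] by measurable
  show "AE \<omega> in P. norm ((\<Prod>f\<leftarrow>fs. X f \<omega>) * exp (- X h \<omega>)) \<le> norm (\<Prod>f\<leftarrow>fs. X f \<omega>)"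
    using X_nonneg[OF assms(2,3)] by (intro AE_I2) (auto simp: abs_mult mult_left_le)
qed

lemma damped_moment_swap: "damped_moment h (f # g # fs) = damped_moment h (g # f # fs)"
  by (simp add: damped_moment_def mult_ac)

lemma damped_moment_diff:
  assumes "fs \<in> lists C_0" "h \<in> C_0" "\<And>x. h x \<ge> 0" "f \<in> C_0" "g \<in> C_0"
  shows "damped_moment h ((\<lambda>x. f x - g x) # fs) = damped_moment h (f # fs) - damped_moment h (g # fs)"
proof -
  have "X (\<lambda>x. f x - g x) \<omega> = X f \<omega> - X g \<omega>" if "\<omega> \<in> space P" for \<omega>
    using X_add[OF assms(4) C_0_cmult[OF assms(5), of "-1"] that] X_cmult[OF assms(5) that, of "-1"] by simp
  then have "damped_moment h ((\<lambda>x. f x - g x) # fs)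
      = (\<integral>\<omega>. (\<Prod>f\<leftarrow>f # fs. X f \<omega>) * exp (- X h \<omega>) - (\<Prod>f\<leftarrow>g # fs. X f \<omega>) * exp (- X h \<omega>) \<partial>P)"
    unfolding damped_moment_def by (intro Bochner_Integration.integral_cong refl) (simp add: left_diff_distrib)
  also have "\<dots> = damped_moment h (f # fs) - damped_moment h (g # fs)"
    unfolding damped_moment_def using assms by (intro Bochner_Integration.integral_diff integrable_damped) auto
  finally show ?thesis .
qed

text \<open>A derivative of the damping in direction \<open>g\<close> brings down the factor
  \<open>- X g\<close>. Domination is by the integrand with \<open>g\<close> prepended, from 1 - t
  <= exp(-t) <= 1 for t >= 0.\<close>

lemma damped_moment_difference_quotient:
  assumes fs: "fs \<in> lists C_0" and h: "h \<in> C_0" "\<And>x. h x \<ge> 0" and g: "g \<in> C_0" "\<And>x. g x \<ge> 0"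
  shows "(\<lambda>n. (damped_moment (\<lambda>x. h x + 1 / real (Suc n) * g x) fs - damped_moment h fs) * real (Suc n))
    \<longlonglongrightarrow> - damped_moment h (g # fs)"
proof -
  let ?Y = "\<lambda>\<omega>. (\<Prod>f\<leftarrow>fs. X f \<omega>) * exp (- X h \<omega>)"
  let ?d = "\<lambda>n \<omega>. ?Y \<omega> * ((exp (- (1 / real (Suc n) * X g \<omega>)) - 1) * real (Suc n))"
  have hg: "(\<lambda>x. h x + 1 / real (Suc n) * g x) \<in> C_0" for n
    by (intro C_0_add C_0_cmult h g)
  have Xhg: "X (\<lambda>x. h x + 1 / real (Suc n) * g x) \<omega> = X h \<omega> + 1 / real (Suc n) * X g \<omega>" if "\<omega> \<in> space P" for n \<omega>
    by (simp only: X_add[OF h(1) C_0_cmult[OF g(1)] that] X_cmult[OF g(1) that])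
  have eq: "(damped_moment (\<lambda>x. h x + 1 / real (Suc n) * g x) fs - damped_moment h fs) * real (Suc n)
      = (\<integral>\<omega>. ?d n \<omega> \<partial>P)" for n
  proof -
    have "(\<integral>\<omega>. ?d n \<omega> \<partial>P) = (\<integral>\<omega>. ((\<Prod>f\<leftarrow>fs. X f \<omega>) * exp (- X (\<lambda>x. h x + 1 / real (Suc n) * g x) \<omega>) - ?Y \<omega>) * real (Suc n) \<partial>P)"
    proof (intro Bochner_Integration.integral_cong refl)
      fix \<omega> assume w: "\<omega> \<in> space P"
      have "exp (- (X h \<omega> + 1 / real (Suc n) * X g \<omega>)) = exp (- X h \<omega>) * exp (- (1 / real (Suc n) * X g \<omega>))"
        by (simp add: exp_add[symmetric])
      then show "?d n \<omega> = ((\<Prod>f\<leftarrow>fs. X f \<omega>) * exp (- X (\<lambda>x. h x + 1 / real (Suc n) * g x) \<omega>) - ?Y \<omega>) * real (Suc n)"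
        unfolding Xhg[OF w] by (simp only: right_diff_distrib left_diff_distrib mult.assoc mult_1_left)
    qed
    also have "\<dots> = (damped_moment (\<lambda>x. h x + 1 / real (Suc n) * g x) fs - damped_moment h fs) * real (Suc n)"
      unfolding damped_moment_def
      using integrable_damped[OF fs hg] integrable_damped[OF fs h] h(2) g(2) by (simp del: of_nat_Suc)
    finally show ?thesis ..
  qed
  have lim: "(\<lambda>n. ?d n \<omega>) \<longlonglongrightarrow> ?Y \<omega> * (- X g \<omega>)" for \<omega>
  proof (rule tendsto_mult[OF tendsto_const])
    have "((\<lambda>t. exp (- (t * X g \<omega>))) has_real_derivative - X g \<omega>) (at 0)"
      by (auto intro!: derivative_eq_intros)
    from LIMSEQ_difference_quotient[OF this]
    show "(\<lambda>n. (exp (- (1 / real (Suc n) * X g \<omega>)) - 1) * real (Suc n)) \<longlonglongrightarrow> - X g \<omega>" by simp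
  qed
  have bound: "norm (?d n \<omega>) \<le> norm ((\<Prod>f\<leftarrow>g # fs. X f \<omega>) * exp (- X h \<omega>))" if "\<omega> \<in> space P" for n \<omega>
  proof -
    have Xg: "X g \<omega> \<ge> 0" by (rule X_nonneg[OF g that])
    let ?t = "1 / real (Suc n) * X g \<omega>"
    have "exp (- ?t) \<le> 1" "1 - ?t \<le> exp (- ?t)"
      using Xg exp_ge_add_one_self[of "- ?t"] by auto
    then have "\<bar>exp (- ?t) - 1\<bar> * real (Suc n) \<le> ?t * real (Suc n)"
      by (intro mult_right_mono) auto
    then have "\<bar>(exp (- ?t) - 1) * real (Suc n)\<bar> \<le> X g \<omega>"
      by (simp add: abs_mult)
    then have "\<bar>?Y \<omega>\<bar> * \<bar>(exp (- ?t) - 1) * real (Suc n)\<bar> \<le> \<bar>?Y \<omega>\<bar> * X g \<omega>"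
      by (rule mult_left_mono) simp
    then show ?thesis using Xg by (simp add: abs_mult mult_ac del: of_nat_Suc)
  qed
  have "(\<lambda>n. \<integral>\<omega>. ?d n \<omega> \<partial>P) \<longlonglongrightarrow> (\<integral>\<omega>. ?Y \<omega> * (- X g \<omega>) \<partial>P)"
  proof (rule integral_dominated_convergence)
    show "integrable P (\<lambda>\<omega>. norm ((\<Prod>f\<leftarrow>g # fs. X f \<omega>) * exp (- X h \<omega>)))"
      using fs g h by (intro integrable_norm integrable_damped) auto
    note [measurable] = borel_measurable_integrable[OF integrable_damped[OF fs h]] X_measurable[OF g(1)]
    show "?d n \<in> borel_measurable P" for n by measurable
    show "(\<lambda>\<omega>. ?Y \<omega> * (- X g \<omega>)) \<in> borel_measurable P" by measurable
    show "AE \<omega> in P. norm (?d n \<omega>) \<le> norm ((\<Prod>f\<leftarrow>g # fs. X f \<omega>) * exp (- X h \<omega>))" for n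
      using bound by (intro AE_I2)
  qed (use lim in auto)
  moreover have "(\<integral>\<omega>. ?Y \<omega> * (- X g \<omega>) \<partial>P) = - damped_moment h (g # fs)"
    unfolding damped_moment_def Bochner_Integration.integral_minus[symmetric]
    by (intro Bochner_Integration.integral_cong refl) (simp add: mult_ac)
  ultimately show ?thesis unfolding eq by simp
qed

end

text \<open>The normalised solution of \<open>w' = - w (1 + \<eta> \<kappa>\<^sup>2 w)\<close>, \<open>w 0 = 1\<close>, where \<open>\<eta> \<kappa>\<^sup>2 = p / (1 - p)\<close>.\<close>

definition tilt :: "real \<Rightarrow> real \<Rightarrow> real" where
  "tilt p y = exp (- y) * (1 - p) / (1 - p * exp (- y))"

lemma tilt_0: "p < 1 \<Longrightarrow> tilt p 0 = 1"
  by (simp add: tilt_def)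

context
  fixes p :: real
  assumes p: "0 \<le> p" "p < 1"
begin

lemma tilt_denom_pos: "y \<ge> 0 \<Longrightarrow> 1 - p * exp (- y) > 0"
proof -
  assume "y \<ge> 0"
  then have "p * exp (- y) \<le> p * 1" using p by (intro mult_left_mono) auto
  with p show ?thesis by simp
qed

lemma tilt_bounds: "y \<ge> 0 \<Longrightarrow> 0 \<le> tilt p y \<and> tilt p y \<le> 1"
  using tilt_denom_pos[of y] p by (auto simp: tilt_def field_simps)

lemma tilt_has_derivative:
  assumes "y \<ge> 0" "a = p / (1 - p)"
  shows "(tilt p has_real_derivative - (tilt p y * (1 + a * tilt p y))) (at y)"
proof -
  have d: "1 - p * exp (- y) \<noteq> 0" "1 - p \<noteq> 0" using tilt_denom_pos[OF assms(1)] p by auto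
  have "(tilt p has_real_derivative
      ((- exp (- y) * (1 - p)) * (1 - p * exp (- y)) - exp (- y) * (1 - p) * (p * exp (- y))) / ((1 - p * exp (- y)) * (1 - p * exp (- y)))) (at y)"
    unfolding tilt_def[abs_def] using d by (auto intro!: derivative_eq_intros simp: mult_ac)
  moreover have "((- exp (- y) * (1 - p)) * (1 - p * exp (- y)) - exp (- y) * (1 - p) * (p * exp (- y))) / ((1 - p * exp (- y)) * (1 - p * exp (- y)))
     = - (tilt p y * (1 + a * tilt p y))"
  proof -
    have "(- e * q * D - e * q * (p * e)) / (D * D) = - (e * q / D * (1 + p / q * (e * q / D)))"
      if "D \<noteq> 0" "q \<noteq> 0" for e q D :: real
      using that by (simp add: field_simps)
    from this[OF d, of "exp (- y)"] show ?thesis by (simp only: tilt_def assms(2))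
  qed
  ultimately show ?thesis by simp
qed

end

text \<open>\<Psi> is the Laplace exponent per unit volume. The Poisson case has
  \<open>p = 0\<close>, where \<open>tilt 0 y\<close> is \<open>exp (- y)\<close>; the negative
  binomial case has \<open>p = \<eta> / (\<eta> + 1 / \<kappa>\<^sup>2)\<close>.\<close>

locale tilted_statistics = linear_statistics P X for P :: "'w measure" and X :: "('a::euclidean_space \<Rightarrow> real) \<Rightarrow> 'w \<Rightarrow> real" +
  fixes \<eta> \<kappa> p :: real and \<Psi> :: "real \<Rightarrow> real"
  assumes p: "0 \<le> p" "p < 1" "\<eta> * \<kappa>\<^sup>2 = p / (1 - p)"
    and Psi_0: "\<Psi> 0 = 0"
    and Psi_derivative: "y \<ge> 0 \<Longrightarrow> (\<Psi> has_real_derivative - (\<kappa>\<^sup>2 * tilt p y)) (at y)"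
    and laplace: "h \<in> C_0 \<Longrightarrow> (\<And>x. h x \<ge> 0) \<Longrightarrow> (\<integral>\<omega>. exp (- X h \<omega>) \<partial>P) = exp (\<integral>x. \<Psi> (h x) \<partial>lborel)"
begin

text \<open>The cumulant of order \<open>Suc j\<close> per unit volume under damping
  \<open>y\<close>. At \<open>y = 0\<close> the tilt is 1 and the cumulants of \<tau>
  reappear.\<close>

definition cumulant_fun :: "nat \<Rightarrow> real \<Rightarrow> real" where
  "cumulant_fun j y = poly (cumulant_poly \<eta> \<kappa> j) (tilt p y)"

text \<open>The Riccati equation of \<open>tilt\<close> turns d/dy into minus the derivation that
  defines \<open>cumulant_poly\<close>. This is where the algebraic and the probabilistic recursion
  meet.\<close>

lemma cumulant_fun_derivative:
  assumes "y \<ge> 0"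
  shows "(cumulant_fun j has_real_derivative - cumulant_fun (Suc j) y) (at y)"
proof -
  have "(cumulant_fun j has_real_derivative
      poly (pderiv (cumulant_poly \<eta> \<kappa> j)) (tilt p y) * - (tilt p y * (1 + (\<eta> * \<kappa>\<^sup>2) * tilt p y))) (at y)"
    unfolding cumulant_fun_def[abs_def]
    by (rule DERIV_chain2[OF poly_DERIV tilt_has_derivative[OF p(1,2) assms p(3)]])
  then show ?thesis by (simp add: cumulant_fun_def algebra_simps)
qed

lemma cumulant_fun_bounded: obtains L where "L \<ge> 0" "\<And>y. y \<ge> 0 \<Longrightarrow> \<bar>cumulant_fun j y\<bar> \<le> L"
proof -
  have "continuous_on {0..1} (\<lambda>w. poly (cumulant_poly \<eta> \<kappa> j) w)"
    by (intro continuous_intros)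
  then have "bounded ((\<lambda>w. poly (cumulant_poly \<eta> \<kappa> j) w) ` {0..1})"
    by (intro compact_imp_bounded compact_continuous_image) auto
  then obtain L where "L > 0" "\<And>w. w \<in> {0..1} \<Longrightarrow> \<bar>poly (cumulant_poly \<eta> \<kappa> j) w\<bar> \<le> L"
    by (auto simp: bounded_pos)
  then show thesis
    using that[of L] tilt_bounds[OF p(1,2)] by (auto simp: cumulant_fun_def)
qed

lemma cumulant_fun_continuous: "continuous_on {0..} (cumulant_fun j)"
  using cumulant_fun_derivative by (intro DERIV_continuous_on) (auto intro: has_field_derivative_at_within)

lemma C_0_mult_cumulant_fun:
  assumes "F \<in> C_0" "h \<in> C_0" "\<And>x. h x \<ge> 0"
  shows "(\<lambda>x. F x * cumulant_fun j (h x)) \<in> C_0"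
proof (rule C_0_mult_left[OF assms(1)])
  show "continuous_on UNIV (\<lambda>x. cumulant_fun j (h x))"
    by (rule continuous_on_compose2[OF cumulant_fun_continuous]) (use assms in \<open>auto simp: C_0_iff\<close>)
qed

text \<open>Differentiate both sides of the Laplace formula in a direction \<open>f >= 0\<close>;
  the chain rule for \<open>exp\<close> reproduces the Laplace transform as a factor.\<close>

lemma damped_moment_single:
  assumes "f \<in> C_0" "h \<in> C_0" "\<And>x. h x \<ge> 0"
  shows "damped_moment h [f] = (\<integral>x. f x * cumulant_fun 0 (h x) \<partial>lborel) * damped_moment h []"
proof -
  have nonneg: "damped_moment h [f] = (\<integral>x. f x * cumulant_fun 0 (h x) \<partial>lborel) * damped_moment h []"
    if f: "f \<in> C_0" "\<And>x. f x \<ge> 0" for f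
  proof -
    obtain L where L: "\<And>y. y \<ge> 0 \<Longrightarrow> \<bar>cumulant_fun 0 y\<bar> \<le> L" using cumulant_fun_bounded by blast
    have D: "(\<Psi> has_real_derivative - cumulant_fun 0 y) (at y)" if "y \<ge> 0" for y
      using Psi_derivative[OF that] by (simp add: cumulant_fun_def mult.commute)
    have int: "integrable lborel (\<lambda>x. 1 * \<Psi> (h x))" if h: "h \<in> C_0" "\<And>x. h x \<ge> 0" for h :: "'a \<Rightarrow> real"
    proof -
      have "continuous_on {0..} \<Psi>"
        using D by (intro DERIV_continuous_on) (auto intro: has_field_derivative_at_within)
      then have "continuous_on UNIV (\<lambda>x. \<Psi> (h x))"
        by (rule continuous_on_compose2) (use h in \<open>auto simp: C_0_iff\<close>)
      then have "(\<lambda>x. \<Psi> (h x)) \<in> C_0"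
        using h Psi_0 by (auto simp: C_0_iff elim!: bounded_subset)
      then show ?thesis by (simp add: C_0_integrable_lborel)
    qed
    have "(\<lambda>n. ((\<integral>x. 1 * \<Psi> (h x + 1 / real (Suc n) * f x) \<partial>lborel) - (\<integral>x. 1 * \<Psi> (h x) \<partial>lborel)) * real (Suc n))
        \<longlonglongrightarrow> (\<integral>x. 1 * (f x * - cumulant_fun 0 (h x)) \<partial>lborel)"
      by (rule LIMSEQ_difference_quotient_integral[where L = L and B = 1])
        (use D L int assms(2,3) f in auto)
    from LIMSEQ_difference_quotient_compose[OF this DERIV_exp]
    have "(\<lambda>n. (exp (\<integral>x. \<Psi> (h x + 1 / real (Suc n) * f x) \<partial>lborel) - exp (\<integral>x. \<Psi> (h x) \<partial>lborel)) * real (Suc n))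
        \<longlonglongrightarrow> exp (\<integral>x. \<Psi> (h x) \<partial>lborel) * - (\<integral>x. f x * cumulant_fun 0 (h x) \<partial>lborel)"
      by simp
    moreover have "damped_moment h [] = exp (\<integral>x. \<Psi> (h x) \<partial>lborel)" if "h \<in> C_0" "\<And>x. h x \<ge> 0" for h
      using laplace[OF that] by (simp add: damped_moment_def)
    moreover have "(\<lambda>x. h x + 1 / real (Suc n) * f x) \<in> C_0" "h x + 1 / real (Suc n) * f x \<ge> 0" for n x
      using assms f by (auto intro!: C_0_add C_0_cmult add_nonneg_nonneg simp del: times_divide_eq_left)
    ultimately have "(\<lambda>n. (damped_moment (\<lambda>x. h x + 1 / real (Suc n) * f x) [] - damped_moment h []) * real (Suc n))
        \<longlonglongrightarrow> damped_moment h [] * - (\<integral>x. f x * cumulant_fun 0 (h x) \<partial>lborel)"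
      using assms by (simp del: of_nat_Suc)
    from LIMSEQ_unique[OF damped_moment_difference_quotient[OF _ assms(2,3) f, of "[]"] this]
    show ?thesis by (simp add: mult.commute)
  qed
  \<comment> \<open>Signed \<open>f\<close> is reached as a difference of two nonnegative functions,
    both sides being linear in \<open>f\<close>.\<close>
  have split: "f = (\<lambda>x. max 0 (f x) - max 0 (- f x))" by (auto simp: fun_eq_iff max_def)
  have pos: "(\<lambda>x. max 0 (f x)) \<in> C_0" "(\<lambda>x. max 0 (- f x)) \<in> C_0"
    using assms by (auto intro!: C_0_max_0 C_0_uminus)
  note int = C_0_integrable_lborel[OF C_0_mult_cumulant_fun[OF _ assms(2,3)]]
  have "damped_moment h [f] = damped_moment h [\<lambda>x. max 0 (f x)] - damped_moment h [\<lambda>x. max 0 (- f x)]"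
    by (subst split, rule damped_moment_diff) (use assms pos in auto)
  also have "\<dots> = (\<integral>x. max 0 (f x) * cumulant_fun 0 (h x) - max 0 (- f x) * cumulant_fun 0 (h x) \<partial>lborel) * damped_moment h []"
    using nonneg[OF pos(1)] nonneg[OF pos(2)] int[OF pos(1)] int[OF pos(2)] by (simp add: left_diff_distrib)
  also have "(\<integral>x. max 0 (f x) * cumulant_fun 0 (h x) - max 0 (- f x) * cumulant_fun 0 (h x) \<partial>lborel)
      = (\<integral>x. f x * cumulant_fun 0 (h x) \<partial>lborel)"
    by (intro Bochner_Integration.integral_cong refl) (auto simp: max_def)
  finally show ?thesis .
qed

lemma C_0_prod_list: "f \<in> C_0 \<Longrightarrow> as \<in> lists C_0 \<Longrightarrow> (\<lambda>x. f x * (\<Prod>a\<leftarrow>as. a x)) \<in> C_0"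
proof (induction as arbitrary: f)
  case (Cons a as)
  then show ?case
    using Cons.IH[of "\<lambda>x. f x * a x"] C_0_mult[of f a] by (simp add: mult.assoc)
qed simp

lemma splits_C_0:
  assumes "fs \<in> lists C_0" "q \<in> set (splits fs)"
  shows "fst q \<in> lists C_0" "snd q \<in> lists C_0"
  using splits_subset[of "fst q" "snd q" fs] assms by auto

text \<open>Induction by differentiating the identity for \<open>fs\<close> in direction
  \<open>g\<close>. The product rule puts \<open>g\<close> either under the integral, raising the
  cumulant order, or into the remaining moment: exactly the two ways in which \<open>splits\<close>
  extends by \<open>g\<close>.\<close>

lemma damped_moment_Cons:
  assumes "fs \<in> lists C_0" "f \<in> C_0" "h \<in> C_0" "\<And>x. h x \<ge> 0"
  shows "damped_moment h (f # fs) = (\<Sum>q\<leftarrow>splits fs.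
     (\<integral>x. f x * (\<Prod>a\<leftarrow>fst q. a x) * cumulant_fun (length (fst q)) (h x) \<partial>lborel) * damped_moment h (snd q))"
  using assms
proof (induction fs arbitrary: f h)
  case Nil
  then show ?case using damped_moment_single by simp
next
  case (Cons g fs)
  have fs: "fs \<in> lists C_0" and g: "g \<in> C_0" using Cons by auto
  let ?I = "\<lambda>f as j h. (\<integral>x. f x * (\<Prod>a\<leftarrow>as. a x) * cumulant_fun j (h x) \<partial>lborel)"
  let ?R = "\<lambda>g. (\<Sum>q\<leftarrow>splits fs. ?I (\<lambda>x. f x * g x) (fst q) (Suc (length (fst q))) h * damped_moment h (snd q)
         + ?I f (fst q) (length (fst q)) h * damped_moment h (g # snd q))"
  have int: "integrable lborel (\<lambda>x. f x * (\<Prod>a\<leftarrow>as. a x) * cumulant_fun j (h x))"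
    if "f \<in> C_0" "as \<in> lists C_0" "h \<in> C_0" "\<And>x. h x \<ge> 0" for f as j h
    using that by (intro C_0_integrable_lborel C_0_mult_cumulant_fun C_0_prod_list)
  have nonneg: "damped_moment h (f # g # fs) = ?R g" if g: "g \<in> C_0" "\<And>x. g x \<ge> 0" for g
  proof -
    let ?h = "\<lambda>n x. h x + 1 / real (Suc n) * g x"
    have hn: "?h n \<in> C_0" "?h n x \<ge> 0" for n x
      using Cons.prems g by (auto intro!: C_0_add C_0_cmult add_nonneg_nonneg simp del: times_divide_eq_left)
    \<comment> \<open>Product rule for a single split; the minus signs of the two derivatives cancel
      later against the one on the left-hand side.\<close>
    have quot: "(\<lambda>n. (?I f (fst q) (length (fst q)) (?h n) * damped_moment (?h n) (snd q)
         - ?I f (fst q) (length (fst q)) h * damped_moment h (snd q)) * real (Suc n))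
       \<longlonglongrightarrow> (- ?I (\<lambda>x. f x * g x) (fst q) (Suc (length (fst q))) h) * damped_moment h (snd q)
          + ?I f (fst q) (length (fst q)) h * (- damped_moment h (g # snd q))" if q: "q \<in> set (splits fs)" for q
    proof (rule LIMSEQ_difference_quotient_mult)
      note q' = splits_C_0[OF fs q]
      let ?F = "\<lambda>x. f x * (\<Prod>a\<leftarrow>fst q. a x)"
      have F: "?F \<in> C_0" by (rule C_0_prod_list[OF Cons.prems(1) q'(1)])
      obtain B where B: "\<And>x. \<bar>?F x\<bar> \<le> B" using C_0_bounded[OF F] by blast
      obtain L where L: "\<And>y. y \<ge> 0 \<Longrightarrow> \<bar>cumulant_fun (Suc (length (fst q))) y\<bar> \<le> L"
        using cumulant_fun_bounded by blast
      have "(\<lambda>n. (?I f (fst q) (length (fst q)) (?h n) - ?I f (fst q) (length (fst q)) h) * real (Suc n))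
         \<longlonglongrightarrow> (\<integral>x. ?F x * (g x * - cumulant_fun (Suc (length (fst q))) (h x)) \<partial>lborel)"
        by (rule LIMSEQ_difference_quotient_integral[where L = L and B = B])
          (use L B F C_0_borel_measurable[OF F] cumulant_fun_derivative Cons.prems g in
            \<open>auto intro!: C_0_integrable_lborel C_0_mult_cumulant_fun\<close>)
      also have "(\<integral>x. ?F x * (g x * - cumulant_fun (Suc (length (fst q))) (h x)) \<partial>lborel)
          = - ?I (\<lambda>x. f x * g x) (fst q) (Suc (length (fst q))) h"
        unfolding Bochner_Integration.integral_minus[symmetric]
        by (intro Bochner_Integration.integral_cong refl) (simp add: mult_ac)
      finally show "(\<lambda>n. (?I f (fst q) (length (fst q)) (?h n) - ?I f (fst q) (length (fst q)) h) * real (Suc n))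
         \<longlonglongrightarrow> - ?I (\<lambda>x. f x * g x) (fst q) (Suc (length (fst q))) h" .
      show "(\<lambda>n. (damped_moment (?h n) (snd q) - damped_moment h (snd q)) * real (Suc n)) \<longlonglongrightarrow> - damped_moment h (g # snd q)"
        by (rule damped_moment_difference_quotient[OF q'(2) Cons.prems(2,3) g])
    qed
    have lim1: "(\<lambda>n. (damped_moment (?h n) (f # fs) - damped_moment h (f # fs)) * real (Suc n)) \<longlonglongrightarrow>
       (\<Sum>q\<leftarrow>splits fs. (- ?I (\<lambda>x. f x * g x) (fst q) (Suc (length (fst q))) h) * damped_moment h (snd q)
          + ?I f (fst q) (length (fst q)) h * (- damped_moment h (g # snd q)))"
      unfolding Cons.IH[OF Cons.prems(1) hn] Cons.IH[OF Cons.prems]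
      by (rule LIMSEQ_difference_quotient_sum_list) (rule quot)
    have eq: "(\<Sum>q\<leftarrow>splits fs. (- ?I (\<lambda>x. f x * g x) (fst q) (Suc (length (fst q))) h) * damped_moment h (snd q)
          + ?I f (fst q) (length (fst q)) h * (- damped_moment h (g # snd q))) = - ?R g"
      by (simp add: uminus_sum_list_map o_def)
    have lim2: "(\<lambda>n. (damped_moment (?h n) (f # fs) - damped_moment h (f # fs)) * real (Suc n)) \<longlonglongrightarrow> - damped_moment h (g # f # fs)"
      using fs Cons.prems g by (intro damped_moment_difference_quotient) auto
    have "- ?R g = - damped_moment h (g # f # fs)"
      using LIMSEQ_unique[OF lim1 lim2] unfolding eq .
    then show ?thesis by (simp add: damped_moment_swap)
  qed
  \<comment> \<open>Derivatives were available only for \<open>g >= 0\<close>; a general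
    \<open>g\<close> is treated through its positive and negative parts.\<close>
  define u v where "u = (\<lambda>x. max 0 (g x))" and "v = (\<lambda>x. max 0 (- g x))"
  have uv: "u \<in> C_0" "v \<in> C_0" "\<And>x. u x \<ge> 0" "\<And>x. v x \<ge> 0"
    using g by (auto intro!: C_0_max_0 C_0_uminus simp: u_def v_def)
  have g_uv: "g = (\<lambda>x. u x - v x)" by (auto simp: fun_eq_iff max_def u_def v_def)
  have M: "damped_moment h (g # gs) = damped_moment h (u # gs) - damped_moment h (v # gs)" if "gs \<in> lists C_0" for gs
    unfolding g_uv by (rule damped_moment_diff[OF that Cons.prems(2,3) uv(1,2)])
  have "damped_moment h (f # g # fs) = ?R u - ?R v"
    using M[of "f # fs"] fs Cons.prems nonneg[OF uv(1,3)] nonneg[OF uv(2,4)] by (simp add: damped_moment_swap[of h f])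
  also have "\<dots> = ?R g"
    unfolding sum_list_subtractf[symmetric]
  proof (intro arg_cong[where f = sum_list] map_cong refl)
    fix q assume q: "q \<in> set (splits fs)"
    note q' = splits_C_0[OF fs q]
    have I_diff: "?I (\<lambda>x. f x * g x) (fst q) j h = ?I (\<lambda>x. f x * u x) (fst q) j h - ?I (\<lambda>x. f x * v x) (fst q) j h" for j
    proof -
      have "?I (\<lambda>x. f x * g x) (fst q) j h = (\<integral>x. f x * u x * (\<Prod>a\<leftarrow>fst q. a x) * cumulant_fun j (h x)
          - f x * v x * (\<Prod>a\<leftarrow>fst q. a x) * cumulant_fun j (h x) \<partial>lborel)"
        by (intro Bochner_Integration.integral_cong refl) (simp add: g_uv algebra_simps)
      also have "\<dots> = ?I (\<lambda>x. f x * u x) (fst q) j h - ?I (\<lambda>x. f x * v x) (fst q) j h"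
        by (intro Bochner_Integration.integral_diff int C_0_mult Cons.prems uv q')
      finally show ?thesis .
    qed
    show "?I (\<lambda>x. f x * u x) (fst q) (Suc (length (fst q))) h * damped_moment h (snd q)
         + ?I f (fst q) (length (fst q)) h * damped_moment h (u # snd q)
         - (?I (\<lambda>x. f x * v x) (fst q) (Suc (length (fst q))) h * damped_moment h (snd q)
         + ?I f (fst q) (length (fst q)) h * damped_moment h (v # snd q))
       = ?I (\<lambda>x. f x * g x) (fst q) (Suc (length (fst q))) h * damped_moment h (snd q)
         + ?I f (fst q) (length (fst q)) h * damped_moment h (g # snd q)"
      unfolding I_diff M[OF q'(2)] left_diff_distrib right_diff_distrib by simp
  qed
  finally show ?case
    by (simp add: case_prod_unfold o_def sum_list_addf mult.assoc)
qed

text \<open>At damping 0 the recursion for the moments is the one for \<tau>. The induction is on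
  the length, since the second component of a split of the tail is shorter than the whole
  list.\<close>

lemma moments_eq_tau:
  assumes kappa: "\<kappa> > 0" "\<eta> + 1 / \<kappa>\<^sup>2 > 0" and fs: "fs \<in> lists test_functions"
  shows "integrable P (\<lambda>\<omega>. \<Prod>f\<leftarrow>fs. X f \<omega>) \<and> tau (rho_prod \<eta> \<kappa> fs) = (\<integral>\<omega>. (\<Prod>f\<leftarrow>fs. X f \<omega>) \<partial>P)"
proof
  have C: "fs \<in> lists C_0" if "fs \<in> lists test_functions" for fs :: "('a \<Rightarrow> real) list"
    using that test_functions_subset_C_0 by auto
  show "integrable P (\<lambda>\<omega>. \<Prod>f\<leftarrow>fs. X f \<omega>)"
    by (rule integrable_prod_X[OF C[OF fs]])
  have X_0: "X (\<lambda>_. 0) \<omega> = 0" if "\<omega> \<in> space P" for \<omega>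
    using X_cmult[OF C_0_zero that, of 0] by simp
  have "tau (rho_prod \<eta> \<kappa> fs) = damped_moment (\<lambda>_. 0) fs"
    using fs
  proof (induction "length fs" arbitrary: fs rule: less_induct)
    case less
    show ?case
    proof (cases fs)
      case Nil
      then show ?thesis
        using prob_space by (simp add: tau_def rho_prod_Nil vacuum_fock_fin vacuum_def damped_moment_def X_0
            cong: Bochner_Integration.integral_cong)
    next
      case (Cons f gs)
      then have f: "f \<in> test_functions" and gs: "gs \<in> lists test_functions" using less.prems by auto
      have IH: "tau (rho_prod \<eta> \<kappa> (snd q)) = damped_moment (\<lambda>_. 0) (snd q)" if "q \<in> set (splits gs)" for q
        using splits_subset[of "fst q" "snd q" gs] splits_length[of "fst q" "snd q" gs] that gs
        by (intro less.hyps) (auto simp: Cons)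
      have "tau (rho_prod \<eta> \<kappa> fs) = (\<Sum>q\<leftarrow>splits gs. poly (cumulant_poly \<eta> \<kappa> (length (fst q))) 1 *
          (\<integral>x. f x * (\<Prod>a\<leftarrow>fst q. a x) \<partial>lborel) * damped_moment (\<lambda>_. 0) (snd q))"
        unfolding Cons tau_rho_prod_Cons[OF kappa refl f gs] case_prod_unfold
        by (intro arg_cong[where f = sum_list] map_cong refl) (simp add: IH)
      also have "\<dots> = damped_moment (\<lambda>_. 0) (f # gs)"
        using damped_moment_Cons[OF C[OF gs] test_functions_subset_C_0[OF f] C_0_zero]
        by (simp add: cumulant_fun_def tilt_0 p mult.commute[of _ "poly _ _"])
      finally show ?thesis by (simp add: Cons)
    qed
  qed
  also have "\<dots> = (\<integral>\<omega>. (\<Prod>f\<leftarrow>fs. X f \<omega>) \<partial>P)"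
    unfolding damped_moment_def by (intro Bochner_Integration.integral_cong refl) (simp add: X_0)
  finally show "tau (rho_prod \<eta> \<kappa> fs) = (\<integral>\<omega>. (\<Prod>f\<leftarrow>fs. X f \<omega>) \<partial>P)" .
qed

end

subsection \<open>Laplace transforms, distributions and independence\<close>

text \<open>For values in the unit interval the exponential series is dominated by that of |t|, so
  it may be integrated termwise; hence the moments determine the characteristic function.\<close>

lemma (in prob_space) char_eq_moment_series:
  fixes U :: "'a \<Rightarrow> real"
  assumes [measurable]: "U \<in> borel_measurable M" and U: "\<And>\<omega>. \<omega> \<in> space M \<Longrightarrow> 0 \<le> U \<omega> \<and> U \<omega> \<le> 1"
  shows "(\<lambda>n. (\<i> * of_real t) ^ n /\<^sub>R fact n * of_real (expectation (\<lambda>\<omega>. U \<omega> ^ n))) sums char (distr M borel U) t"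
proof -
  let ?f = "\<lambda>n \<omega>. (\<i> * of_real t) ^ n /\<^sub>R fact n * complex_of_real (U \<omega> ^ n)"
  have bound: "norm (?f n \<omega>) \<le> \<bar>t\<bar> ^ n /\<^sub>R fact n" if "\<omega> \<in> space M" for n \<omega>
  proof -
    have "\<bar>U \<omega>\<bar> ^ n \<le> 1" using U[OF that] by (intro power_le_one) auto
    then have "\<bar>t\<bar> ^ n / fact n * \<bar>U \<omega>\<bar> ^ n \<le> \<bar>t\<bar> ^ n / fact n * 1"
      by (intro mult_left_mono) auto
    then show ?thesis by (simp add: norm_mult norm_power field_simps)
  qed
  have U_int: "integrable M (\<lambda>\<omega>. U \<omega> ^ n)" for n
    by (rule integrable_const_bound[of _ 1]) (use U in \<open>auto intro!: power_le_one AE_I2 simp: power_abs\<close>)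
  have int: "integrable M (?f n)" for n
    using U_int[of n] by (intro integrable_mult_right integrable_of_real)
  have summ: "summable (\<lambda>n. \<bar>t\<bar> ^ n /\<^sub>R fact n)"
    using summable_exp_generic[of "\<bar>t\<bar>"] by simp
  have s: "(\<lambda>n. integral\<^sup>L M (?f n)) sums (\<integral>\<omega>. (\<Sum>n. ?f n \<omega>) \<partial>M)"
  proof (rule sums_integral[OF int])
    show "AE \<omega> in M. summable (\<lambda>n. norm (?f n \<omega>))"
      using bound by (intro AE_I2 summable_comparison_test'[OF summ]) auto
    show "summable (\<lambda>n. \<integral>\<omega>. norm (?f n \<omega>) \<partial>M)"
    proof (rule summable_comparison_test'[OF summ])
      fix n
      have "(\<integral>\<omega>. norm (?f n \<omega>) \<partial>M) \<le> (\<integral>\<omega>. \<bar>t\<bar> ^ n /\<^sub>R fact n \<partial>M)"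
        by (rule integral_mono[OF integrable_norm[OF int]]) (use bound in auto)
      then show "norm (\<integral>\<omega>. norm (?f n \<omega>) \<partial>M) \<le> \<bar>t\<bar> ^ n /\<^sub>R fact n"
        by (simp add: prob_space)
    qed
  qed
  have e: "(\<Sum>n. ?f n \<omega>) = exp (\<i> * of_real (t * U \<omega>))" for \<omega>
  proof -
    have "?f n \<omega> = (\<i> * of_real (t * U \<omega>)) ^ n /\<^sub>R fact n" for n
      by (simp add: power_mult_distrib)
    then show ?thesis using exp_converges[of "\<i> * of_real (t * U \<omega>)"] by (simp add: sums_iff)
  qed
  have c: "char (distr M borel U) t = (\<integral>\<omega>. exp (\<i> * of_real (t * U \<omega>)) \<partial>M)"
    unfolding char_def by (subst integral_distr) auto
  have i: "integral\<^sup>L M (?f n) = (\<i> * of_real t) ^ n /\<^sub>R fact n * of_real (expectation (\<lambda>\<omega>. U \<omega> ^ n))" for n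
    by (simp only: integral_mult_right_zero integral_complex_of_real)
  show ?thesis using s unfolding e i c .
qed

text \<open>The Laplace transform at the integers lists the moments of \<open>exp (- X)\<close>,
  which takes values in the unit interval. Moments determine its characteristic function, hence its
  law, and \<open>- ln\<close> recovers that of \<open>X\<close>.\<close>

lemma laplace_transform_unique:
  fixes X :: "'a \<Rightarrow> real" and Y :: "'b \<Rightarrow> real"
  assumes P: "prob_space P" and Q: "prob_space Q"
    and X [measurable]: "X \<in> borel_measurable P" and Y [measurable]: "Y \<in> borel_measurable Q"
    and X_nonneg: "\<And>\<omega>. \<omega> \<in> space P \<Longrightarrow> X \<omega> \<ge> 0" and Y_nonneg: "\<And>\<omega>. \<omega> \<in> space Q \<Longrightarrow> Y \<omega> \<ge> 0"
    and eq: "\<And>n::nat. (\<integral>\<omega>. exp (- real n * X \<omega>) \<partial>P) = (\<integral>\<omega>. exp (- real n * Y \<omega>) \<partial>Q)"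
  shows "distr P borel X = distr Q borel Y"
proof -
  interpret P: prob_space P by (rule P)
  interpret Q: prob_space Q by (rule Q)
  have "char (distr P borel (\<lambda>\<omega>. exp (- X \<omega>))) t = char (distr Q borel (\<lambda>\<omega>. exp (- Y \<omega>))) t" for t
  proof -
    have "(\<integral>\<omega>. exp (- X \<omega>) ^ n \<partial>P) = (\<integral>\<omega>. exp (- Y \<omega>) ^ n \<partial>Q)" for n
      using eq[of n] by (simp add: exp_of_nat_mult[symmetric])
    then show ?thesis
      using P.char_eq_moment_series[of "\<lambda>\<omega>. exp (- X \<omega>)" t] Q.char_eq_moment_series[of "\<lambda>\<omega>. exp (- Y \<omega>)" t]
        X_nonneg Y_nonneg by (auto intro: sums_unique2)
  qed
  then have "distr P borel (\<lambda>\<omega>. exp (- X \<omega>)) = distr Q borel (\<lambda>\<omega>. exp (- Y \<omega>))"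
    by (intro Levy_uniqueness P.real_distribution_distr Q.real_distribution_distr) auto
  then have "distr (distr P borel (\<lambda>\<omega>. exp (- X \<omega>))) borel (\<lambda>u. - ln u)
      = distr (distr Q borel (\<lambda>\<omega>. exp (- Y \<omega>))) borel (\<lambda>u. - ln u)" by simp
  then show ?thesis
    by (simp add: distr_distr o_def)
qed

text \<open>Reweighting the measure by \<open>G / c\<close> leaves the Laplace transform of
  \<open>X\<close> unchanged, so the law of \<open>X\<close> is unchanged too. If
  \<open>c = 0\<close>, the weight vanishes almost everywhere.\<close>

lemma (in prob_space) laplace_transform_weighted:
  fixes X G :: "'a \<Rightarrow> real"
  assumes [measurable]: "X \<in> borel_measurable M" "G \<in> borel_measurable M"
    and X: "\<And>\<omega>. \<omega> \<in> space M \<Longrightarrow> X \<omega> \<ge> 0" and G: "\<And>\<omega>. 0 \<le> G \<omega> \<and> G \<omega> \<le> 1"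
    and eq: "\<And>n::nat. expectation (\<lambda>\<omega>. exp (- real n * X \<omega>) * G \<omega>) = expectation (\<lambda>\<omega>. exp (- real n * X \<omega>)) * c"
    and B [measurable]: "B \<in> sets borel"
  shows "expectation (\<lambda>\<omega>. indicator B (X \<omega>) * G \<omega>) = expectation (\<lambda>\<omega>. indicator B (X \<omega>)) * c"
proof -
  have int_G: "integrable M G"
    by (rule integrable_const_bound[of _ 1]) (use G in auto)
  have c: "expectation G = c" using eq[of 0] by (simp add: prob_space)
  then have "c \<ge> 0" using G by (metis integral_nonneg_AE AE_I2)
  show ?thesis
  proof (cases "c = 0")
    case True
    have "AE \<omega> in M. G \<omega> = 0"
      using integral_nonneg_eq_0_iff_AE[OF int_G] c True G by simp
    then have "expectation (\<lambda>\<omega>. indicator B (X \<omega>) * G \<omega>) = expectation (\<lambda>\<omega>. 0)"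
      by (intro integral_cong_AE) auto
    with True show ?thesis by simp
  next
    case False
    with \<open>c \<ge> 0\<close> have cpos: "c > 0" by simp
    define Q where "Q = density M (\<lambda>\<omega>. ennreal (G \<omega> / c))"
    have "emeasure Q (space Q) = (\<integral>\<^sup>+\<omega>. ennreal (G \<omega> / c) \<partial>M)"
      by (simp add: Q_def emeasure_density cong: nn_integral_cong)
    also have "\<dots> = ennreal (expectation (\<lambda>\<omega>. G \<omega> / c))"
      using int_G G cpos by (intro nn_integral_eq_integral) auto
    also have "\<dots> = 1" using c cpos by simp
    finally interpret Q: prob_space Q by (rule prob_spaceI)
    have Q: "(\<integral>\<omega>. f \<omega> \<partial>Q) = expectation (\<lambda>\<omega>. f \<omega> * G \<omega>) / c" if "f \<in> borel_measurable M" for f :: "'a \<Rightarrow> real"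
      using that G cpos unfolding Q_def by (subst integral_density) (auto simp: mult.commute)
    have sets_Q [simp]: "sets Q = sets M" "space Q = space M" by (simp_all add: Q_def)
    have "distr Q borel X = distr M borel X"
    proof (rule laplace_transform_unique)
      show "X \<in> borel_measurable Q" using sets_Q by (simp cong: measurable_cong_sets)
      show "(\<integral>\<omega>. exp (- real n * X \<omega>) \<partial>Q) = (\<integral>\<omega>. exp (- real n * X \<omega>) \<partial>M)" for n
        using eq[of n] cpos by (subst Q) auto
    qed (use X Q.prob_space_axioms prob_space_axioms in auto)
    moreover have "(\<integral>\<omega>. indicator B (X \<omega>) \<partial>Q) = (\<integral>x. (indicator B x :: real) \<partial>distr Q borel X)"
      by (rule integral_distr[symmetric]) (use sets_Q in \<open>simp_all cong: measurable_cong_sets\<close>)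
    moreover have "expectation (\<lambda>\<omega>. indicator B (X \<omega>)) = (\<integral>x. (indicator B x :: real) \<partial>distr M borel X)"
      by (rule integral_distr[symmetric]) simp_all
    ultimately have "(\<integral>\<omega>. indicator B (X \<omega>) \<partial>Q) = expectation (\<lambda>\<omega>. indicator B (X \<omega>) :: real)"
      by (simp only:)
    then show ?thesis
      using Q[of "\<lambda>\<omega>. indicator B (X \<omega>)"] cpos by (simp add: field_simps)
  qed
qed

text \<open>The exponential factors are exchanged for indicators one coordinate at a time, with the
  product of all other factors as the weight.\<close>

lemma (in prob_space) indep_vars_of_laplace_transform:
  fixes X :: "nat \<Rightarrow> 'a \<Rightarrow> real"
  assumes X_meas: "\<And>i. i < n \<Longrightarrow> X i \<in> borel_measurable M"
    and X: "\<And>i \<omega>. i < n \<Longrightarrow> \<omega> \<in> space M \<Longrightarrow> X i \<omega> \<ge> 0"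
    and eq: "\<And>t::nat \<Rightarrow> nat. expectation (\<lambda>\<omega>. \<Prod>i<n. exp (- real (t i) * X i \<omega>)) = (\<Prod>i<n. expectation (\<lambda>\<omega>. exp (- real (t i) * X i \<omega>)))"
  shows "indep_vars (\<lambda>_. borel) X {..<n}"
proof -
  \<comment> \<open>Coordinates below \<open>m\<close> are already indicators. The clamp
    \<open>max 0\<close> keeps the exponential factors at most 1 even outside
    \<open>space M\<close>, as the weight must be bounded everywhere.\<close>
  define Z where "Z m B t i \<omega> = (if i < m then indicator (B i) (X i \<omega>) else exp (- real (t i) * max 0 (X i \<omega>)))"
    for m and B :: "nat \<Rightarrow> real set" and t :: "nat \<Rightarrow> nat" and i \<omega>
  have Z_01: "0 \<le> Z m B t i \<omega> \<and> Z m B t i \<omega> \<le> 1" for m B t i \<omega>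
    by (auto simp: Z_def indicator_def)
  have Z_meas: "Z m B t i \<in> borel_measurable M" if "i < n" "\<And>i. B i \<in> sets borel" for m B t i
    using X_meas[OF that(1)] that(2)[of i] unfolding Z_def[abs_def] by (cases "i < m") simp_all
  have "expectation (\<lambda>\<omega>. \<Prod>i<n. Z m B t i \<omega>) = (\<Prod>i<n. expectation (Z m B t i))"
    if "m \<le> n" "\<And>i. B i \<in> sets borel" for m B t
    using that(1)
  proof (induction m arbitrary: t)
    case 0
    have "expectation (\<lambda>\<omega>. \<Prod>i<n. Z 0 B t i \<omega>) = expectation (\<lambda>\<omega>. \<Prod>i<n. exp (- real (t i) * X i \<omega>))"
      using X by (intro Bochner_Integration.integral_cong prod.cong refl) (simp add: Z_def max_def)
    also have "\<dots> = (\<Prod>i<n. expectation (Z 0 B t i))"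
      unfolding eq using X by (intro Bochner_Integration.integral_cong prod.cong refl) (simp add: Z_def max_def)
    finally show ?case .
  next
    case (Suc m)
    then have m: "m < n" by simp
    define G where "G \<omega> = (\<Prod>i\<in>{..<n} - {m}. Z m B t i \<omega>)" for \<omega>
    define c where "c = (\<Prod>i\<in>{..<n} - {m}. expectation (Z m B t i))"
    have other: "Z m' B t' i = Z m B t i" if "i \<noteq> m" "m' = m \<or> m' = Suc m" "\<And>i. i \<noteq> m \<Longrightarrow> t' i = t i" for i m' t'
      using that by (auto simp: Z_def fun_eq_iff)
    have split: "(\<Prod>i<n. Z m' B t' i \<omega>) = Z m' B t' m \<omega> * G \<omega>" "(\<Prod>i<n. expectation (Z m' B t' i)) = expectation (Z m' B t' m) * c"
      if "m' = m \<or> m' = Suc m" "\<And>i. i \<noteq> m \<Longrightarrow> t' i = t i" for m' t' \<omega>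
    proof -
      have o: "Z m' B t' i = Z m B t i" if "i \<in> {..<n} - {m}" for i
        by (rule other) (use that \<open>m' = m \<or> m' = Suc m\<close> \<open>\<And>i. i \<noteq> m \<Longrightarrow> t' i = t i\<close> in auto)
      have *: "(\<Prod>i<n. h i) = h m * (\<Prod>i\<in>{..<n} - {m}. h i)" for h :: "nat \<Rightarrow> real"
        by (subst prod.remove[of _ m]) (use m in auto)
      show "(\<Prod>i<n. Z m' B t' i \<omega>) = Z m' B t' m \<omega> * G \<omega>" "(\<Prod>i<n. expectation (Z m' B t' i)) = expectation (Z m' B t' m) * c"
        unfolding * G_def c_def 
        by (intro arg_cong2[where f = "(*)"] prod.cong refl; simp only: o)+
    qed
    \<comment> \<open>The hypothesis of the weighted lemma for all \<open>k\<close> is the induction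
      hypothesis with \<open>t(m := k)\<close>, which is why \<open>t\<close> is arbitrary in the
      induction.\<close>
    have "expectation (\<lambda>\<omega>. indicator (B m) (X m \<omega>) * G \<omega>) = expectation (\<lambda>\<omega>. indicator (B m) (X m \<omega>)) * c"
    proof (rule laplace_transform_weighted[OF X_meas[OF m] _ X[OF m]])
      show "G \<in> borel_measurable M"
        unfolding G_def[abs_def] by (intro borel_measurable_prod Z_meas that(2)) auto
      show "0 \<le> G \<omega> \<and> G \<omega> \<le> 1" for \<omega>
        unfolding G_def using Z_01 by (auto intro!: prod_nonneg prod_le_1)
      fix k :: nat
      have s: "Z m B (t(m := k)) m \<omega> = exp (- real k * X m \<omega>)" if "\<omega> \<in> space M" for \<omega>
        using X[OF m that] by (simp add: Z_def max_def)
      have "expectation (\<lambda>\<omega>. exp (- real k * X m \<omega>) * G \<omega>) = expectation (\<lambda>\<omega>. \<Prod>i<n. Z m B (t(m := k)) i \<omega>)"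
        using split(1)[of m "t(m := k)"] by (intro Bochner_Integration.integral_cong refl) (simp add: s)
      also have "\<dots> = expectation (Z m B (t(m := k)) m) * c"
        using Suc split(2)[of m "t(m := k)"] by simp
      also have "expectation (Z m B (t(m := k)) m) = expectation (\<lambda>\<omega>. exp (- real k * X m \<omega>))"
        by (intro Bochner_Integration.integral_cong refl) (simp add: s)
      finally show "expectation (\<lambda>\<omega>. exp (- real k * X m \<omega>) * G \<omega>) = expectation (\<lambda>\<omega>. exp (- real k * X m \<omega>)) * c" .
    qed (use that in auto)
    moreover have "Z (Suc m) B t m = (\<lambda>\<omega>. indicator (B m) (X m \<omega>))"
      by (simp add: Z_def fun_eq_iff)
    moreover have "(\<Prod>i<n. Z (Suc m) B t i \<omega>) = Z (Suc m) B t m \<omega> * G \<omega>" for \<omega>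
      by (rule split(1)) auto
    moreover have "(\<Prod>i<n. expectation (Z (Suc m) B t i)) = expectation (Z (Suc m) B t m) * c"
      by (rule split(2)) auto
    ultimately show ?case by (simp only:)
  qed
  note Z = this
  show ?thesis
  proof (cases "n = 0")
    case True
    then show ?thesis by (simp add: indep_vars_def indep_sets_def)
  next
    case False
    have "prob (\<Inter>j\<in>{..<n}. X j -` B j \<inter> space M) = (\<Prod>j<n. prob (X j -` B j \<inter> space M))"
      if B: "B \<in> {..<n} \<rightarrow> sets borel" for B
    proof -
      define B' where "B' i = (if i < n then B i else {})" for i
      have B': "B' i \<in> sets borel" for i using B by (auto simp: B'_def)
      have [measurable]: "X j -` B j \<inter> space M \<in> sets M" if "j < n" for j
        using X_meas[OF that] B that by (auto intro: measurable_sets)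
      have "prob (\<Inter>j\<in>{..<n}. X j -` B j \<inter> space M) = expectation (indicator (\<Inter>j\<in>{..<n}. X j -` B j \<inter> space M))"
        using False by (auto intro!: arg_cong[where f = prob])
      also have "\<dots> = expectation (\<lambda>\<omega>. \<Prod>i<n. Z n B' (\<lambda>_. 0) i \<omega>)"
      proof (intro Bochner_Integration.integral_cong refl)
        fix \<omega> assume w: "\<omega> \<in> space M"
        have "(\<Prod>i<n. Z n B' (\<lambda>_. 0) i \<omega>) = (\<Prod>i<n. indicator (B i) (X i \<omega>))"
          by (intro prod.cong) (auto simp: Z_def B'_def)
        also have "\<dots> = indicator (\<Inter>j\<in>{..<n}. X j -` B j \<inter> space M) \<omega>"
        proof (cases "\<forall>i<n. X i \<omega> \<in> B i")
          case True
          then have "(\<Prod>i<n. indicator (B i) (X i \<omega>)) = (\<Prod>i<n. 1 :: real)"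
            by (intro prod.cong) auto
          with True w show ?thesis by (simp add: indicator_def)
        next
          case False
          then obtain i where i: "i < n" "X i \<omega> \<notin> B i" by blast
          then have "(\<Prod>i<n. indicator (B i) (X i \<omega>)) = (0 :: real)"
            by (intro prod_zero) (auto intro!: bexI[of _ i])
          with i show ?thesis by (auto simp: indicator_def)
        qed
        finally show "indicator (\<Inter>j\<in>{..<n}. X j -` B j \<inter> space M) \<omega> = (\<Prod>i<n. Z n B' (\<lambda>_. 0) i \<omega>)" ..
      qed
      also have "\<dots> = (\<Prod>i<n. expectation (Z n B' (\<lambda>_. 0) i))"
        by (rule Z[OF order_refl B'])
      also have "\<dots> = (\<Prod>j<n. prob (X j -` B j \<inter> space M))"
      proof (intro prod.cong refl)
        fix i assume i: "i \<in> {..<n}"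
        have "expectation (Z n B' (\<lambda>_. 0) i) = expectation (indicator (X i -` B i \<inter> space M))"
          using i by (intro Bochner_Integration.integral_cong refl) (auto simp: Z_def B'_def indicator_def)
        also have "\<dots> = prob (X i -` B i \<inter> space M)"
          by (auto intro!: arg_cong[where f = prob])
        finally show "expectation (Z n B' (\<lambda>_. 0) i) = prob (X i -` B i \<inter> space M)" .
      qed
      finally show ?thesis .
    qed
    moreover have "indep_vars (\<lambda>_. borel) X {..<n} \<longleftrightarrow> (\<forall>A\<in>{..<n} \<rightarrow> sets borel.
        prob (\<Inter>j\<in>{..<n}. X j -` A j \<inter> space M) = (\<Prod>j<n. prob (X j -` A j \<inter> space M)))"
    proof (rule indep_vars_finite)
      show "sets borel = sigma_sets (space borel) (sets (borel :: real measure))"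
        by (simp only: sets.sigma_sets_eq)
      show "Int_stable (sets (borel :: real measure))"
        by (auto simp: Int_stable_def)
    qed (use False X_meas in auto)
    ultimately show ?thesis by blast
  qed
qed

subsection \<open>Construction of compound Poisson processes\<close>

text \<open>Only finitely many coordinates enter, so the integral lives on the finite-dimensional
  marginal, where Fubini factorises it.\<close>

lemma nn_integral_prod_PiM_UNIV:
  assumes M: "\<And>i. prob_space (M i)" and J: "finite J"
    and f: "\<And>i. i \<in> J \<Longrightarrow> f i \<in> borel_measurable (M i)"
  shows "(\<integral>\<^sup>+\<omega>. (\<Prod>i\<in>J. f i (\<omega> i)) \<partial>PiM UNIV M) = (\<Prod>i\<in>J. integral\<^sup>N (M i) (f i))"
proof -
  interpret product_prob_space M UNIV
    by (intro product_prob_spaceI M)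
  have "(\<lambda>x. f i (x i)) \<in> borel_measurable (PiM J M)" if "i \<in> J" for i
    using measurable_compose[OF measurable_component_singleton[OF that, of M] f[OF that]] .
  then have [measurable]: "(\<lambda>x. \<Prod>i\<in>J. f i (x i)) \<in> borel_measurable (PiM J M)"
    by (rule borel_measurable_prod_ennreal)
  have "(\<Prod>i\<in>J. integral\<^sup>N (M i) (f i)) = (\<integral>\<^sup>+x. (\<Prod>i\<in>J. f i (x i)) \<partial>PiM J M)"
    by (rule product_nn_integral_prod[symmetric]) (use J f in auto)
  also have "\<dots> = (\<integral>\<^sup>+x. (\<Prod>i\<in>J. f i (x i)) \<partial>distr (PiM UNIV M) (PiM J M) (\<lambda>x. restrict x J))"
    using distr_PiM_restrict_finite[OF J] by simp
  also have "\<dots> = (\<integral>\<^sup>+\<omega>. (\<Prod>i\<in>J. f i (restrict \<omega> J i)) \<partial>PiM UNIV M)"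
    by (rule nn_integral_distr) (auto intro: measurable_restrict_subset)
  also have "\<dots> = (\<integral>\<^sup>+\<omega>. (\<Prod>i\<in>J. f i (\<omega> i)) \<partial>PiM UNIV M)"
    by (intro nn_integral_cong prod.cong) auto
  finally show ?thesis ..
qed

lemma poisson_generating_function:
  assumes "r > 0" "a \<ge> 0"
  shows "(\<integral>\<^sup>+k. ennreal a ^ k \<partial>measure_pmf (poisson_pmf r)) = ennreal (exp (r * (a - 1)))"
proof -
  have s: "(\<lambda>k. r ^ k / fact k * exp (- r) * a ^ k) sums (exp (r * a) * exp (- r))"
    using sums_mult2[OF exp_converges[of "r * a"], of "exp (- r)"]
    by (simp add: power_mult_distrib field_simps)
  have "(\<integral>\<^sup>+k. ennreal a ^ k \<partial>measure_pmf (poisson_pmf r)) = (\<Sum>k. ennreal (r ^ k / fact k * exp (- r) * a ^ k))"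
    using assms by (simp add: nn_integral_measure_pmf nn_integral_count_space_nat ennreal_power ennreal_mult''[symmetric])
  also have "\<dots> = ennreal (\<Sum>k. r ^ k / fact k * exp (- r) * a ^ k)"
    using s assms by (intro suminf_ennreal2) (auto simp: sums_iff)
  also have "(\<Sum>k. r ^ k / fact k * exp (- r) * a ^ k) = exp (r * (a - 1))"
    using s by (simp add: sums_iff exp_add[symmetric] algebra_simps)
  finally show ?thesis .
qed

text \<open>Annuli around the origin partition the space into countably many bounded pieces of
  positive finite volume, in each of which a uniform law exists.\<close>

definition shell :: "nat \<Rightarrow> 'a::euclidean_space set" where
  "shell n = ball 0 (real (Suc n)) - ball 0 (real n)"

lemma shell_sets [measurable]: "shell n \<in> sets borel"
  by (auto simp: shell_def)

lemma mem_shell: "x \<in> shell n \<longleftrightarrow> nat \<lfloor>norm x\<rfloor> = n"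
proof -
  have "x \<in> shell n \<longleftrightarrow> real n \<le> norm x \<and> norm x < real (Suc n)"
    by (auto simp: shell_def)
  also have "\<dots> \<longleftrightarrow> \<lfloor>norm x\<rfloor> = int n"
    by (simp add: floor_eq_iff add.commute)
  also have "\<dots> \<longleftrightarrow> nat \<lfloor>norm x\<rfloor> = n"
    using norm_ge_zero[of x] zero_le_floor[of "norm x"] by linarith
  finally show ?thesis .
qed

lemma shell_finite: "emeasure lborel (shell n :: 'a::euclidean_space set) < \<infinity>"
  by (rule emeasure_bounded_finite) (auto simp: shell_def intro: bounded_subset[OF bounded_ball])

lemma shell_pos: "emeasure lborel (shell n :: 'a::euclidean_space set) \<noteq> 0"
proof
  assume *: "emeasure lborel (shell n :: 'a set) = 0"
  obtain b :: 'a where b: "b \<in> Basis" using nonempty_Basis by blast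
  \<comment> \<open>A ball of radius 1/2 centred halfway between the two bounding spheres witnesses
    positive volume.\<close>
  let ?B = "ball ((real n + 1/2) *\<^sub>R b) (1/2)"
  have "?B \<subseteq> shell n"
  proof
    fix x assume "x \<in> ?B"
    then have d: "norm ((real n + 1/2) *\<^sub>R b - x) < 1/2" by (simp add: dist_norm)
    have nb: "norm ((real n + 1/2) *\<^sub>R b) = real n + 1/2" using b by simp
    have "norm x \<le> norm ((real n + 1/2) *\<^sub>R b) + norm ((real n + 1/2) *\<^sub>R b - x)"
      by (metis norm_minus_commute norm_triangle_sub)
    moreover have "norm ((real n + 1/2) *\<^sub>R b) \<le> norm x + norm ((real n + 1/2) *\<^sub>R b - x)"
      by (rule norm_triangle_sub)
    ultimately show "x \<in> shell n"
      using d nb by (auto simp: shell_def)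
  qed
  then have "emeasure lborel ?B \<le> 0"
    using emeasure_mono[of ?B "shell n" lborel] * by simp
  then show False
    using content_ball_pos[of "1/2" "(real n + 1/2) *\<^sub>R b"] by (simp add: measure_def)
qed

definition shell_volume :: "'a::euclidean_space itself \<Rightarrow> nat \<Rightarrow> real" where
  "shell_volume _ n = measure lborel (shell n :: 'a set)"

lemma shell_volume: "emeasure lborel (shell n :: 'a::euclidean_space set) = ennreal (shell_volume TYPE('a) n)"
  and shell_volume_pos: "shell_volume TYPE('a) n > 0"
proof -
  show *: "emeasure lborel (shell n :: 'a set) = ennreal (shell_volume TYPE('a) n)"
    using shell_finite[of n, where 'a = 'a] by (simp add: shell_volume_def emeasure_eq_ennreal_measure less_top)
  show "shell_volume TYPE('a) n > 0"
    using shell_pos[of n, where 'a = 'a] unfolding * by (simp add: shell_volume_def zero_less_measure_iff * le_less)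
qed

text \<open>A sample: for each shell a number of points and an infinite supply of marked locations,
  of which only the first that many are used.\<close>

type_synonym 'a cloud = "nat \<Rightarrow> nat \<times> (nat \<Rightarrow> 'a \<times> nat)"

lemma sets_borel_nat: "sets (borel :: nat measure) = UNIV"
  by (auto intro: borel_open simp: discrete_topology_class.open_discrete)

lemma sets_dirac_sum: "sets (dirac_sum I a y) = sets borel"
  by (simp add: dirac_sum_def)

lemma integral_dirac_sum:
  assumes [measurable]: "f \<in> borel_measurable borel" and a: "\<And>i. a i \<ge> 0"
  shows "(\<integral>x. f x \<partial>dirac_sum I a y) = (\<integral>i. a i * f (y i :: 'b::topological_space) \<partial>count_space I)"
  unfolding dirac_sum_def using a
  by (subst integral_distr) (auto simp: integral_density)

text \<open>The process is the identity map on a space of measures. The functions \<open>f\<close>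
  are all Borel functions vanishing outside a ball, so that masses of bounded Borel sets are
  covered. \<open>T x\<close> is the expectation of exp(s f(x)) over the mark s; it is 1 where
  \<open>f\<close> vanishes, so \<open>T x - 1\<close> has bounded support.\<close>

definition compound_poisson :: "real \<Rightarrow> nat pmf \<Rightarrow> 'a::euclidean_space measure measure \<Rightarrow> bool" where
  "compound_poisson lam \<sigma> P \<longleftrightarrow> random_measure P (\<lambda>\<mu>. \<mu>)
     \<and> (AE \<mu> in P. \<exists>(I::nat set) (s::nat \<Rightarrow> nat) x. \<mu> = dirac_sum I (\<lambda>i. real (s i)) x)
     \<and> (\<forall>(f :: 'a \<Rightarrow> real) K::nat. f \<in> borel_measurable borel \<and> (\<forall>x. norm x \<ge> real K \<longrightarrow> f x = 0) \<longrightarrow>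
          (\<lambda>\<mu>. \<integral>x. f x \<partial>\<mu>) \<in> borel_measurable P)
     \<and> (\<forall>(f :: 'a \<Rightarrow> real) T (K::nat) B. f \<in> borel_measurable borel \<and> (\<forall>x. norm x \<ge> real K \<longrightarrow> f x = 0) \<and>
          T \<in> borel_measurable borel \<and> (\<forall>x. 0 \<le> T x \<and> T x \<le> B) \<and>
          (\<forall>x. (\<integral>\<^sup>+s. ennreal (exp (real s * f x)) \<partial>measure_pmf \<sigma>) = ennreal (T x)) \<longrightarrow>
          (\<integral>\<^sup>+\<mu>. ennreal (exp (\<integral>x. f x \<partial>\<mu>)) \<partial>P) = ennreal (exp (lam * (\<integral>x. T x - 1 \<partial>lborel))))"

context
  fixes lam :: real and \<sigma> :: "nat pmf"
  assumes lam: "lam > 0"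
begin

definition point_law :: "nat \<Rightarrow> ('a::euclidean_space \<times> nat) measure" where
  "point_law n = uniform_measure lborel (shell n) \<Otimes>\<^sub>M measure_pmf \<sigma>"

text \<open>The standard construction of a Poisson process of intensity \<open>lam\<close> on a set
  of finite volume: a Poisson number of independent uniform points, here with independent marks of
  law \<sigma>.\<close>

definition shell_law :: "nat \<Rightarrow> (nat \<times> (nat \<Rightarrow> 'a::euclidean_space \<times> nat)) measure" where
  "shell_law n = measure_pmf (poisson_pmf (lam * shell_volume TYPE('a) n)) \<Otimes>\<^sub>M PiM UNIV (\<lambda>_. point_law n)"

definition cloud_law :: "'a::euclidean_space cloud measure" where
  "cloud_law = PiM UNIV shell_law"

lemma prob_space_uniform_shell: "prob_space (uniform_measure lborel (shell n :: 'a::euclidean_space set))"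
  using shell_pos shell_finite by (intro prob_space_uniform_measure) (auto simp: less_top)

lemma prob_space_point_law: "prob_space (point_law n :: ('a::euclidean_space \<times> nat) measure)"
proof -
  interpret A: prob_space "uniform_measure lborel (shell n :: 'a set)" by (rule prob_space_uniform_shell)
  interpret B: prob_space "measure_pmf \<sigma>" by (rule prob_space_measure_pmf)
  interpret pair_prob_space "uniform_measure lborel (shell n :: 'a set)" "measure_pmf \<sigma>" ..
  show ?thesis unfolding point_law_def by (rule prob_space_axioms)
qed

lemma prob_space_shell_law: "prob_space (shell_law n :: (nat \<times> (nat \<Rightarrow> 'a::euclidean_space \<times> nat)) measure)"
proof -
  interpret A: prob_space "measure_pmf (poisson_pmf (lam * shell_volume TYPE('a) n))" by (rule prob_space_measure_pmf)
  interpret B: prob_space "PiM UNIV (\<lambda>_::nat. point_law n :: ('a \<times> nat) measure)"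
    by (intro prob_space_PiM prob_space_point_law)
  interpret pair_prob_space "measure_pmf (poisson_pmf (lam * shell_volume TYPE('a) n))" "PiM UNIV (\<lambda>_::nat. point_law n :: ('a \<times> nat) measure)" ..
  show ?thesis unfolding shell_law_def by (rule prob_space_axioms)
qed

lemma prob_space_cloud_law: "prob_space (cloud_law :: 'a::euclidean_space cloud measure)"
  unfolding cloud_law_def by (intro prob_space_PiM prob_space_shell_law)

lemma sets_point_law: "sets (point_law n) = sets (borel :: ('a::euclidean_space \<times> nat) measure)"
  unfolding point_law_def borel_prod[symmetric]
  by (intro sets_pair_measure_cong) (auto simp: sets_borel_nat)

lemma sets_shell_law: "sets (shell_law n) = sets (borel :: (nat \<times> (nat \<Rightarrow> 'a::euclidean_space \<times> nat)) measure)"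
  unfolding shell_law_def borel_prod[symmetric]
proof (intro sets_pair_measure_cong)
  show "sets (PiM UNIV (\<lambda>_::nat. point_law n)) = sets (borel :: (nat \<Rightarrow> 'a \<times> nat) measure)"
    unfolding sets_PiM_equal_borel[symmetric] by (intro sets_PiM_cong sets_point_law refl)
qed (auto simp: sets_borel_nat)

text \<open>Identifying the product sigma-algebra with the Borel sets of the product topology allows
  measurability to be proved by continuity.\<close>

lemma sets_cloud_law: "sets cloud_law = sets (borel :: 'a::euclidean_space cloud measure)"
  unfolding cloud_law_def sets_PiM_equal_borel[symmetric] by (intro sets_PiM_cong sets_shell_law refl)

lemma space_laws [simp]: "space (point_law n) = UNIV" "space (shell_law n) = UNIV" "space cloud_law = UNIV"
  using sets_eq_imp_space_eq[OF sets_point_law] sets_eq_imp_space_eq[OF sets_shell_law] sets_eq_imp_space_eq[OF sets_cloud_law]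
  by auto

section \<open>The random measure read off from a cloud\<close>

definition location :: "'a cloud \<Rightarrow> nat \<times> nat \<Rightarrow> 'a" where
  "location \<omega> = (\<lambda>(n, j). fst (snd (\<omega> n) j))"

definition mark :: "'a cloud \<Rightarrow> nat \<times> nat \<Rightarrow> nat" where
  "mark \<omega> = (\<lambda>(n, j). snd (snd (\<omega> n) j))"

text \<open>Only the lower bound on the norm is kept: it is a closed condition, and it already
  ensures that a bounded set meets only finitely many shells' points.\<close>

definition proper_clouds :: "'a::euclidean_space cloud set" where
  "proper_clouds = {\<omega>. \<forall>n j. real n \<le> norm (location \<omega> (n, j))}"

text \<open>\<open>prod_decode\<close> turns the index pairs into natural numbers, the index type of
  \<open>point_process\<close>. On the null set of improper clouds the value is the zero measure, so
  every value is Radon.\<close>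

definition cloud_measure :: "'a::euclidean_space cloud \<Rightarrow> 'a measure" where
  "cloud_measure \<omega> = (if \<omega> \<in> proper_clouds
     then dirac_sum {k. snd (prod_decode k) < fst (\<omega> (fst (prod_decode k)))}
            (\<lambda>k. real (mark \<omega> (prod_decode k))) (\<lambda>k. location \<omega> (prod_decode k))
     else null_measure borel)"

definition cloud_sum :: "nat \<Rightarrow> ('a \<Rightarrow> real) \<Rightarrow> 'a cloud \<Rightarrow> real" where
  "cloud_sum K f \<omega> = (\<Sum>n<K. \<Sum>j<fst (\<omega> n). real (snd (snd (\<omega> n) j)) * f (fst (snd (\<omega> n) j)))"

lemma sum_prod_decode:
  "(\<Sum>k | prod_decode k \<in> Sigma {..<K} (\<lambda>n. {..<N n}). h (prod_decode k)) = (\<Sum>n<K. \<Sum>j<N n. h (n, j))"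
  and finite_prod_decode: "finite {k. prod_decode k \<in> Sigma {..<K} (\<lambda>n. {..<N n :: nat})}"
proof -
  have b: "bij_betw prod_decode {k. prod_decode k \<in> Sigma {..<K} (\<lambda>n. {..<N n})} (Sigma {..<K} (\<lambda>n. {..<N n}))"
    by (rule bij_betw_byWitness[where f' = prod_encode]) auto
  show "finite {k. prod_decode k \<in> Sigma {..<K} (\<lambda>n. {..<N n :: nat})}"
    using bij_betw_finite[OF b] by simp
  have "(\<Sum>k | prod_decode k \<in> Sigma {..<K} (\<lambda>n. {..<N n}). h (prod_decode k)) = (\<Sum>p\<in>Sigma {..<K} (\<lambda>n. {..<N n}). h p)"
    by (rule sum.reindex_bij_betw[OF b])
  also have "\<dots> = (\<Sum>n<K. \<Sum>j<N n. h (n, j))"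
    by (simp add: sum.Sigma)
  finally show "(\<Sum>k | prod_decode k \<in> Sigma {..<K} (\<lambda>n. {..<N n}). h (prod_decode k)) = (\<Sum>n<K. \<Sum>j<N n. h (n, j))" .
qed

text \<open>In a proper cloud the points of shell \<open>n\<close> have norm at least
  \<open>n\<close>, so all shells from \<open>K\<close> on lie where \<open>f\<close> vanishes and
  the countable sum collapses to a finite one.\<close>

lemma integral_cloud_measure:
  fixes f :: "'a::euclidean_space \<Rightarrow> real"
  assumes \<omega>: "\<omega> \<in> proper_clouds" and f: "f \<in> borel_measurable borel" and K: "\<And>x. norm x \<ge> real K \<Longrightarrow> f x = 0"
  shows "(\<integral>x. f x \<partial>cloud_measure \<omega>) = cloud_sum K f \<omega>"
proof -
  let ?I = "{k. snd (prod_decode k) < fst (\<omega> (fst (prod_decode k)))}"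
  let ?g = "\<lambda>k. real (mark \<omega> (prod_decode k)) * f (location \<omega> (prod_decode k))"
  let ?J = "{k. prod_decode k \<in> Sigma {..<K} (\<lambda>n. {..<fst (\<omega> n)})}"
  have J: "{k \<in> ?I. ?g k \<noteq> 0} \<subseteq> ?J"
  proof
    fix k assume k: "k \<in> {k \<in> ?I. ?g k \<noteq> 0}"
    obtain n j where nj: "prod_decode k = (n, j)" by fastforce
    have "real n \<le> norm (location \<omega> (n, j))" using \<omega> by (simp add: proper_clouds_def)
    moreover have "\<not> real K \<le> norm (location \<omega> (n, j))" using k K nj by auto
    ultimately show "k \<in> ?J" using k nj by auto
  qed
  have "(\<integral>x. f x \<partial>cloud_measure \<omega>) = (\<integral>k. ?g k \<partial>count_space ?I)"
    using \<omega> f by (simp add: cloud_measure_def integral_dirac_sum)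
  also have "\<dots> = (\<Sum>k\<in>{k \<in> ?I. ?g k \<noteq> 0}. ?g k)"
    using finite_subset[OF J finite_prod_decode] by (subst lebesgue_integral_count_space_finite_support) auto
  also have "\<dots> = (\<Sum>k\<in>?J. ?g k)"
    by (rule sum.mono_neutral_left[OF finite_prod_decode J]) auto
  also have "\<dots> = cloud_sum K f \<omega>"
    using sum_prod_decode[where K = K and N = "\<lambda>n. fst (\<omega> n)" and h = "\<lambda>p. real (mark \<omega> p) * f (location \<omega> p)"]
    by (simp add: cloud_sum_def mark_def location_def)
  finally show ?thesis .
qed

lemma sets_cloud_measure: "sets (cloud_measure \<omega>) = sets borel"
  by (simp add: cloud_measure_def sets_dirac_sum)

lemma cloud_measure_radon: "cloud_measure \<omega> \<in> radon_measures"
  unfolding radon_measures_def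
proof (intro CollectI conjI allI impI sets_cloud_measure)
  fix C :: "'a set" assume C: "compact C"
  show "emeasure (cloud_measure \<omega>) C < \<infinity>"
  proof (cases "\<omega> \<in> proper_clouds")
    case False
    then show ?thesis by (simp add: cloud_measure_def)
  next
    case True
    obtain r where r: "C \<subseteq> ball 0 r" using bounded_subset_ballD[OF compact_imp_bounded[OF C]] by blast
    define K where "K = nat \<lceil>r\<rceil>"
    have K: "norm x < real K" if "x \<in> C" for x
      using r that real_nat_ceiling_ge[of r] by (force simp: K_def)
    let ?I = "{k. snd (prod_decode k) < fst (\<omega> (fst (prod_decode k)))}"
    let ?g = "\<lambda>k. ennreal (real (mark \<omega> (prod_decode k))) * indicator C (location \<omega> (prod_decode k))"
    let ?J = "{k. prod_decode k \<in> Sigma {..<K} (\<lambda>n. {..<fst (\<omega> n)})}"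
    have "emeasure (cloud_measure \<omega>) C = (\<integral>\<^sup>+k. ?g k \<partial>count_space ?I)"
      using True C by (simp add: cloud_measure_def emeasure_dirac_sum borel_compact)
    also have "\<dots> = (\<Sum>k\<in>?J. ?g k)"
    proof (rule nn_integral_count_space'[OF finite_prod_decode])
      fix k assume k: "k \<in> ?I" "k \<notin> ?J"
      obtain n j where nj: "prod_decode k = (n, j)" by fastforce
      have "real K \<le> real n" using k nj by auto
      also have "real n \<le> norm (location \<omega> (n, j))" using True by (simp add: proper_clouds_def)
      finally have "location \<omega> (n, j) \<notin> C" using K by force
      then show "?g k = 0" using nj by simp
    qed auto
    also have "\<dots> < \<infinity>"
      unfolding infinity_ennreal_def ennreal_sum_less_top[OF finite_prod_decode]
      by (auto simp: indicator_def)
    finally show ?thesis .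
  qed
qed

text \<open>The first component is discrete, hence locally constant; applied with the number of
  points as the number of summands.\<close>

lemma continuous_on_fst_discrete:
  fixes h :: "nat \<Rightarrow> 'b::topological_space \<Rightarrow> real"
  assumes "\<And>N. continuous_on UNIV (h N)"
  shows "continuous_on UNIV (\<lambda>p. h (fst p) (snd p))"
  unfolding continuous_on_open_vimage[OF open_UNIV]
proof (intro allI impI)
  fix B :: "real set" assume B: "open B"
  have "(\<lambda>p. h (fst p) (snd p)) -` B \<inter> UNIV = (\<Union>N. {N} \<times> (h N -` B))" by auto
  moreover have "open (h N -` B)" for N
    using assms[of N] B by (metis open_vimage)
  ultimately show "open ((\<lambda>p. h (fst p) (snd p)) -` B \<inter> UNIV)"
    by (auto intro!: open_UN open_Times discrete_topology_class.open_discrete)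
qed

lemma continuous_on_cloud_sum:
  assumes "continuous_on UNIV f"
  shows "continuous_on UNIV (cloud_sum K f)"
proof -
  have "continuous_on UNIV (\<lambda>s :: nat \<Rightarrow> 'a \<times> nat. \<Sum>j<N. real (snd (s j)) * f (fst (s j)))" for N
  proof (intro continuous_on_sum continuous_on_mult)
    fix j :: nat
    have c: "continuous_on UNIV (\<lambda>s :: nat \<Rightarrow> 'a \<times> nat. s j)" by simp
    show "continuous_on UNIV (\<lambda>s :: nat \<Rightarrow> 'a \<times> nat. real (snd (s j)))"
      using continuous_on_compose2[OF Topological_Spaces.continuous_on_discrete[of UNIV real] continuous_on_snd[OF c]] by simp
    show "continuous_on UNIV (\<lambda>s :: nat \<Rightarrow> 'a \<times> nat. f (fst (s j)))"
      using continuous_on_compose2[OF assms continuous_on_fst[OF c]] by simp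
  qed
  then have h: "continuous_on UNIV (\<lambda>p :: nat \<times> (nat \<Rightarrow> 'a \<times> nat). \<Sum>j<fst p. real (snd (snd p j)) * f (fst (snd p j)))"
    by (rule continuous_on_fst_discrete[where h = "\<lambda>N s. \<Sum>j<N. real (snd (s j)) * f (fst (s j))"])
  have "continuous_on UNIV (\<lambda>\<omega> :: 'a cloud. \<Sum>j<fst (\<omega> n). real (snd (snd (\<omega> n) j)) * f (fst (snd (\<omega> n) j)))" for n
    using continuous_on_compose2[OF h continuous_on_product_coordinates[of n]] by simp
  then show ?thesis
    unfolding cloud_sum_def[abs_def] by (intro continuous_on_sum)
qed

lemma closed_proper_clouds: "closed (proper_clouds :: 'a::euclidean_space cloud set)"
proof -
  have c: "continuous_on UNIV (\<lambda>\<omega> :: 'a cloud. norm (location \<omega> (n, j)))" for n j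
  proof -
    have 1: "continuous_on UNIV (\<lambda>\<omega> :: 'a cloud. snd (\<omega> n))"
      by (intro continuous_on_snd) simp
    have 2: "continuous_on UNIV (\<lambda>s :: nat \<Rightarrow> 'a \<times> nat. s j)" by simp
    have "continuous_on UNIV (\<lambda>\<omega> :: 'a cloud. snd (\<omega> n) j)"
      using continuous_on_compose2[OF 2 1] by simp
    then show ?thesis
      unfolding location_def by (simp add: continuous_on_norm continuous_on_fst)
  qed
  have *: "proper_clouds = (\<Inter>n. \<Inter>j. {\<omega> :: 'a cloud. real n \<le> norm (location \<omega> (n, j))})"
    by (auto simp: proper_clouds_def)
  show ?thesis
    unfolding * using c by (auto intro!: closed_INT closed_Collect_le)
qed

lemma proper_clouds_sets [measurable]: "(proper_clouds :: 'a::euclidean_space cloud set) \<in> sets cloud_law"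
  unfolding sets_cloud_law by (rule borel_closed[OF closed_proper_clouds])

lemma AE_proper_clouds: "AE \<omega> in cloud_law. \<omega> \<in> (proper_clouds :: 'a::euclidean_space cloud set)"
proof -
  have "AE \<omega> in (cloud_law :: 'a cloud measure). real n \<le> norm (fst (snd (\<omega> n) j))" for n j
  proof -
    interpret A: prob_space "uniform_measure lborel (shell n :: 'a set)" by (rule prob_space_uniform_shell)
    interpret B: prob_space "measure_pmf \<sigma>" by (rule prob_space_measure_pmf)
    interpret AB: pair_prob_space "uniform_measure lborel (shell n :: 'a set)" "measure_pmf \<sigma>" ..
    have "AE p in point_law n. real n \<le> norm (fst p :: 'a)"
      unfolding point_law_def
    proof (rule AB.AE_pair_measure)
      show "{p \<in> space (uniform_measure lborel (shell n :: 'a set) \<Otimes>\<^sub>M measure_pmf \<sigma>). real n \<le> norm (fst p)}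
          \<in> sets (uniform_measure lborel (shell n) \<Otimes>\<^sub>M measure_pmf \<sigma>)"
        by measurable
      have "AE x in uniform_measure lborel (shell n :: 'a set). real n \<le> norm x"
        by (rule AE_uniform_measureI) (auto simp: shell_def)
      then show "AE x in uniform_measure lborel (shell n :: 'a set). AE y in measure_pmf \<sigma>. real n \<le> norm (fst (x, y))"
        by simp
    qed
    then have 1: "AE s in PiM UNIV (\<lambda>_::nat. point_law n). real n \<le> norm (fst (s j) :: 'a)"
      by (intro AE_PiM_component prob_space_point_law) auto
    interpret C: prob_space "measure_pmf (poisson_pmf (lam * shell_volume TYPE('a) n))" by (rule prob_space_measure_pmf)
    interpret D: prob_space "PiM UNIV (\<lambda>_::nat. point_law n :: ('a \<times> nat) measure)"
      by (intro prob_space_PiM prob_space_point_law)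
    interpret CD: pair_prob_space "measure_pmf (poisson_pmf (lam * shell_volume TYPE('a) n))" "PiM UNIV (\<lambda>_::nat. point_law n :: ('a \<times> nat) measure)" ..
    have "AE p in shell_law n. real n \<le> norm (fst (snd p j) :: 'a)"
      unfolding shell_law_def
    proof (rule CD.AE_pair_measure)
      have "(\<lambda>p. norm (fst (snd p j) :: 'a)) \<in> borel_measurable (shell_law n)"
        unfolding measurable_cong_sets[OF sets_shell_law refl]
      proof (rule borel_measurable_continuous_onI)
        have 2: "continuous_on UNIV (\<lambda>s :: nat \<Rightarrow> 'a \<times> nat. s j)" by simp
        show "continuous_on UNIV (\<lambda>p :: nat \<times> (nat \<Rightarrow> 'a \<times> nat). norm (fst (snd p j)))"
          using continuous_on_compose2[OF 2 continuous_on_snd[OF continuous_on_id]]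
          by (intro continuous_on_norm continuous_on_fst) simp
      qed
      from borel_measurable_le[OF _ this, of "\<lambda>_. real n"]
      show "{p \<in> space (measure_pmf (poisson_pmf (lam * shell_volume TYPE('a) n)) \<Otimes>\<^sub>M PiM UNIV (\<lambda>_::nat. point_law n)).
          real n \<le> norm (fst (snd p j) :: 'a)} \<in> sets (measure_pmf (poisson_pmf (lam * shell_volume TYPE('a) n)) \<Otimes>\<^sub>M PiM UNIV (\<lambda>_::nat. point_law n))"
        unfolding shell_law_def by simp
      show "AE x in measure_pmf (poisson_pmf (lam * shell_volume TYPE('a) n)).
          AE y in PiM UNIV (\<lambda>_::nat. point_law n). real n \<le> norm (fst (snd (x, y) j) :: 'a)"
        using 1 by simp
    qed
    then show ?thesis
      unfolding cloud_law_def by (intro AE_PiM_component prob_space_shell_law) auto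
  qed
  then have "AE \<omega> in (cloud_law :: 'a cloud measure). \<forall>n j. real n \<le> norm (fst (snd (\<omega> n) j))"
    by (simp add: AE_all_countable)
  then show ?thesis by (simp add: proper_clouds_def location_def)
qed

lemma integral_cloud_measure_improper: "\<omega> \<notin> proper_clouds \<Longrightarrow> (\<integral>x. f x \<partial>cloud_measure \<omega>) = 0"
  by (simp add: cloud_measure_def)

text \<open>\<open>vague_borel\<close> is generated by all vaguely open sets, including arbitrary
  unions of basic ones, so measurability on the generating sets of the topology would not settle it.
  Continuity on the closed set of proper clouds, which may be tested on those generating sets,
  handles every open set at once.\<close>

lemma cloud_measure_measurable: "cloud_measure \<in> cloud_law \<rightarrow>\<^sub>M (vague_borel :: 'a::euclidean_space measure measure)"
  unfolding vague_borel_def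
proof (rule measurable_measure_of)
  show "{U. openin vague_topology U} \<subseteq> Pow (radon_measures :: 'a measure set)"
  proof -
    have "topspace vague_topology \<subseteq> (radon_measures :: 'a measure set)"
      unfolding vague_topology_def topology_generated_by_topspace by blast
    then show ?thesis using openin_subset by fast
  qed
  show "cloud_measure \<in> space cloud_law \<rightarrow> radon_measures"
    using cloud_measure_radon by blast
next
  fix V :: "'a measure set" assume "V \<in> {U. openin vague_topology U}"
  then have V: "openin vague_topology V" by simp
  let ?G = "proper_clouds :: 'a cloud set"
  have "continuous_map (top_of_set ?G) vague_topology cloud_measure"
    unfolding vague_topology_def
  proof (rule continuous_on_generated_topo)
    fix S :: "'a measure set"
    assume "S \<in> {{\<mu> \<in> radon_measures. (\<integral>x. f x \<partial>\<mu>) \<in> U} |f U. f \<in> C_0 \<and> open U}"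
    then obtain f :: "'a \<Rightarrow> real" and U where S: "S = {\<mu> \<in> radon_measures. (\<integral>x. f x \<partial>\<mu>) \<in> U}" and f: "f \<in> C_0" and U: "open U"
      by blast
    obtain r where r: "{x. f x \<noteq> 0} \<subseteq> ball 0 r" using f bounded_subset_ballD unfolding C_0_iff by blast
    define K where "K = nat \<lceil>r\<rceil>"
    have K: "f x = 0" if "norm x \<ge> real K" for x
      using r that real_nat_ceiling_ge[of r] by (force simp: K_def)
    have "cloud_measure -` S \<inter> topspace (top_of_set ?G) = ?G \<inter> cloud_sum K f -` U"
      using integral_cloud_measure[OF _ C_0_borel_measurable[OF f] K]
      by (auto simp: S cloud_measure_radon)
    moreover have "openin (top_of_set ?G) (?G \<inter> cloud_sum K f -` U)"
    proof (rule continuous_openin_preimage_gen[OF _ U])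
      show "continuous_on ?G (cloud_sum K f)"
        using f continuous_on_cloud_sum[of f K] by (auto simp: C_0_iff intro: continuous_on_subset)
    qed
    ultimately show "openin (top_of_set ?G) (cloud_measure -` S \<inter> topspace (top_of_set ?G))" by simp
  next
    have "radon_measures \<in> {{\<mu> \<in> radon_measures. (\<integral>x. f x \<partial>\<mu>) \<in> U} |f U. (f :: 'a \<Rightarrow> real) \<in> C_0 \<and> open U}"
      using C_0_zero by (intro CollectI exI[of _ "\<lambda>_. 0"] exI[of _ UNIV]) auto
    then show "cloud_measure ` topspace (top_of_set ?G) \<subseteq> \<Union> {{\<mu> \<in> radon_measures. (\<integral>x. f x \<partial>\<mu>) \<in> U} |f U. (f :: 'a \<Rightarrow> real) \<in> C_0 \<and> open U}"
      using cloud_measure_radon by blast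
  qed
  then have "openin (top_of_set ?G) {\<omega> \<in> topspace (top_of_set ?G). cloud_measure \<omega> \<in> V}"
    using V by (rule openin_continuous_map_preimage)
  then obtain T where T: "open T" "{\<omega> \<in> ?G. cloud_measure \<omega> \<in> V} = ?G \<inter> T"
    by (auto simp: openin_open)
  have "cloud_measure -` V \<inter> space cloud_law = (?G \<inter> T) \<union> (if null_measure borel \<in> V then - ?G else {})"
    unfolding T(2)[symmetric]
  proof (rule set_eqI)
    fix \<omega>
    have "cloud_measure \<omega> = null_measure borel" if "\<omega> \<notin> ?G" using that by (simp add: cloud_measure_def)
    then show "\<omega> \<in> cloud_measure -` V \<inter> space cloud_law \<longleftrightarrow>
        \<omega> \<in> {\<omega> \<in> ?G. cloud_measure \<omega> \<in> V} \<union> (if null_measure borel \<in> V then - ?G else {})"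
      by (cases "\<omega> \<in> ?G") auto
  qed
  also have "\<dots> \<in> sets cloud_law"
    using T(1) borel_closed[OF closed_proper_clouds] borel_comp[OF borel_closed[OF closed_proper_clouds]]
    unfolding sets_cloud_law by auto
  finally show "cloud_measure -` V \<inter> space cloud_law \<in> sets cloud_law" .
qed

text \<open>The exponential factorises over the independent shells, and within a shell over a
  Poisson number of independent points. The Poisson generating function gives exp(lam (I - v)) for a
  shell of volume v on which \<open>T\<close> integrates to I.\<close>

lemma nn_integral_exp_cloud_measure:
  fixes f T :: "'a::euclidean_space \<Rightarrow> real"
  assumes f [measurable]: "f \<in> borel_measurable borel" and K: "\<And>x. norm x \<ge> real K \<Longrightarrow> f x = 0"
    and T [measurable]: "T \<in> borel_measurable borel" and T_bounds: "\<And>x. 0 \<le> T x \<and> T x \<le> B"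
    and T_eq: "\<And>x. (\<integral>\<^sup>+s. ennreal (exp (real s * f x)) \<partial>measure_pmf \<sigma>) = ennreal (T x)"
  shows "(\<integral>\<^sup>+\<omega>. ennreal (exp (\<integral>x. f x \<partial>cloud_measure \<omega>)) \<partial>cloud_law) = ennreal (exp (lam * (\<integral>x. T x - 1 \<partial>lborel)))"
proof -
  define u where "u = (\<lambda>p :: 'a \<times> nat. ennreal (exp (real (snd p) * f (fst p))))"
  define e where "e = (\<lambda>p :: nat \<times> (nat \<Rightarrow> 'a \<times> nat). \<Prod>j<fst p. u (snd p j))"
  let ?v = "shell_volume TYPE('a)"
  define I where "I n = (\<integral>x. T x * indicator (shell n) x \<partial>lborel)" for n
  have int_ind: "integrable lborel (\<lambda>x. indicator (shell n :: 'a set) x :: real)" for n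
    using shell_finite[of n, where 'a = 'a] by simp
  have int_T: "integrable lborel (\<lambda>x. T x * indicator (shell n) x)" for n
  proof (rule Bochner_Integration.integrable_bound[OF integrable_mult_right[OF int_ind, of B n]])
    have "norm (T x * indicator (shell n) x) \<le> norm (B * indicator (shell n) x)" for x
      using T_bounds[of x] by (simp add: indicator_def)
    then show "AE x in lborel. norm (T x * indicator (shell n) x) \<le> norm (B * indicator (shell n) x)" by simp
  qed simp
  have u_meas [measurable]: "u \<in> borel_measurable (point_law n)" for n
    unfolding u_def point_law_def by measurable
  have "e \<in> borel_measurable (shell_law n)" for n
  proof -
    have "(\<lambda>p. \<Prod>j<N. u (snd p j)) \<in> borel_measurable (shell_law n)" for N :: nat
      unfolding shell_law_def by measurable
    moreover have "fst \<in> shell_law n \<rightarrow>\<^sub>M count_space UNIV"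
      unfolding shell_law_def by measurable
    ultimately show ?thesis
      unfolding e_def by (rule measurable_compose_countable)
  qed
  note e_meas = this
  have point: "integral\<^sup>N (point_law n) u = ennreal (I n / ?v n)" for n
  proof -
    have "integral\<^sup>N (point_law n) u = (\<integral>\<^sup>+x. (\<integral>\<^sup>+s. u (x, s) \<partial>measure_pmf \<sigma>) \<partial>uniform_measure lborel (shell n))"
      unfolding point_law_def by (rule sigma_finite_measure.nn_integral_fst[OF prob_space_imp_sigma_finite[OF prob_space_measure_pmf], symmetric]) (use u_meas[of n] in \<open>simp add: point_law_def\<close>)
    also have "\<dots> = (\<integral>\<^sup>+x. ennreal (T x) \<partial>uniform_measure lborel (shell n))"
      by (simp add: u_def T_eq)
    also have "\<dots> = (\<integral>\<^sup>+x. ennreal (T x) * indicator (shell n) x \<partial>lborel) / emeasure lborel (shell n :: 'a set)"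
      by (rule nn_integral_uniform_measure) auto
    also have "(\<integral>\<^sup>+x. ennreal (T x) * indicator (shell n) x \<partial>lborel) = (\<integral>\<^sup>+x. ennreal (T x * indicator (shell n) x) \<partial>lborel)"
      by (intro nn_integral_cong) (auto simp: indicator_def)
    also have "\<dots> = ennreal (I n)"
      unfolding I_def using int_T T_bounds by (intro nn_integral_eq_integral) auto
    also have "ennreal (I n) / emeasure lborel (shell n :: 'a set) = ennreal (I n / ?v n)"
      unfolding shell_volume using shell_volume_pos T_bounds by (intro divide_ennreal) (auto simp: I_def)
    finally show ?thesis .
  qed
  have shell: "integral\<^sup>N (shell_law n) e = ennreal (exp (lam * (I n - ?v n)))" for n
  proof -
    interpret D: prob_space "PiM UNIV (\<lambda>_::nat. point_law n :: ('a \<times> nat) measure)"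
      by (intro prob_space_PiM prob_space_point_law)
    have "integral\<^sup>N (shell_law n) e = (\<integral>\<^sup>+N. (\<integral>\<^sup>+s. e (N, s) \<partial>PiM UNIV (\<lambda>_. point_law n)) \<partial>measure_pmf (poisson_pmf (lam * ?v n)))"
      unfolding shell_law_def by (rule D.nn_integral_fst[symmetric]) (use e_meas[of n] in \<open>simp add: shell_law_def\<close>)
    also have "\<dots> = (\<integral>\<^sup>+N. ennreal (I n / ?v n) ^ N \<partial>measure_pmf (poisson_pmf (lam * ?v n)))"
    proof (intro nn_integral_cong)
      fix N :: nat
      have "(\<integral>\<^sup>+s. e (N, s) \<partial>PiM UNIV (\<lambda>_. point_law n)) = (\<Prod>j<N. integral\<^sup>N (point_law n) u)"
        unfolding e_def fst_conv snd_conv by (rule nn_integral_prod_PiM_UNIV[OF prob_space_point_law]) auto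
      then show "(\<integral>\<^sup>+s. e (N, s) \<partial>PiM UNIV (\<lambda>_. point_law n)) = ennreal (I n / ?v n) ^ N"
        by (simp add: point)
    qed
    also have "\<dots> = ennreal (exp (lam * ?v n * (I n / ?v n - 1)))"
      using lam shell_volume_pos[of n, where 'a = 'a] T_bounds
      by (intro poisson_generating_function) (auto simp: I_def intro!: divide_nonneg_nonneg less_imp_le[OF shell_volume_pos])
    also have "lam * ?v n * (I n / ?v n - 1) = lam * (I n - ?v n)"
      using shell_volume_pos[of n, where 'a = 'a] by (simp add: field_simps)
    finally show ?thesis .
  qed
  have "(\<integral>\<^sup>+\<omega>. ennreal (exp (\<integral>x. f x \<partial>cloud_measure \<omega>)) \<partial>cloud_law) = (\<integral>\<^sup>+\<omega>. (\<Prod>n<K. e (\<omega> n)) \<partial>cloud_law)"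
  proof (rule nn_integral_cong_AE)
    show "AE \<omega> in cloud_law. ennreal (exp (\<integral>x. f x \<partial>cloud_measure \<omega>)) = (\<Prod>n<K. e (\<omega> n))"
      using AE_proper_clouds
    proof eventually_elim
      case (elim \<omega>)
      show ?case
        by (simp add: integral_cloud_measure[OF elim f K] cloud_sum_def e_def u_def exp_sum prod_ennreal prod_nonneg)
    qed
  qed
  also have "\<dots> = (\<Prod>n<K. integral\<^sup>N (shell_law n) e)"
    unfolding cloud_law_def by (rule nn_integral_prod_PiM_UNIV[OF prob_space_shell_law]) (use e_meas in auto)
  also have "\<dots> = ennreal (exp (lam * (\<Sum>n<K. I n - ?v n)))"
    by (simp add: shell prod_ennreal exp_sum sum_distrib_left)
  also have "(\<Sum>n<K. I n - ?v n) = (\<integral>x. (\<Sum>n<K. T x * indicator (shell n) x - indicator (shell n) x) \<partial>lborel)"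
    using int_T int_ind by (simp add: I_def shell_volume_def)
  also have "\<dots> = (\<integral>x. T x - 1 \<partial>lborel)"
  proof (intro Bochner_Integration.integral_cong refl)
    fix x :: 'a
    \<comment> \<open>Off the support of \<open>f\<close> the integrand vanishes, which justifies
      replacing the sum over the first \<open>K\<close> shells by the whole space.\<close>
    have T1: "T x = 1" if "f x = 0"
      using T_eq[of x] that T_bounds[of x] by (simp add: prob_space.emeasure_space_1[OF prob_space_measure_pmf, simplified])
    let ?m = "nat \<lfloor>norm x\<rfloor>"
    have ind: "indicator (shell n) x = (if n = ?m then 1 else 0 :: real)" for n
      using mem_shell[of x n] by (auto simp: indicator_def)
    have "(\<Sum>n<K. T x * indicator (shell n) x - indicator (shell n) x) = (\<Sum>n<K. if n = ?m then T x - 1 else 0)"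
      by (intro sum.cong) (auto simp: ind)
    also have "\<dots> = (if ?m < K then T x - 1 else 0)" by simp
    also have "\<dots> = T x - 1"
    proof (cases "?m < K")
      case False
      then have "norm x \<ge> real K" by (simp add: nat_less_iff not_less) linarith
      then show ?thesis using T1 K by simp
    qed simp
    finally show "(\<Sum>n<K. T x * indicator (shell n) x - indicator (shell n) x) = T x - 1" .
  qed
  finally show ?thesis .
qed

lemma compound_poisson_exists: "\<exists>P :: 'a::euclidean_space measure measure. compound_poisson lam \<sigma> P"
proof -
  let ?R = "radon_measures :: 'a measure set"
  \<comment> \<open>The finest sigma-algebra for which \<open>cloud_measure\<close> is measurable.
    It contains the vague Borel sets, and a functional of the measure is measurable as soon as its
    composition with \<open>cloud_measure\<close> is.\<close>
  let ?E = "{B. B \<subseteq> ?R \<and> cloud_measure -` B \<inter> space cloud_law \<in> sets cloud_law}"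
  define N where "N = sigma ?R ?E"
  define P where "P = distr cloud_law N cloud_measure"
  have space_N: "space N = ?R" unfolding N_def by (rule space_measure_of) auto
  have sets_N: "B \<in> sets N" if "B \<in> ?E" for B
    using that unfolding N_def by (subst sets_measure_of) auto
  have meas [measurable]: "cloud_measure \<in> cloud_law \<rightarrow>\<^sub>M N"
    unfolding N_def by (rule measurable_measure_of) (use cloud_measure_radon in auto)
  have N_meas: "\<Phi> \<in> N \<rightarrow>\<^sub>M borel" if "(\<lambda>\<omega>. \<Phi> (cloud_measure \<omega>)) \<in> cloud_law \<rightarrow>\<^sub>M borel" for \<Phi> :: "'a measure \<Rightarrow> real"
  proof (rule measurableI)
    fix B :: "real set" assume "B \<in> sets borel"
    with that have "(\<lambda>\<omega>. \<Phi> (cloud_measure \<omega>)) -` B \<inter> space cloud_law \<in> sets cloud_law" by (rule measurable_sets)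
    moreover have "cloud_measure -` (\<Phi> -` B \<inter> ?R) \<inter> space cloud_law = (\<lambda>\<omega>. \<Phi> (cloud_measure \<omega>)) -` B \<inter> space cloud_law"
      using cloud_measure_radon by auto
    ultimately show "\<Phi> -` B \<inter> space N \<in> sets N" unfolding space_N by (intro sets_N) auto
  qed simp
  have cloud_int: "(\<lambda>\<omega>. \<integral>x. f x \<partial>cloud_measure \<omega>) \<in> borel_measurable cloud_law"
    if f [measurable]: "f \<in> borel_measurable borel" and K: "\<And>x. norm x \<ge> real K \<Longrightarrow> f x = 0" for f :: "'a \<Rightarrow> real" and K
  proof -
    have "(\<lambda>\<omega> :: 'a cloud. \<Sum>j<fst (\<omega> n). real (snd (snd (\<omega> n) j)) * f (fst (snd (\<omega> n) j))) \<in> borel_measurable cloud_law" for n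
    proof (rule measurable_compose_countable[where f = "\<lambda>N \<omega>. \<Sum>j<N. real (snd (snd (\<omega> n) j)) * f (fst (snd (\<omega> n) j))"])
      show "(\<lambda>\<omega> :: 'a cloud. fst (\<omega> n)) \<in> cloud_law \<rightarrow>\<^sub>M count_space UNIV"
        unfolding cloud_law_def shell_law_def by measurable
      show "(\<lambda>\<omega> :: 'a cloud. \<Sum>j<N. real (snd (snd (\<omega> n) j)) * f (fst (snd (\<omega> n) j))) \<in> borel_measurable cloud_law" for N :: nat
        unfolding cloud_law_def shell_law_def point_law_def by measurable
    qed
    then have [measurable]: "cloud_sum K f \<in> borel_measurable cloud_law"
      unfolding cloud_sum_def[abs_def] by (intro borel_measurable_sum)
    have "(\<lambda>\<omega>. \<integral>x. f x \<partial>cloud_measure \<omega>) = (\<lambda>\<omega>. if \<omega> \<in> proper_clouds then cloud_sum K f \<omega> else 0)"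
      using integral_cloud_measure[OF _ f K] by (auto simp: fun_eq_iff integral_cloud_measure_improper)
    also have "\<dots> \<in> borel_measurable cloud_law"
      by measurable
    finally show ?thesis .
  qed
  show ?thesis
    unfolding compound_poisson_def
  proof (intro exI[of _ P] conjI allI impI; (elim conjE)?)
    have "prob_space P" unfolding P_def by (rule prob_space.prob_space_distr[OF prob_space_cloud_law meas])
    moreover have "(\<lambda>\<mu>. \<mu>) \<in> P \<rightarrow>\<^sub>M vague_borel"
    proof (rule measurableI)
      have sp: "space (vague_borel :: 'a measure measure) = ?R"
        unfolding vague_borel_def by (rule space_measure_of_conv)
      show "\<mu> \<in> space (vague_borel :: 'a measure measure)" if "\<mu> \<in> space P" for \<mu>
        using that by (simp add: P_def space_N sp)
      fix V :: "'a measure set" assume V: "V \<in> sets vague_borel"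
      have "V \<subseteq> ?R" using sets.sets_into_space[OF V] sp by simp
      moreover have "cloud_measure -` V \<inter> space cloud_law \<in> sets cloud_law"
        by (rule measurable_sets[OF cloud_measure_measurable V])
      ultimately show "(\<lambda>\<mu>. \<mu>) -` V \<inter> space P \<in> sets P"
        unfolding P_def by (auto simp: space_N Int_absorb2 intro!: sets_N)
    qed
    ultimately show "random_measure P (\<lambda>\<mu>. \<mu>)" by (simp add: random_measure_def)
  next
    let ?Q = "\<lambda>\<mu> :: 'a measure. \<exists>(I::nat set) (s::nat \<Rightarrow> nat) x. \<mu> = dirac_sum I (\<lambda>i. real (s i)) x"
    have Q: "?Q (cloud_measure \<omega>)" for \<omega>
    proof (cases "\<omega> \<in> proper_clouds")
      case False
      have "null_measure borel = (dirac_sum {} (\<lambda>i. real (0::nat)) (\<lambda>_::nat. 0) :: 'a measure)"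
        by (rule measure_eqI) (simp_all add: sets_dirac_sum emeasure_dirac_sum nn_integral_empty)
      then show ?thesis
        using False by (intro exI[of _ "{}"] exI[of _ "\<lambda>_. 0"]) (simp add: cloud_measure_def)
    next
      case True
      then show ?thesis
        by (intro exI[of _ "{k. snd (prod_decode k) < fst (\<omega> (fst (prod_decode k)))}"]
            exI[of _ "\<lambda>k. mark \<omega> (prod_decode k)"] exI[of _ "\<lambda>k. location \<omega> (prod_decode k)"])
          (simp add: cloud_measure_def)
    qed
    \<comment> \<open>Every cloud yields a sum of point masses, so the preimage of this set is the
      whole space and the set belongs to the chosen sigma-algebra.\<close>
    have "{\<mu> \<in> space N. ?Q \<mu>} \<in> sets N"
    proof (rule sets_N)
      have "cloud_measure -` {\<mu> \<in> space N. ?Q \<mu>} \<inter> space cloud_law = space cloud_law"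
        using Q cloud_measure_radon by (auto simp: space_N)
      then show "{\<mu> \<in> space N. ?Q \<mu>} \<in> ?E" by (simp only: mem_Collect_eq sets.top) (auto simp: space_N)
    qed
    then show "AE \<mu> in P. ?Q \<mu>"
      unfolding P_def by (subst AE_distr_iff[OF meas]) (use Q in auto)
  next
    fix f :: "'a \<Rightarrow> real" and K :: nat
    assume "f \<in> borel_measurable borel" "\<forall>x. norm x \<ge> real K \<longrightarrow> f x = 0"
    note * = this(1) this(2)[rule_format]
    show "(\<lambda>\<mu>. \<integral>x. f x \<partial>\<mu>) \<in> borel_measurable P"
      using N_meas[OF cloud_int[OF *]] unfolding P_def by simp
  next
    fix f T :: "'a \<Rightarrow> real" and K :: nat and B :: real
    assume f: "f \<in> borel_measurable borel" "\<forall>x. norm x \<ge> real K \<longrightarrow> f x = 0"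
      and T: "T \<in> borel_measurable borel" "\<forall>x. 0 \<le> T x \<and> T x \<le> B"
       "\<forall>x. (\<integral>\<^sup>+s. ennreal (exp (real s * f x)) \<partial>measure_pmf \<sigma>) = ennreal (T x)"
    note * = f(1) f(2)[rule_format]
    have m: "(\<lambda>\<mu>. \<integral>x. f x \<partial>\<mu>) \<in> borel_measurable N"
      by (rule N_meas[OF cloud_int[OF *]])
    have "(\<integral>\<^sup>+\<mu>. ennreal (exp (\<integral>x. f x \<partial>\<mu>)) \<partial>P) = (\<integral>\<^sup>+\<omega>. ennreal (exp (\<integral>x. f x \<partial>cloud_measure \<omega>)) \<partial>cloud_law)"
      unfolding P_def by (rule nn_integral_distr[OF meas]) (use m in measurable)
    also have "\<dots> = ennreal (exp (lam * (\<integral>x. T x - 1 \<partial>lborel)))"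
      by (rule nn_integral_exp_cloud_measure[OF * T(1) T(2)[rule_format] T(3)[rule_format]])
    finally show "(\<integral>\<^sup>+\<mu>. ennreal (exp (\<integral>x. f x \<partial>\<mu>)) \<partial>P) = ennreal (exp (lam * (\<integral>x. T x - 1 \<partial>lborel)))" .
  qed
qed

end

subsection \<open>Negative binomial distributions\<close>

lemma log_series_sums:
  fixes z :: real
  assumes "\<bar>z\<bar> < 1"
  shows "(\<lambda>n. z ^ Suc n / real (Suc n)) sums (- ln (1 - z))"
proof -
  have "(\<lambda>n. - (z ^ n) / real n) sums ln (1 - z)"
    using ln_series'[of "- z"] assms by simp
  from sums_minus[OF this] have "(\<lambda>n. z ^ n / real n) sums (- ln (1 - z))" by simp
  \<comment> \<open>The index shift is harmless because the term at 0 is a division by zero, hence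
    0.\<close>
  then show ?thesis using sums_Suc_iff[of "\<lambda>n. z ^ n / real n"] by simp
qed

lemma neg_binomial_series_sums:
  fixes z r :: real
  assumes "\<bar>z\<bar> < 1"
  shows "(\<lambda>n. pochhammer r n / fact n * z ^ n) sums ((1 - z) powr (- r))"
proof -
  have "(- r gchoose n) * (- z) ^ n = pochhammer r n / fact n * z ^ n" for n
  proof -
    have "(- 1 :: real) ^ n * (- z) ^ n = z ^ n" by (simp flip: power_mult_distrib)
    then show ?thesis by (simp add: gbinomial_pochhammer mult.assoc mult.left_commute[of _ "pochhammer r n"] field_simps)
  qed
  then show ?thesis
    using gen_binomial_real[of "- z" "- r"] assms by simp
qed

context
  fixes \<eta> \<kappa> p :: real
  assumes eta: "\<eta> > 0" and kappa: "\<kappa> > 0" and p_def: "p = \<eta> / (\<eta> + 1 / \<kappa>\<^sup>2)"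
begin

lemma p_bounds: "0 < p" "p < 1" and p_ratio: "\<eta> * \<kappa>\<^sup>2 = p / (1 - p)" and p_inverse: "1 + \<kappa>\<^sup>2 * \<eta> = 1 / (1 - p)"
proof -
  have pos: "\<eta> + 1 / \<kappa>\<^sup>2 > 0" using eta kappa by (simp add: add_pos_pos)
  show "0 < p" "p < 1" using eta kappa pos by (simp_all add: p_def)
  have *: "1 - p = 1 / (1 + \<kappa>\<^sup>2 * \<eta>)" "p = \<kappa>\<^sup>2 * \<eta> / (1 + \<kappa>\<^sup>2 * \<eta>)"
    using pos kappa eta by (simp_all add: p_def field_simps)
  show "1 + \<kappa>\<^sup>2 * \<eta> = 1 / (1 - p)" unfolding *(1) by simp
  have "1 + \<kappa>\<^sup>2 * \<eta> > 0" using eta by (simp add: add_pos_nonneg)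
  then show "\<eta> * \<kappa>\<^sup>2 = p / (1 - p)" unfolding *(1) by (subst *(2)) simp
qed

text \<open>The Laplace exponent per unit volume: the integral of exp(- s y) - 1 over
  \<open>zeta_measure\<close>, summed by the logarithmic series.\<close>

definition nb_exponent :: "real \<Rightarrow> real" where
  "nb_exponent y = (ln (1 - p) - ln (1 - p * exp (- y))) / \<eta>"

lemma nb_exponent_0: "nb_exponent 0 = 0"
  by (simp add: nb_exponent_def)

lemma nb_denom_pos: "y \<ge> 0 \<Longrightarrow> 1 - p * exp (- y) > 0"
  using p_bounds by (intro tilt_denom_pos) auto

lemma nb_exponent_derivative:
  assumes "y \<ge> 0"
  shows "(nb_exponent has_real_derivative - (\<kappa>\<^sup>2 * tilt p y)) (at y)"
proof -
  have "(nb_exponent has_real_derivative - (p * exp (- y) / (1 - p * exp (- y))) / \<eta>) (at y)"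
    unfolding nb_exponent_def[abs_def] using nb_denom_pos[OF assms] eta by (auto intro!: derivative_eq_intros)
  moreover have "\<kappa>\<^sup>2 = p / ((1 - p) * \<eta>)"
    using p_ratio eta p_bounds by (simp add: field_simps)
  then have "- (p * exp (- y) / (1 - p * exp (- y))) / \<eta> = - (\<kappa>\<^sup>2 * tilt p y)"
    using p_bounds by (simp add: tilt_def)
  ultimately show ?thesis by simp
qed

text \<open>The tilt lies between 0 and 1, so the slope is at most \<open>\<kappa>\<^sup>2\<close>
  in absolute value. The linear bound dominates the approximation of indicators by continuous
  functions.\<close>

lemma nb_exponent_bound:
  assumes "y \<ge> 0"
  shows "\<bar>nb_exponent y\<bar> \<le> \<kappa>\<^sup>2 * y"
proof -
  have "norm (nb_exponent y - nb_exponent 0) \<le> \<kappa>\<^sup>2 * norm (y - 0)"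
  proof (rule field_differentiable_bound[where S = "{0..}" and f = nb_exponent and f' = "\<lambda>y. - (\<kappa>\<^sup>2 * tilt p y)"])
    show "(nb_exponent has_field_derivative - (\<kappa>\<^sup>2 * tilt p z)) (at z within {0..})" if "z \<in> {0..}" for z
      using nb_exponent_derivative[of z] that by (auto intro: has_field_derivative_at_within)
    show "norm (- (\<kappa>\<^sup>2 * tilt p z)) \<le> \<kappa>\<^sup>2" if "z \<in> {0..}" for z
      using tilt_bounds[of p z] p_bounds that by (simp add: abs_mult mult_left_le)
  qed (use assms in auto)
  then show ?thesis using assms by (simp add: nb_exponent_0)
qed

lemma nb_exponent_measurable: "nb_exponent \<in> borel_measurable borel"
  unfolding nb_exponent_def[abs_def] by measurable

text \<open>The difference of the logarithmic series at p exp(y) and at \<open>p\<close>. All its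
  terms are nonpositive, so convergence already yields absolute summability.\<close>

lemma integral_zeta_measure:
  assumes y: "y \<le> 0"
  shows "(\<integral>s\<in>{0<..}. (exp (s * y) - 1) \<partial>zeta_measure \<eta> \<kappa>) = nb_exponent (- y)"
proof -
  let ?a = "\<lambda>k::nat. 1 / \<eta> * p ^ k * (1 / real k)"
  let ?g = "\<lambda>n. 1 / \<eta> * p ^ Suc n * (1 / real (Suc n)) * (exp (real (Suc n) * y) - 1)"
  have zlt: "\<bar>p * exp y\<bar> < 1" using nb_denom_pos[of "- y"] y p_bounds by simp
  have s: "?g sums nb_exponent (- y)"
  proof -
    have "(\<lambda>n. ((p * exp y) ^ Suc n / real (Suc n) - p ^ Suc n / real (Suc n)) / \<eta>) sums ((- ln (1 - p * exp y) - - ln (1 - p)) / \<eta>)"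
      using p_bounds by (intro sums_divide sums_diff log_series_sums zlt) auto
    moreover have "((p * exp y) ^ Suc n / real (Suc n) - p ^ Suc n / real (Suc n)) / \<eta> = ?g n" for n
    proof -
      have "(a * b / m - a / m) / \<eta> = 1 / \<eta> * a * (1 / m) * (b - 1)" for a b m :: real
        by (simp add: algebra_simps diff_divide_distrib)
      then show ?thesis by (simp only: power_mult_distrib exp_of_nat_mult)
    qed
    ultimately show ?thesis by (simp add: nb_exponent_def)
  qed
  have neg: "?g n \<le> 0" for n
    using eta p_bounds y by (intro mult_nonneg_nonpos) (auto simp: mult_nonneg_nonpos)
  have summ: "summable (\<lambda>n. norm (?g n))"
    unfolding real_norm_def abs_of_nonpos[OF neg] by (rule sums_summable[OF sums_minus[OF s]])
  have "(\<integral>s\<in>{0<..}. (exp (s * y) - 1) \<partial>zeta_measure \<eta> \<kappa>)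
      = (\<integral>k. ?a k * (indicator {0<..} (real k) *\<^sub>R (exp (real k * y) - 1)) \<partial>count_space {1..})"
    unfolding set_lebesgue_integral_def zeta_measure_def p_def[symmetric]
    using eta p_bounds by (intro integral_dirac_sum) auto
  also have "\<dots> = (\<integral>n. ?a (Suc n) * (indicator {0<..} (real (Suc n)) *\<^sub>R (exp (real (Suc n) * y) - 1)) \<partial>count_space UNIV)"
    by (rule integral_bij_count_space[symmetric]) (rule bij_betw_byWitness[where f' = "\<lambda>k. k - 1"], auto)
  also have "\<dots> = (\<integral>n. ?g n \<partial>count_space UNIV)"
    by (intro Bochner_Integration.integral_cong refl) simp
  also have "\<dots> = nb_exponent (- y)"
    by (rule sums_unique2[OF sums_integral_count_space_nat s]) (use summ in \<open>simp only: integrable_count_space_nat_iff\<close>)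
  finally show ?thesis .
qed

text \<open>The logarithmic series distribution, which is \<open>zeta_measure\<close> normalised.
  The weight at 0 is a division by zero, hence 0.\<close>

definition nb_mark_pmf :: "nat pmf" where
  "nb_mark_pmf = embed_pmf (\<lambda>k. p ^ k / (real k * - ln (1 - p)))"

text \<open>The total mass of \<open>zeta_measure\<close>, by the logarithmic series.\<close>

definition nb_rate :: real where "nb_rate = - ln (1 - p) / \<eta>"

lemma nb_rate_pos: "nb_rate > 0"
  using p_bounds eta by (simp add: nb_rate_def divide_neg_pos)

lemma nb_mark_weights:
  assumes "p * exp y < 1"
  shows "(\<Sum>k. ennreal (p ^ k / (real k * - ln (1 - p)) * exp (real k * y))) = ennreal (ln (1 - p * exp y) / ln (1 - p))"
proof -
  have L: "- ln (1 - p) > 0" using p_bounds by (simp add: ln_less_zero)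
  have "\<bar>p * exp y\<bar> < 1" using assms p_bounds by simp
  from sums_divide[OF log_series_sums[OF this], of "- ln (1 - p)"]
  have "(\<lambda>n. (p * exp y) ^ Suc n / real (Suc n) / - ln (1 - p)) sums (- ln (1 - p * exp y) / - ln (1 - p))" .
  then have s: "(\<lambda>n. (p * exp y) ^ Suc n / real (Suc n) / - ln (1 - p)) sums (ln (1 - p * exp y) / ln (1 - p))"
    by (simp only: minus_divide_divide)
  have eq: "(p * exp y) ^ Suc n / real (Suc n) / - ln (1 - p)
      = p ^ Suc n / (real (Suc n) * - ln (1 - p)) * exp (real (Suc n) * y)" for n
    by (simp add: power_mult_distrib exp_of_nat_mult del: power_Suc of_nat_Suc)
  have s: "(\<lambda>k. p ^ k / (real k * - ln (1 - p)) * exp (real k * y)) sums (ln (1 - p * exp y) / ln (1 - p))"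
    using s unfolding eq by (subst (asm) sums_Suc_iff) simp
  moreover have "p ^ k / (real k * - ln (1 - p)) * exp (real k * y) \<ge> 0" for k
    using L p_bounds by (intro mult_nonneg_nonneg divide_nonneg_nonneg) auto
  ultimately show ?thesis
    by (subst suminf_ennreal2) (auto simp: sums_iff)
qed

lemma pmf_nb_mark: "pmf nb_mark_pmf k = p ^ k / (real k * - ln (1 - p))"
  unfolding nb_mark_pmf_def
proof (rule pmf_embed_pmf)
  have L: "- ln (1 - p) > 0" using p_bounds by (simp add: ln_less_zero)
  show "0 \<le> p ^ k / (real k * - ln (1 - p))" for k
    using L p_bounds by (intro divide_nonneg_nonneg mult_nonneg_nonneg) auto
  show "(\<integral>\<^sup>+k. ennreal (p ^ k / (real k * - ln (1 - p))) \<partial>count_space UNIV) = 1"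
    using nb_mark_weights[of 0] p_bounds L by (simp add: nn_integral_count_space_nat)
qed

lemma nn_integral_nb_mark:
  assumes "p * exp y < 1"
  shows "(\<integral>\<^sup>+k. ennreal (exp (real k * y)) \<partial>measure_pmf nb_mark_pmf) = ennreal (ln (1 - p * exp y) / ln (1 - p))"
proof -
  have "ennreal (p ^ k / (real k * - ln (1 - p))) * ennreal (exp (real k * y))
      = ennreal (p ^ k / (real k * - ln (1 - p)) * exp (real k * y))" for k
    by (rule ennreal_mult''[symmetric]) simp
  then show ?thesis
    unfolding nn_integral_measure_pmf nn_integral_count_space_nat pmf_nb_mark nb_mark_weights[OF assms, symmetric]
    by simp
qed

text \<open>The binomial series with a negative exponent. Admitting all \<open>y\<close> with
  \<open>p * exp y < 1\<close> covers normalisation, the Laplace transform and small positive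
  exponential moments at once.\<close>

lemma nn_integral_neg_binomial:
  assumes v: "v \<ge> 0" and y: "p * exp y < 1"
  shows "(\<integral>\<^sup>+x. ennreal (exp (y * x)) \<partial>neg_binomial_distribution \<eta> \<kappa> v)
    = ennreal ((1 - p) powr (v / \<eta>) * (1 - p * exp y) powr (- (v / \<eta>)))"
proof -
  let ?w = "\<lambda>n::nat. (1 + \<kappa>\<^sup>2 * \<eta>) powr (- v / \<eta>) * (p ^ n * (pochhammer (v / \<eta>) n / fact n))"
  have poch: "pochhammer (v / \<eta>) n \<ge> 0" for n
    using v eta by (cases "v = 0") (auto simp: pochhammer_0_left intro: pochhammer_nonneg less_imp_le)
  have "(1 + \<kappa>\<^sup>2 * \<eta>) powr (- v / \<eta>) = (1 - p) powr (v / \<eta>)"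
    using p_bounds by (simp add: p_inverse powr_divide powr_minus_divide)
  then have w: "?w n * exp (y * real n) = (1 - p) powr (v / \<eta>) * (pochhammer (v / \<eta>) n / fact n * (p * exp y) ^ n)" for n
    by (simp add: power_mult_distrib exp_of_nat_mult[symmetric] mult_ac)
  have "(\<integral>\<^sup>+x. ennreal (exp (y * x)) \<partial>neg_binomial_distribution \<eta> \<kappa> v)
      = (\<integral>\<^sup>+n. ennreal (?w n) * ennreal (exp (y * real n)) \<partial>count_space UNIV)"
    unfolding neg_binomial_distribution_def dirac_sum_def p_def[symmetric]
    by (subst nn_integral_distr) (auto simp: nn_integral_density)
  also have "\<dots> = (\<Sum>n. ennreal (?w n * exp (y * real n)))"
    unfolding nn_integral_count_space_nat by (simp only: ennreal_mult''[OF exp_ge_zero])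
  also have "\<dots> = ennreal ((1 - p) powr (v / \<eta>) * (1 - p * exp y) powr (- (v / \<eta>)))"
  proof -
    have "(\<lambda>n. ?w n * exp (y * real n)) sums ((1 - p) powr (v / \<eta>) * (1 - p * exp y) powr (- (v / \<eta>)))"
      unfolding w using p_bounds y by (intro sums_mult neg_binomial_series_sums) simp
    moreover have "?w n * exp (y * real n) \<ge> 0" for n
      unfolding w using poch p_bounds by (intro mult_nonneg_nonneg divide_nonneg_nonneg) auto
    ultimately show ?thesis by (subst suminf_ennreal2) (auto simp: sums_iff)
  qed
  finally show ?thesis .
qed

lemma sets_neg_binomial: "sets (neg_binomial_distribution \<eta> \<kappa> v) = sets borel"
  by (simp add: neg_binomial_distribution_def sets_dirac_sum)

lemma prob_space_neg_binomial:
  assumes "v \<ge> 0"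
  shows "prob_space (neg_binomial_distribution \<eta> \<kappa> v)"
proof (rule prob_spaceI)
  have "(1 - p) powr (v / \<eta>) * (1 - p) powr (- (v / \<eta>)) = 1"
    using p_bounds by (simp add: powr_add[symmetric])
  then show "emeasure (neg_binomial_distribution \<eta> \<kappa> v) (space (neg_binomial_distribution \<eta> \<kappa> v)) = 1"
    using nn_integral_neg_binomial[OF assms, of 0] p_bounds by simp
qed

lemma neg_binomial_laplace:
  assumes v: "v \<ge> 0" and t: "t \<ge> 0"
  shows "(\<integral>x. exp (- t * x) \<partial>neg_binomial_distribution \<eta> \<kappa> v) = exp (v * nb_exponent t)"
proof -
  have d: "1 - p * exp (- t) > 0" by (rule nb_denom_pos[OF t])
  have "(1 - p) powr (v / \<eta>) * (1 - p * exp (- t)) powr (- (v / \<eta>)) = exp (v * nb_exponent t)"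
    using d p_bounds by (simp add: powr_def nb_exponent_def exp_add[symmetric] algebra_simps diff_divide_distrib)
  then have "(\<integral>\<^sup>+x. ennreal (exp (- t * x)) \<partial>neg_binomial_distribution \<eta> \<kappa> v) = ennreal (exp (v * nb_exponent t))"
    using nn_integral_neg_binomial[OF v, of "- t"] d by simp
  then show ?thesis
    using sets_neg_binomial by (subst integral_eq_nn_integral) (auto cong: measurable_cong_sets)
qed

lemma neg_binomial_exponential_moment:
  assumes v: "v \<ge> 0" and y: "p * exp y < 1"
  shows "integrable (neg_binomial_distribution \<eta> \<kappa> v) (\<lambda>x. exp (y * x))"
  using nn_integral_neg_binomial[OF assms] sets_neg_binomial
  by (intro integrableI_nonneg) (auto cong: measurable_cong_sets)

lemma AE_neg_binomial_nat:
  assumes v: "v \<ge> 0"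
  shows "AE x in neg_binomial_distribution \<eta> \<kappa> v. x \<in> \<nat>"
proof -
  have "(\<nat> :: real set) \<in> sets borel" by (rule borel_closed) simp
  then show ?thesis
    unfolding neg_binomial_distribution_def dirac_sum_def by (subst AE_distr_iff) (auto simp: Collect_mem_eq)
qed

lemma neg_binomial_nonneg:
  assumes v: "v \<ge> 0"
  shows "AE x in neg_binomial_distribution \<eta> \<kappa> v. x \<ge> 0"
  using AE_neg_binomial_nat[OF v] by eventually_elim (auto simp: Nats_def)

end

subsection \<open>Integer-valued Radon measures\<close>

lemma radon_bounded_finite:
  assumes \<mu>: "\<mu> \<in> radon_measures" and A: "bounded A"
  shows "emeasure \<mu> A < \<infinity>"
proof -
  have "emeasure \<mu> A \<le> emeasure \<mu> (closure A)"
    using \<mu> by (intro emeasure_mono closure_subset) (auto simp: radon_measures_def)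
  also have "\<dots> < \<infinity>"
    using \<mu> A by (auto simp: radon_measures_def)
  finally show ?thesis .
qed

text \<open>Integer masses on shrinking neighbourhoods stabilise, so each point has a basic
  neighbourhood of the same mass as the point itself. Hence there are countably many atoms, and the
  rest is covered by countably many null sets of the basis.\<close>

lemma dirac_sum_of_integer_valued:
  fixes \<mu> :: "'a::euclidean_space measure"
  assumes \<mu>: "\<mu> \<in> radon_measures" and B: "countable B" "topological_basis B"
    and int: "\<And>U. U \<in> B \<Longrightarrow> bounded U \<Longrightarrow> measure \<mu> U \<in> \<nat>"
  shows "\<exists>(I::nat set) (s::nat \<Rightarrow> nat) x. \<mu> = dirac_sum I (\<lambda>i. real (s i)) x"
proof -
  have sets: "sets \<mu> = sets borel" using \<mu> by (simp add: radon_measures_def)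
  then have space: "space \<mu> = UNIV" using sets_eq_imp_space_eq by fastforce
  have fin: "emeasure \<mu> U < \<infinity>" if "bounded U" for U
    using radon_bounded_finite[OF \<mu> that] .
  have fm: "U \<in> fmeasurable \<mu>" if "bounded U" "U \<in> sets borel" for U
    using fin[OF that(1)] that(2) sets by (auto simp: fmeasurable_def)
  have Bo: "open U" if "U \<in> B" for U using topological_basis_open[OF B(2) that] .
  have atom: "measure \<mu> {x} \<in> \<nat> \<and> (\<exists>U\<in>B. x \<in> U \<and> bounded U \<and> measure \<mu> U = measure \<mu> {x})" for x
  proof -
    have "\<exists>U\<in>B. x \<in> U \<and> U \<subseteq> ball x (1 / real (Suc n))" for n
    proof -
      have "x \<in> ball x (1 / real (Suc n))" by simp
      then show ?thesis by (rule topological_basisE[OF B(2) open_ball]) blast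
    qed
    then obtain U where U: "\<And>n. U n \<in> B" "\<And>n. x \<in> U n" "\<And>n. U n \<subseteq> ball x (1 / real (Suc n))" by metis
    have bU: "bounded (U n)" for n using U(3) bounded_ball bounded_subset by blast
    have "(\<lambda>n. measure \<mu> (ball x (1 / real (Suc n)))) \<longlonglongrightarrow> measure \<mu> (\<Inter>n. ball x (1 / real (Suc n)))"
    proof (rule Lim_measure_decseq)
      show "decseq (\<lambda>n. ball x (1 / real (Suc n)))"
        unfolding decseq_def by (intro allI impI subset_ball) (simp add: frac_le)
      show "emeasure \<mu> (ball x (1 / real (Suc n))) \<noteq> \<infinity>" for n
        using fin[OF bounded_ball, of x "1 / real (Suc n)"] by simp
    qed (simp add: sets image_subset_iff)
    moreover have "(\<Inter>n. ball x (1 / real (Suc n))) = {x}"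
    proof (intro equalityI subsetI)
      fix y assume "y \<in> (\<Inter>n. ball x (1 / real (Suc n)))"
      then have "dist x y \<le> 1 / real (Suc n)" for n by (auto intro: less_imp_le)
      then have "dist x y \<le> 0"
        using LIMSEQ_le_const[OF LIMSEQ_inverse_real_of_nat, of "dist x y"] by (auto simp: inverse_eq_divide)
      then show "y \<in> {x}" by simp
    qed auto
    ultimately have lim: "(\<lambda>n. measure \<mu> (ball x (1 / real (Suc n)))) \<longlonglongrightarrow> measure \<mu> {x}" by simp
    have le: "measure \<mu> {x} \<le> measure \<mu> (U n)" "measure \<mu> (U n) \<le> measure \<mu> (ball x (1 / real (Suc n)))" for n
      using U[of n] Bo[OF U(1)[of n]] bU[of n] sets by (auto intro!: measure_mono_fmeasurable fm)
    have lim': "(\<lambda>n. measure \<mu> (U n)) \<longlonglongrightarrow> measure \<mu> {x}"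
      by (rule tendsto_sandwich[OF _ _ tendsto_const lim]) (use le in auto)
    have nat: "measure \<mu> {x} \<in> \<nat>"
      by (rule closed_sequentially[OF _ _ lim']) (use int U(1) bU in auto)
    obtain n where n: "measure \<mu> (U n) < measure \<mu> {x} + 1"
      using order_tendstoD(2)[OF lim', of "measure \<mu> {x} + 1"] by (auto simp: eventually_sequentially)
    \<comment> \<open>Two natural numbers, the second at most the first, that differ by less than
      1.\<close>
    have "measure \<mu> (U n) = measure \<mu> {x}"
      using nat int[OF U(1)[of n] bU[of n]] le(1)[of n] n by (auto elim!: Nats_cases)
    with nat U(1,2)[of n] bU[of n] show ?thesis by blast
  qed
  then obtain N where N: "\<And>x. N x \<in> B" "\<And>x. x \<in> N x" "\<And>x. bounded (N x)" "\<And>x. measure \<mu> (N x) = measure \<mu> {x}"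
    by metis
  define D where "D = {x. measure \<mu> {x} \<noteq> 0}"
  \<comment> \<open>Two atoms sharing a neighbourhood would give it at least the sum of their
    masses. Injectivity into the countable basis makes the set of atoms countable.\<close>
  have "inj_on N D"
  proof (rule inj_onI, rule ccontr)
    fix x y assume D: "x \<in> D" "y \<in> D" and eq: "N x = N y" and ne: "x \<noteq> y"
    have "measure \<mu> {x, y} = measure \<mu> {x} + measure \<mu> {y}"
      using ne fm[of "{x}"] fm[of "{y}"] by (subst insert_is_Un, subst measure_Un_AE) (auto simp: fmeasurable_def)
    moreover have "measure \<mu> {x, y} \<le> measure \<mu> (N x)"
      using N(2)[of x] N(2)[of y] eq N(3)[of x] Bo[OF N(1)[of x]] sets by (intro measure_mono_fmeasurable fm) auto
    ultimately have "measure \<mu> {y} \<le> 0" using N(4) by simp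
    with D show False by (simp add: D_def measure_le_0_iff)
  qed
  moreover have "countable (N ` D)" using N(1) by (intro countable_subset[OF _ B(1)]) auto
  ultimately have D: "countable D" by (rule countable_image_inj_on[rotated])
  have "(\<Union>U\<in>{U\<in>B. bounded U \<and> measure \<mu> U = 0}. U) \<in> null_sets \<mu>"
  proof (rule null_sets_UN')
    show "countable {U\<in>B. bounded U \<and> measure \<mu> U = 0}" using B(1) by simp
    fix U assume U: "U \<in> {U\<in>B. bounded U \<and> measure \<mu> U = 0}"
    then show "U \<in> null_sets \<mu>"
      using fin[of U] Bo[of U] sets by (intro null_setsI) (auto simp: emeasure_eq_ennreal_measure less_top)
  qed
  then have V: "emeasure \<mu> (\<Union>U\<in>{U\<in>B. bounded U \<and> measure \<mu> U = 0}. U) = 0"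
    by (rule null_setsD1)
  \<comment> \<open>A point that is not an atom has a basic neighbourhood of mass 0.\<close>
  have sub: "- D \<subseteq> (\<Union>U\<in>{U\<in>B. bounded U \<and> measure \<mu> U = 0}. U)"
    using N by (fastforce simp: D_def)
  have "(\<Union>U\<in>{U\<in>B. bounded U \<and> measure \<mu> U = 0}. U) \<in> sets \<mu>"
    using Bo sets by (auto intro!: borel_open)
  from emeasure_mono[OF sub this] have null: "emeasure \<mu> (- D) = 0"
    unfolding V by simp
  have Dsets: "D \<in> sets borel" using D by (rule sets.countable[rotated]) auto
  have singleton: "emeasure \<mu> {x} = ennreal (real (nat \<lfloor>measure \<mu> {x}\<rfloor>))" for x
  proof -
    obtain k :: nat where "measure \<mu> {x} = real k" using atom[of x] by (blast elim: Nats_cases)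
    then have "real (nat \<lfloor>measure \<mu> {x}\<rfloor>) = measure \<mu> {x}" by simp
    moreover have "emeasure \<mu> {x} = ennreal (measure \<mu> {x})"
      using fin[of "{x}"] by (simp add: emeasure_eq_ennreal_measure less_top)
    ultimately show ?thesis by (simp only:)
  qed
  let ?I = "to_nat_on D ` D" and ?x = "from_nat_into D"
  have bij: "bij_betw ?x ?I D"
    by (rule bij_betw_byWitness[where f' = "to_nat_on D"]) (use D in auto)
  have "\<mu> = dirac_sum ?I (\<lambda>i. real (nat \<lfloor>measure \<mu> {?x i}\<rfloor>)) ?x"
  proof (rule measure_eqI)
    fix A assume "A \<in> sets \<mu>"
    then have A: "A \<in> sets borel" using sets by simp
    have "emeasure \<mu> A = emeasure \<mu> (A \<inter> D) + emeasure \<mu> (A \<inter> - D)"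
      using A Dsets sets by (subst plus_emeasure) (auto intro!: arg_cong[where f = "emeasure \<mu>"])
    also have "emeasure \<mu> (A \<inter> - D) = 0"
      using null emeasure_mono[of "A \<inter> - D" "- D" \<mu>] Dsets sets by auto
    also have "emeasure \<mu> (A \<inter> D) = (\<integral>\<^sup>+x. emeasure \<mu> {x} \<partial>count_space (A \<inter> D))"
      using D sets by (intro emeasure_countable_singleton) auto
    also have "\<dots> = (\<integral>\<^sup>+x. emeasure \<mu> {x} * indicator A x \<partial>count_space D)"
      by (simp add: nn_integral_count_space_indicator indicator_inter_arith mult_ac)
    also have "\<dots> = (\<integral>\<^sup>+i. emeasure \<mu> {?x i} * indicator A (?x i) \<partial>count_space ?I)"
      by (rule nn_integral_bij_count_space[OF bij, symmetric])
    also have "\<dots> = emeasure (dirac_sum ?I (\<lambda>i. real (nat \<lfloor>measure \<mu> {?x i}\<rfloor>)) ?x) A"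
      unfolding emeasure_dirac_sum[OF A] singleton ..
    finally show "emeasure \<mu> A = emeasure (dirac_sum ?I (\<lambda>i. real (nat \<lfloor>measure \<mu> {?x i}\<rfloor>)) ?x) A" by simp
  qed (simp add: sets dirac_sum_def)
  then show ?thesis by (intro exI)
qed

subsection \<open>Poisson and negative binomial processes\<close>

lemma openin_vague_subset: "openin (vague_topology :: 'a::euclidean_space measure topology) V \<Longrightarrow> V \<subseteq> radon_measures"
proof -
  have "topspace vague_topology \<subseteq> (radon_measures :: 'a measure set)"
    unfolding vague_topology_def topology_generated_by_topspace by blast
  then show "openin vague_topology V \<Longrightarrow> V \<subseteq> radon_measures"
    using openin_subset by blast
qed

lemma space_vague_borel: "space (vague_borel :: 'a::euclidean_space measure measure) = radon_measures"
  unfolding vague_borel_def by (rule space_measure_of_conv)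

lemma random_measure_radon: "random_measure P \<gamma> \<Longrightarrow> \<omega> \<in> space P \<Longrightarrow> \<gamma> \<omega> \<in> radon_measures"
  using measurable_space[of \<gamma> P vague_borel \<omega>] by (simp add: random_measure_def space_vague_borel)

lemma random_measure_integral_measurable:
  assumes rm: "random_measure P \<gamma>" and f: "f \<in> C_0"
  shows "(\<lambda>\<omega>. \<integral>x. f x \<partial>\<gamma> \<omega>) \<in> borel_measurable P"
proof (rule borel_measurableI)
  fix U :: "real set" assume U: "open U"
  let ?V = "{\<mu> \<in> radon_measures. (\<integral>x. f x \<partial>\<mu>) \<in> U}"
  have "openin vague_topology ?V"
    unfolding vague_topology_def by (rule topology_generated_by_Basis) (use f U in blast)
  then have V: "?V \<in> sets vague_borel"
    unfolding vague_borel_def using openin_vague_subset by (subst sets_measure_of) auto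
  have "\<gamma> \<in> P \<rightarrow>\<^sub>M vague_borel" using rm by (simp add: random_measure_def)
  from measurable_sets[OF this V] have "\<gamma> -` ?V \<inter> space P \<in> sets P" .
  moreover have "\<gamma> -` ?V \<inter> space P = (\<lambda>\<omega>. \<integral>x. f x \<partial>\<gamma> \<omega>) -` U \<inter> space P"
    using random_measure_radon[OF rm] by auto
  ultimately show "(\<lambda>\<omega>. \<integral>x. f x \<partial>\<gamma> \<omega>) -` U \<inter> space P \<in> sets P" by simp
qed

lemma random_measure_linear_statistics:
  assumes rm: "random_measure P \<gamma>"
    and em: "\<And>f. f \<in> C_0 \<Longrightarrow> (\<And>x. f x \<ge> 0) \<Longrightarrow> \<exists>\<epsilon>>0. integrable P (\<lambda>\<omega>. exp (\<epsilon> * (\<integral>x. f x \<partial>\<gamma> \<omega>)))"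
  shows "linear_statistics P (\<lambda>f \<omega>. \<integral>x. f x \<partial>\<gamma> \<omega>)"
proof -
  interpret prob_space P using rm by (simp add: random_measure_def)
  note int = C_0_integrable_radon[OF _ random_measure_radon[OF rm]]
  show ?thesis
  proof
    show "(\<lambda>\<omega>. \<integral>x. f x \<partial>\<gamma> \<omega>) \<in> borel_measurable P" if "f \<in> C_0" for f
      by (rule random_measure_integral_measurable[OF rm that])
    show "(\<integral>x. f x + g x \<partial>\<gamma> \<omega>) = (\<integral>x. f x \<partial>\<gamma> \<omega>) + (\<integral>x. g x \<partial>\<gamma> \<omega>)"
      if "f \<in> C_0" "g \<in> C_0" "\<omega> \<in> space P" for f g \<omega>
      using int that by (intro Bochner_Integration.integral_add) auto
    show "\<exists>\<epsilon>>0. integrable P (\<lambda>\<omega>. exp (\<epsilon> * (\<integral>x. f x \<partial>\<gamma> \<omega>)))" if "f \<in> C_0" "\<And>x. f x \<ge> 0" for f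
      by (rule em[OF that])
  qed simp_all
qed

lemma C_0_support:
  assumes "f \<in> C_0"
  obtains K :: nat where "\<And>x. norm x \<ge> real K \<Longrightarrow> f x = 0"
proof -
  obtain r where r: "{x. f x \<noteq> 0} \<subseteq> ball 0 r" using assms bounded_subset_ballD unfolding C_0_iff by blast
  have "f x = 0" if "norm x \<ge> real (nat \<lceil>r\<rceil>)" for x
    using r that real_nat_ceiling_ge[of r] by force
  then show thesis using that by blast
qed

lemma poisson_moments:
  fixes \<gamma> :: "'w \<Rightarrow> 'a::euclidean_space measure"
  assumes kappa: "\<kappa> > 0" and P: "poisson_point_process (\<kappa>\<^sup>2) P \<gamma>" and fs: "fs \<in> lists test_functions"
  shows "integrable P (\<lambda>\<omega>. \<Prod>f\<leftarrow>fs. \<integral>x. f x \<partial>\<gamma> \<omega>) \<and>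
    tau (rho_prod 0 \<kappa> fs) = (\<integral>\<omega>. (\<Prod>f\<leftarrow>fs. \<integral>x. f x \<partial>\<gamma> \<omega>) \<partial>P)"
proof -
  have rm: "random_measure P \<gamma>"
    and laplace: "\<And>f. f \<in> C_0 \<Longrightarrow> (\<integral>\<omega>. exp (\<integral>x. f x \<partial>\<gamma> \<omega>) \<partial>P) = exp (\<integral>x. (exp (f x) - 1) * \<kappa>\<^sup>2 \<partial>lborel)"
    using P by (auto simp: poisson_point_process_def point_process_def)
  interpret linear_statistics P "\<lambda>f \<omega>. \<integral>x. f x \<partial>\<gamma> \<omega>"
  proof (rule random_measure_linear_statistics[OF rm])
    fix f :: "'a \<Rightarrow> real" assume f: "f \<in> C_0"
    \<comment> \<open>The Poisson formula holds for signed \<open>f\<close>; its right-hand side is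
      positive, whereas a non-integrable exponential would have integral 0.\<close>
    have "integrable P (\<lambda>\<omega>. exp (\<integral>x. f x \<partial>\<gamma> \<omega>))"
    proof (rule ccontr)
      assume "\<not> integrable P (\<lambda>\<omega>. exp (\<integral>x. f x \<partial>\<gamma> \<omega>))"
      from not_integrable_integral_eq[OF this] laplace[OF f] show False by simp
    qed
    then show "\<exists>\<epsilon>>0. integrable P (\<lambda>\<omega>. exp (\<epsilon> * (\<integral>x. f x \<partial>\<gamma> \<omega>)))" by (intro exI[of _ 1]) simp
  qed
  \<comment> \<open>With \<open>p = 0\<close> the tilt is \<open>exp (- y)\<close>, and the Riccati
    equation becomes linear.\<close>
  interpret tilted_statistics P "\<lambda>f \<omega>. \<integral>x. f x \<partial>\<gamma> \<omega>" 0 \<kappa> 0 "\<lambda>y. \<kappa>\<^sup>2 * (exp (- y) - 1)"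
  proof
    show "((\<lambda>y. \<kappa>\<^sup>2 * (exp (- y) - 1)) has_real_derivative - (\<kappa>\<^sup>2 * tilt 0 y)) (at y)" for y
      by (auto intro!: derivative_eq_intros simp: tilt_def)
    show "(\<integral>\<omega>. exp (- (\<integral>x. h x \<partial>\<gamma> \<omega>)) \<partial>P) = exp (\<integral>x. \<kappa>\<^sup>2 * (exp (- h x) - 1) \<partial>lborel)" if "h \<in> C_0" for h
      using laplace[OF C_0_uminus[OF that]] by (simp add: mult.commute)
  qed simp_all
  show ?thesis using moments_eq_tau[OF kappa _ fs] kappa by simp
qed

lemma
  assumes "compound_poisson lam \<sigma> P"
  shows compound_poisson_random_measure: "random_measure P (\<lambda>\<mu>. \<mu>)"
    and compound_poisson_AE: "AE \<mu> in P. \<exists>(I::nat set) (s::nat \<Rightarrow> nat) x. \<mu> = dirac_sum I (\<lambda>i. real (s i)) x"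
    and compound_poisson_measurable: "f \<in> borel_measurable borel \<Longrightarrow> (\<And>x. norm x \<ge> real K \<Longrightarrow> f x = 0) \<Longrightarrow>
      (\<lambda>\<mu>. \<integral>x. f x \<partial>\<mu> :: real) \<in> borel_measurable P"
    and compound_poisson_laplace: "f \<in> borel_measurable borel \<Longrightarrow> (\<And>x. norm x \<ge> real K \<Longrightarrow> f x = 0) \<Longrightarrow>
       T \<in> borel_measurable borel \<Longrightarrow> (\<And>x. 0 \<le> T x \<and> T x \<le> B) \<Longrightarrow>
       (\<And>x. (\<integral>\<^sup>+s. ennreal (exp (real s * f x)) \<partial>measure_pmf \<sigma>) = ennreal (T x)) \<Longrightarrow>
       (\<integral>\<^sup>+\<mu>. ennreal (exp (\<integral>x. f x \<partial>\<mu>)) \<partial>P) = ennreal (exp (lam * (\<integral>x. T x - 1 \<partial>lborel)))"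
proof -
  note * = assms[unfolded compound_poisson_def]
  show "random_measure P (\<lambda>\<mu>. \<mu>)" "AE \<mu> in P. \<exists>(I::nat set) (s::nat \<Rightarrow> nat) x. \<mu> = dirac_sum I (\<lambda>i. real (s i)) x"
    using * by (iprover dest: conjunct1 conjunct2)+
  show "f \<in> borel_measurable borel \<Longrightarrow> (\<And>x. norm x \<ge> real K \<Longrightarrow> f x = 0) \<Longrightarrow>
      (\<lambda>\<mu>. \<integral>x. f x \<partial>\<mu> :: real) \<in> borel_measurable P"
    using *[THEN conjunct2, THEN conjunct2, THEN conjunct1, rule_format, of f K] by blast
  show "f \<in> borel_measurable borel \<Longrightarrow> (\<And>x. norm x \<ge> real K \<Longrightarrow> f x = 0) \<Longrightarrow>
       T \<in> borel_measurable borel \<Longrightarrow> (\<And>x. 0 \<le> T x \<and> T x \<le> B) \<Longrightarrow>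
       (\<And>x. (\<integral>\<^sup>+s. ennreal (exp (real s * f x)) \<partial>measure_pmf \<sigma>) = ennreal (T x)) \<Longrightarrow>
       (\<integral>\<^sup>+\<mu>. ennreal (exp (\<integral>x. f x \<partial>\<mu>)) \<partial>P) = ennreal (exp (lam * (\<integral>x. T x - 1 \<partial>lborel)))"
    using *[THEN conjunct2, THEN conjunct2, THEN conjunct2, rule_format, of f K T B] by blast
qed

lemma poisson_point_process_exists:
  assumes kappa: "\<kappa> > 0"
  shows "\<exists>P :: 'a::euclidean_space measure measure. poisson_point_process (\<kappa>\<^sup>2) P (\<lambda>\<mu>. \<mu>)"
proof -
  have "\<kappa>\<^sup>2 > 0" using kappa by simp
  \<comment> \<open>A Poisson process is the compound Poisson process in which every mark is
    1.\<close>
  then obtain P :: "'a measure measure" where CP: "compound_poisson (\<kappa>\<^sup>2) (return_pmf 1) P"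
    using compound_poisson_exists by blast
  note P = compound_poisson_random_measure[OF CP] compound_poisson_AE[OF CP]
  have "(\<integral>\<mu>. exp (\<integral>x. f x \<partial>\<mu>) \<partial>P) = exp (\<integral>x. (exp (f x) - 1) * \<kappa>\<^sup>2 \<partial>lborel)" if f: "f \<in> C_0" for f :: "'a \<Rightarrow> real"
  proof -
    obtain K where K: "\<And>x. norm x \<ge> real K \<Longrightarrow> f x = 0" using C_0_support[OF f] by blast
    obtain C where C: "\<And>x. \<bar>f x\<bar> \<le> C" using C_0_bounded[OF f] by blast
    have [measurable]: "f \<in> borel_measurable borel" by (rule C_0_borel_measurable[OF f])
    have "f x \<le> C" for x using C[of x] by linarith
    then have "(\<integral>\<^sup>+\<mu>. ennreal (exp (\<integral>x. f x \<partial>\<mu>)) \<partial>P) = ennreal (exp (\<kappa>\<^sup>2 * (\<integral>x. exp (f x) - 1 \<partial>lborel)))"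
      by (intro compound_poisson_laplace[OF CP, where K = K and B = "exp C"]) (auto simp: K)
    then show ?thesis
      using random_measure_integral_measurable[OF P(1) f] by (subst integral_eq_nn_integral) (auto simp: mult.commute)
  qed
  then have "poisson_point_process (\<kappa>\<^sup>2) P (\<lambda>\<mu>. \<mu>)"
    using P by (simp add: poisson_point_process_def point_process_def)
  then show ?thesis ..
qed

section \<open>Existence of the negative binomial process\<close>

lemma integral_indicator_radon:
  assumes "\<mu> \<in> radon_measures" "A \<in> sets borel"
  shows "(\<integral>x. indicator A x \<partial>\<mu>) = measure \<mu> A"
proof -
  have "sets \<mu> = sets borel" using assms by (simp add: radon_measures_def)
  then show ?thesis using sets_eq_imp_space_eq[of \<mu> borel] by simp
qed

lemma integral_indicator_sum:
  fixes c :: "nat \<Rightarrow> real"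
  assumes "\<And>i. i < n \<Longrightarrow> integrable M (\<lambda>x. indicator (A i) x :: real)"
  shows "(\<integral>x. (\<Sum>i<n. c i * indicator (A i) x) \<partial>M) = (\<Sum>i<n. c i * (\<integral>x. indicator (A i) x \<partial>M))"
proof -
  have "(\<integral>x. (\<Sum>i<n. c i * indicator (A i) x) \<partial>M) = (\<Sum>i<n. \<integral>x. c i * indicator (A i) x \<partial>M)"
    using assms by (intro Bochner_Integration.integral_sum integrable_mult_right) (simp only: lessThan_iff)
  then show ?thesis by (simp only: integral_mult_right_zero)
qed

context
  fixes \<eta> \<kappa> p :: real
  assumes nb: "\<eta> > 0" "\<kappa> > 0" "p = \<eta> / (\<eta> + 1 / \<kappa>\<^sup>2)"
begin

abbreviation (input) nb_exp :: "real \<Rightarrow> real" where "nb_exp \<equiv> nb_exponent \<eta> p"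

text \<open>Compound Poisson with the mass of \<open>zeta_measure\<close> as rate and its
  normalisation as mark law. Because the Laplace formula covers Borel functions, step functions give
  the joint Laplace transform of masses, from which independence and equality of laws
  follow.\<close>

lemma negative_binomial_process_exists:
  "\<exists>P :: 'a::euclidean_space measure measure. negative_binomial_process \<eta> \<kappa> P (\<lambda>\<mu>. \<mu>)"
proof -
  obtain P :: "'a measure measure" where CP: "compound_poisson (nb_rate \<eta> p) (nb_mark_pmf p) P"
    using compound_poisson_exists[OF nb_rate_pos[OF nb]] by blast
  note P = compound_poisson_random_measure[OF CP]
  interpret prob_space P using P by (simp add: random_measure_def)
  have radon: "\<mu> \<in> radon_measures" if "\<mu> \<in> space P" for \<mu>
    using random_measure_radon[OF P that] .
  have lap: "expectation (\<lambda>\<mu>. exp (\<integral>x. f x \<partial>\<mu>)) = exp (\<integral>x. nb_exp (- f x) \<partial>lborel)"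
    if f [measurable]: "f \<in> borel_measurable borel" and f_neg: "\<And>x. f x \<le> 0" and K: "\<And>x. norm x \<ge> real K \<Longrightarrow> f x = 0"
    for f :: "'a \<Rightarrow> real" and K
  proof -
    define T where "T x = ln (1 - p * exp (f x)) / ln (1 - p)" for x
    have L: "ln (1 - p) < 0" using p_bounds[OF nb] by simp
    have b: "1 - p \<le> 1 - p * exp (f x)" "1 - p * exp (f x) < 1" for x
      using f_neg[of x] p_bounds[OF nb] by auto
    have "ln (1 - p) \<le> ln (1 - p * exp (f x))" "ln (1 - p * exp (f x)) \<le> 0" for x
    proof -
      have pos: "0 < 1 - p * exp (f x)" using b[of x] p_bounds[OF nb] by linarith
      show "ln (1 - p) \<le> ln (1 - p * exp (f x))"
        using b(1)[of x] p_bounds[OF nb] pos by simp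
      show "ln (1 - p * exp (f x)) \<le> 0"
        using b(2)[of x] by (simp add: ln_le_zero_iff[OF pos])
    qed
    then have T01: "0 \<le> T x \<and> T x \<le> 1" for x
      using L by (auto simp: T_def field_simps zero_le_divide_iff)
    have "(\<integral>\<^sup>+\<mu>. ennreal (exp (\<integral>x. f x \<partial>\<mu>)) \<partial>P) = ennreal (exp (nb_rate \<eta> p * (\<integral>x. T x - 1 \<partial>lborel)))"
    proof (rule compound_poisson_laplace[OF CP f K _ T01])
      show "T \<in> borel_measurable borel" unfolding T_def by measurable
      show "(\<integral>\<^sup>+s. ennreal (exp (real s * f x)) \<partial>measure_pmf (nb_mark_pmf p)) = ennreal (T x)" for x
        unfolding T_def using b(1)[of x] p_bounds[OF nb] by (intro nn_integral_nb_mark[OF nb]) linarith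
    qed auto
    also have "nb_rate \<eta> p * (\<integral>x. T x - 1 \<partial>lborel) = (\<integral>x. nb_exp (- f x) \<partial>lborel)"
      unfolding integral_mult_right_zero[symmetric]
    proof (intro Bochner_Integration.integral_cong refl)
      fix x show "nb_rate \<eta> p * (T x - 1) = nb_exp (- f x)"
        using L nb(1) by (simp add: nb_rate_def[OF nb] nb_exponent_def[OF nb] T_def field_simps)
    qed
    finally have "(\<integral>\<^sup>+\<mu>. ennreal (exp (\<integral>x. f x \<partial>\<mu>)) \<partial>P) = ennreal (exp (\<integral>x. nb_exp (- f x) \<partial>lborel))" .
    then show ?thesis
      using compound_poisson_measurable[OF CP f K] by (subst integral_eq_nn_integral) auto
  qed
  have mass_meas: "(\<lambda>\<mu>. measure \<mu> A) \<in> borel_measurable P" if A: "A \<in> sets borel" "bounded A" for A :: "'a set"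
  proof -
    obtain r where r: "A \<subseteq> ball 0 r" using bounded_subset_ballD[OF A(2)] by blast
    have "(\<lambda>\<mu>. \<integral>x. (indicator A x :: real) \<partial>\<mu>) \<in> borel_measurable P"
      using r real_nat_ceiling_ge[of r] A(1) by (intro compound_poisson_measurable[OF CP, where K = "nat \<lceil>r\<rceil>"]) (force simp: indicator_def)+
    then show ?thesis
      using integral_indicator_radon[OF radon A(1)] by (simp cong: measurable_cong)
  qed
  have joint: "expectation (\<lambda>\<mu>. \<Prod>i<n. exp (- t i * measure \<mu> (A i))) = (\<Prod>i<n. exp (nb_exp (t i) * measure lborel (A i)))"
    if A: "\<And>i. i < n \<Longrightarrow> A i \<in> sets borel" "\<And>i. i < n \<Longrightarrow> bounded (A i)" and disj: "disjoint_family_on A {..<n}"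
      and t: "\<And>i. t i \<ge> 0" for n :: nat and A :: "nat \<Rightarrow> 'a set" and t :: "nat \<Rightarrow> real"
  proof -
    \<comment> \<open>A step function with value \<open>- t i\<close> on \<open>A i\<close>.
      Disjointness and \<open>nb_exp 0 = 0\<close> let the exponent split into a sum over the
      sets.\<close>
    define f where "f x = - (\<Sum>i<n. t i * indicator (A i) x)" for x
    have "bounded (\<Union>i\<in>{..<n}. A i)" using A(2) by (intro bounded_UN) auto
    then obtain r where r: "(\<Union>i\<in>{..<n}. A i) \<subseteq> ball 0 r" using bounded_subset_ballD by blast
    have f0: "f x = 0" if "norm x \<ge> real (nat \<lceil>r\<rceil>)" for x
    proof -
      have "x \<notin> A i" if "i < n" for i
        using r that \<open>norm x \<ge> _\<close> real_nat_ceiling_ge[of r] by force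
      then show ?thesis by (simp add: f_def)
    qed
    have f_meas: "f \<in> borel_measurable borel"
      unfolding f_def using A(1) by (intro borel_measurable_uminus borel_measurable_sum borel_measurable_times) auto
    have f_neg: "f x \<le> 0" for x
      using t by (auto simp: f_def intro!: sum_nonneg)
    have "expectation (\<lambda>\<mu>. \<Prod>i<n. exp (- t i * measure \<mu> (A i))) = expectation (\<lambda>\<mu>. exp (\<integral>x. f x \<partial>\<mu>))"
    proof (intro Bochner_Integration.integral_cong refl)
      fix \<mu> assume "\<mu> \<in> space P"
      then have r: "\<mu> \<in> radon_measures" by (rule radon)
      have int: "integrable \<mu> (\<lambda>x. indicator (A i) x :: real)" if "i < n" for i
        using radon_bounded_finite[OF r A(2)[OF that]] A(1)[OF that] r by (auto simp: radon_measures_def)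
      have "(\<integral>x. f x \<partial>\<mu>) = - (\<Sum>i<n. t i * (\<integral>x. indicator (A i) x \<partial>\<mu>))"
        unfolding f_def Bochner_Integration.integral_minus by (rule arg_cong[where f = uminus], rule integral_indicator_sum) (rule int)
      also have "\<dots> = (\<Sum>i<n. - t i * measure \<mu> (A i))"
        unfolding sum_negf[symmetric] by (intro sum.cong refl) (simp only: integral_indicator_radon[OF r A(1)] lessThan_iff mult_minus_left)
      finally have "(\<integral>x. f x \<partial>\<mu>) = (\<Sum>i<n. - t i * measure \<mu> (A i))" .
      then show "(\<Prod>i<n. exp (- t i * measure \<mu> (A i))) = exp (\<integral>x. f x \<partial>\<mu>)"
        by (simp add: exp_sum)
    qed
    also have "\<dots> = exp (\<integral>x. nb_exp (- f x) \<partial>lborel)"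
      by (rule lap[OF f_meas f_neg f0])
    also have "(\<integral>x. nb_exp (- f x) \<partial>lborel) = (\<integral>x. (\<Sum>i<n. nb_exp (t i) * indicator (A i) x) \<partial>lborel)"
    proof (intro Bochner_Integration.integral_cong refl)
      fix x
      show "nb_exp (- f x) = (\<Sum>i<n. nb_exp (t i) * indicator (A i) x)"
      proof (cases "\<exists>i<n. x \<in> A i")
        case True
        then obtain i where i: "i < n" "x \<in> A i" by blast
        then have ind: "indicator (A j) x = (if j = i then 1 else 0 :: real)" if "j < n" for j
          using disj that by (auto simp: disjoint_family_on_def indicator_def)
        have "(\<Sum>j<n. c j * indicator (A j) x) = c i" for c :: "nat \<Rightarrow> real"
        proof -
          have "(\<Sum>j<n. c j * indicator (A j) x) = (\<Sum>j<n. if j = i then c j else 0)"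
            by (intro sum.cong) (auto simp: ind)
          then show ?thesis using i by simp
        qed
        note c = this
        show ?thesis unfolding f_def c minus_minus ..
      next
        case False
        then show ?thesis by (simp add: f_def nb_exponent_0[OF nb])
      qed
    qed
    also have "\<dots> = (\<Sum>i<n. nb_exp (t i) * measure lborel (A i))"
    proof -
      have int: "integrable lborel (\<lambda>x. indicator (A i) x :: real)" if "i < n" for i
        using emeasure_bounded_finite[OF A(2)[OF that]] A(1)[OF that] by auto
      have "(\<integral>x. (\<Sum>i<n. nb_exp (t i) * indicator (A i) x) \<partial>lborel) = (\<Sum>i<n. nb_exp (t i) * (\<integral>x. indicator (A i) x \<partial>lborel))"
        by (rule integral_indicator_sum) (rule int)
      also have "\<dots> = (\<Sum>i<n. nb_exp (t i) * measure lborel (A i))"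
        by (intro sum.cong refl) (simp add: A(1))
      finally show ?thesis .
    qed
    finally show ?thesis by (simp add: exp_sum)
  qed
  have single: "expectation (\<lambda>\<mu>. exp (- t * measure \<mu> A)) = exp (nb_exp t * measure lborel A)"
    if "A \<in> sets borel" "bounded A" "t \<ge> 0" for A :: "'a set" and t
    using joint[of 1 "\<lambda>_. A" "\<lambda>_. t"] that by (simp add: disjoint_family_on_def)
  have 1: "indep_vars (\<lambda>_. borel) (\<lambda>i \<mu>. measure \<mu> (A i)) {..<n}"
    if A: "\<forall>i<n. A i \<in> sets borel \<and> bounded (A i)" "disjoint_family_on A {..<n}" for n :: nat and A :: "nat \<Rightarrow> 'a set"
  proof (rule indep_vars_of_laplace_transform)
    show "(\<lambda>\<mu>. measure \<mu> (A i)) \<in> borel_measurable P" if "i < n" for i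
      using mass_meas A that by auto
    fix t :: "nat \<Rightarrow> nat"
    have "expectation (\<lambda>\<mu>. \<Prod>i<n. exp (- real (t i) * measure \<mu> (A i))) = (\<Prod>i<n. exp (nb_exp (real (t i)) * measure lborel (A i)))"
      using A by (intro joint) auto
    also have "\<dots> = (\<Prod>i<n. expectation (\<lambda>\<mu>. exp (- real (t i) * measure \<mu> (A i))))"
      using A by (intro prod.cong refl single[symmetric]) auto
    finally show "expectation (\<lambda>\<mu>. \<Prod>i<n. exp (- real (t i) * measure \<mu> (A i)))
        = (\<Prod>i<n. expectation (\<lambda>\<mu>. exp (- real (t i) * measure \<mu> (A i))))" .
  qed simp
  have 2: "distr P borel (\<lambda>\<mu>. measure \<mu> A) = distr P borel (\<lambda>\<mu>. measure \<mu> B)"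
    if "A \<in> sets borel" "B \<in> sets borel" "bounded A" "bounded B" "emeasure lborel A = emeasure lborel B" for A B :: "'a set"
    using that single[of A] single[of B] mass_meas
    by (intro laplace_transform_unique prob_space_axioms) (auto simp: measure_def)
  have 3: "expectation (\<lambda>\<mu>. exp (\<integral>x. f x \<partial>\<mu>)) = exp (\<integral>x. (\<integral>s\<in>{0<..}. (exp (s * f x) - 1) \<partial>zeta_measure \<eta> \<kappa>) \<partial>lborel)"
    if f: "f \<in> C_0" "\<forall>x. f x \<le> 0" for f :: "'a \<Rightarrow> real"
  proof -
    obtain K where K: "\<And>x. norm x \<ge> real K \<Longrightarrow> f x = 0" using C_0_support[OF f(1)] by blast
    show ?thesis
      using lap[OF C_0_borel_measurable[OF f(1)] _ K] f(2) by (simp add: integral_zeta_measure[OF nb])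
  qed
  show ?thesis
    unfolding negative_binomial_process_def measure_valued_levy_process_def
    by (intro exI[of _ P] conjI allI impI ballI P; (elim conjE)?)
      (rule 1 2 3; assumption)+
qed

end

text \<open>Masses of sets of equal volume have the same law, so a bounded Borel set may be replaced
  by a compact one. For \<open>v = 0\<close> the box degenerates to a point and is still
  nonempty.\<close>

lemma box_of_volume:
  assumes "v \<ge> 0"
  shows "\<exists>B :: 'a::euclidean_space set. compact B \<and> B \<noteq> {} \<and> emeasure lborel B = ennreal v"
proof (intro exI conjI)
  let ?B = "cbox 0 (root DIM('a) v *\<^sub>R One) :: 'a set"
  have r: "root DIM('a) v \<ge> 0" using assms by (intro real_root_ge_zero)
  show "compact ?B" by simp
  show "?B \<noteq> {}" using r by (auto simp: box_ne_empty)
  have "emeasure lborel ?B = ennreal (\<Prod>b\<in>(Basis :: 'a set). root DIM('a) v)"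
    using r by (subst emeasure_lborel_cbox) (auto intro!: arg_cong[where f = ennreal] prod.cong)
  also have "(\<Prod>b\<in>(Basis :: 'a set). root DIM('a) v) = v"
    using assms by (simp add: real_root_pow_pos2)
  finally show "emeasure lborel ?B = ennreal v" .
qed

text \<open>Continuous functions decreasing to the indicator of a compact \<open>B\<close>; the
  first one bounds all the others.\<close>

definition cutoff :: "'a::euclidean_space set \<Rightarrow> nat \<Rightarrow> 'a \<Rightarrow> real" where
  "cutoff B n x = max 0 (1 - real (Suc n) * infdist x B)"

context
  fixes B :: "'a::euclidean_space set"
  assumes B: "compact B" "B \<noteq> {}"
begin

lemma cutoff_bounds: "0 \<le> cutoff B n x" "cutoff B n x \<le> 1" "cutoff B n x \<le> cutoff B 0 x"
proof -
  have "infdist x B \<le> real (Suc n) * infdist x B"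
    using infdist_nonneg[of x B] by (simp add: algebra_simps)
  then show "0 \<le> cutoff B n x" "cutoff B n x \<le> 1" "cutoff B n x \<le> cutoff B 0 x"
    using infdist_nonneg[of x B] by (auto simp: cutoff_def)
qed

lemma cutoff_C_0: "cutoff B n \<in> C_0"
proof -
  have "continuous_on UNIV (cutoff B n)"
    unfolding cutoff_def[abs_def] by (intro continuous_intros continuous_on_infdist)
  moreover have "{x. cutoff B n x \<noteq> 0} \<subseteq> {x. infdist x B \<le> 1}"
  proof -
    have "infdist x B \<le> 1" if "cutoff B n x \<noteq> 0" for x
    proof -
      have "cutoff B 0 x > 0" using cutoff_bounds(1,3)[of n x] that by linarith
      then show ?thesis by (simp add: cutoff_def split: if_splits)
    qed
    then show ?thesis by blast
  qed
  then have "bounded {x. cutoff B n x \<noteq> 0}"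
    using bounded_subset compact_imp_bounded compact_infdist_le[OF B(2,1), of 1] by (metis zero_less_one)
  ultimately show ?thesis by (simp add: C_0_iff)
qed

lemma cutoff_tendsto: "(\<lambda>n. cutoff B n x) \<longlonglongrightarrow> indicator B x"
proof (cases "x \<in> B")
  case True
  then show ?thesis by (simp add: cutoff_def)
next
  case False
  have "closed B" using B(1) by (rule compact_imp_closed)
  then have d: "infdist x B > 0"
    using False B(2) in_closed_iff_infdist_zero[of B x] infdist_nonneg[of x B] by fastforce
  obtain N where N: "real N > 1 / infdist x B" using reals_Archimedean2 by blast
  have "cutoff B n x = 0" if "n \<ge> N" for n
  proof -
    have "1 / infdist x B < real (Suc n)" using N that by simp
    then have "1 < real (Suc n) * infdist x B" using d by (simp only: divide_less_eq if_True)
    then show ?thesis by (simp add: cutoff_def)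
  qed
  then have "eventually (\<lambda>n. cutoff B n x = 0) sequentially"
    unfolding eventually_sequentially by blast
  then have "(\<lambda>n. cutoff B n x) \<longlonglongrightarrow> 0" by (rule tendsto_eventually)
  then show ?thesis using False by simp
qed

end

section \<open>Law of the masses and moments of an arbitrary negative binomial process\<close>

context
  fixes \<eta> \<kappa> p :: real and P :: "'w measure" and \<gamma> :: "'w \<Rightarrow> 'a::euclidean_space measure"
  assumes nb: "\<eta> > 0" "\<kappa> > 0" "p = \<eta> / (\<eta> + 1 / \<kappa>\<^sup>2)"
    and NB: "negative_binomial_process \<eta> \<kappa> P \<gamma>"
begin

lemma negative_binomial_random_measure: "random_measure P \<gamma>"
  using NB by (simp add: negative_binomial_process_def measure_valued_levy_process_def)

lemma negative_binomial_laplace: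
  assumes f: "f \<in> C_0" "\<And>x. f x \<ge> 0"
  shows "(\<integral>\<omega>. exp (- (\<integral>x. f x \<partial>\<gamma> \<omega>)) \<partial>P) = exp (\<integral>x. nb_exponent \<eta> p (f x) \<partial>lborel)"
proof -
  have "(\<integral>\<omega>. exp (\<integral>x. - f x \<partial>\<gamma> \<omega>) \<partial>P)
      = exp (\<integral>x. (\<integral>s\<in>{0<..}. (exp (s * - f x) - 1) \<partial>zeta_measure \<eta> \<kappa>) \<partial>lborel)"
    using NB C_0_uminus[OF f(1)] f(2) unfolding negative_binomial_process_def by (elim conjE ballE[where x = "\<lambda>x. - f x"]) auto
  moreover have "(\<integral>s\<in>{0<..}. (exp (s * - f x) - 1) \<partial>zeta_measure \<eta> \<kappa>) = nb_exponent \<eta> p (f x)" for x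
    using integral_zeta_measure[OF nb, of "- f x"] f(2)[of x] by simp
  ultimately show ?thesis by simp
qed

text \<open>The independence clause for a single set already includes that its mass is a random
  variable.\<close>

lemma negative_binomial_mass_measurable:
  assumes "A \<in> sets borel" "bounded A"
  shows "(\<lambda>\<omega>. measure (\<gamma> \<omega>) A) \<in> borel_measurable P"
proof -
  interpret prob_space P using negative_binomial_random_measure by (simp add: random_measure_def)
  have "indep_vars (\<lambda>_. borel) (\<lambda>i \<omega>. measure (\<gamma> \<omega>) A) {..<1::nat}"
    using NB assms unfolding negative_binomial_process_def measure_valued_levy_process_def
    by (elim conjE allE[where x = "1::nat"] allE[where x = "\<lambda>_. A"] impE) (auto simp: disjoint_family_on_def)
  then show ?thesis by (auto simp: indep_vars_def)
qed

text \<open>The cutoffs carry the Laplace formula from continuous functions to the indicator.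
  Dominated convergence is used for the random measure (bound \<open>g 0\<close>), the expectation
  (bound 1) and the Lebesgue integral of the exponent (bound
  \<open>\<kappa>\<^sup>2 * g 0\<close>).\<close>

lemma negative_binomial_compact_laplace:
  assumes B: "compact B" "B \<noteq> {}" and t: "t \<ge> 0"
  shows "(\<integral>\<omega>. exp (- t * measure (\<gamma> \<omega>) B) \<partial>P) = exp (nb_exponent \<eta> p t * measure lborel B)"
proof -
  interpret prob_space P using negative_binomial_random_measure by (simp add: random_measure_def)
  define g where "g n x = t * cutoff B n x" for n x
  have Bb: "B \<in> sets borel" "bounded B" using B by (auto intro: compact_imp_bounded borel_compact)
  have g: "g n \<in> C_0" "g n x \<ge> 0" "\<bar>g n x\<bar> \<le> g 0 x" for n x
    unfolding g_def[abs_def] using C_0_cmult[OF cutoff_C_0[OF B]] cutoff_bounds[OF B] t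
    by (auto simp: abs_mult mult_left_mono)
  have lim: "(\<lambda>n. g n x) \<longlonglongrightarrow> t * indicator B x" for x
    unfolding g_def by (intro tendsto_intros cutoff_tendsto[OF B])
  have pointwise: "(\<lambda>n. \<integral>x. g n x \<partial>\<gamma> \<omega>) \<longlonglongrightarrow> t * measure (\<gamma> \<omega>) B" if "\<omega> \<in> space P" for \<omega>
  proof -
    have r: "\<gamma> \<omega> \<in> radon_measures"
      by (rule random_measure_radon[OF negative_binomial_random_measure that])
    then have s [measurable_cong]: "sets (\<gamma> \<omega>) = sets borel" by (simp add: radon_measures_def)
    have "(\<lambda>n. \<integral>x. g n x \<partial>\<gamma> \<omega>) \<longlonglongrightarrow> (\<integral>x. t * indicator B x \<partial>\<gamma> \<omega>)"
    proof (rule integral_dominated_convergence)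
      show "(\<lambda>x. t * indicator B x) \<in> borel_measurable (\<gamma> \<omega>)" using Bb by measurable
      show "g n \<in> borel_measurable (\<gamma> \<omega>)" for n
        using C_0_borel_measurable[OF g(1)] measurable_cong_sets[OF s refl] by blast
      show "integrable (\<gamma> \<omega>) (g 0)" by (rule C_0_integrable_radon[OF g(1) r])
    qed (use lim g(3) in auto)
    then show ?thesis using integral_indicator_radon[OF r Bb(1)] by simp
  qed
  have "(\<lambda>n. expectation (\<lambda>\<omega>. exp (- (\<integral>x. g n x \<partial>\<gamma> \<omega>)))) \<longlonglongrightarrow> expectation (\<lambda>\<omega>. exp (- (t * measure (\<gamma> \<omega>) B)))"
  proof (rule integral_dominated_convergence[where w = "\<lambda>_. 1"])
    show "(\<lambda>\<omega>. exp (- (t * measure (\<gamma> \<omega>) B))) \<in> borel_measurable P"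
      using negative_binomial_mass_measurable[OF Bb] by measurable
    show "(\<lambda>\<omega>. exp (- (\<integral>x. g n x \<partial>\<gamma> \<omega>))) \<in> borel_measurable P" for n
      using random_measure_integral_measurable[OF negative_binomial_random_measure g(1)[of n]] by measurable
    show "AE \<omega> in P. (\<lambda>n. exp (- (\<integral>x. g n x \<partial>\<gamma> \<omega>))) \<longlonglongrightarrow> exp (- (t * measure (\<gamma> \<omega>) B))"
      using pointwise by (intro AE_I2 tendsto_intros)
    show "AE \<omega> in P. norm (exp (- (\<integral>x. g n x \<partial>\<gamma> \<omega>))) \<le> 1" for n
      using g(2) by (intro AE_I2) (simp add: integral_nonneg)
  qed simp
  moreover have "(\<lambda>n. expectation (\<lambda>\<omega>. exp (- (\<integral>x. g n x \<partial>\<gamma> \<omega>)))) \<longlonglongrightarrow> exp (\<integral>x. nb_exponent \<eta> p (t * indicator B x) \<partial>lborel)"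
    unfolding negative_binomial_laplace[OF g(1,2)]
  proof (intro tendsto_exp integral_dominated_convergence)
    note [measurable] = nb_exponent_measurable[OF nb] C_0_borel_measurable[OF g(1)] Bb(1)
    show "(\<lambda>x. nb_exponent \<eta> p (t * indicator B x)) \<in> borel_measurable lborel" by measurable
    show "(\<lambda>x. nb_exponent \<eta> p (g n x)) \<in> borel_measurable lborel" for n by measurable
    show "integrable lborel (\<lambda>x. \<kappa>\<^sup>2 * g 0 x)"
      by (intro integrable_mult_right C_0_integrable_lborel g(1))
    show "AE x in lborel. (\<lambda>n. nb_exponent \<eta> p (g n x)) \<longlonglongrightarrow> nb_exponent \<eta> p (t * indicator B x)"
    proof (rule AE_I2)
      fix x
      have "isCont (nb_exponent \<eta> p) (t * indicator B x)"
        using t by (intro DERIV_isCont[OF nb_exponent_derivative[OF nb]]) simp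
      then show "(\<lambda>n. nb_exponent \<eta> p (g n x)) \<longlonglongrightarrow> nb_exponent \<eta> p (t * indicator B x)"
        by (rule isCont_tendsto_compose) (rule lim)
    qed
    show "AE x in lborel. norm (nb_exponent \<eta> p (g n x)) \<le> \<kappa>\<^sup>2 * g 0 x" for n
    proof (rule AE_I2)
      fix x
      have "\<bar>nb_exponent \<eta> p (g n x)\<bar> \<le> \<kappa>\<^sup>2 * g n x" by (rule nb_exponent_bound[OF nb g(2)])
      also have "\<dots> \<le> \<kappa>\<^sup>2 * g 0 x" using g(3)[of n x] by (intro mult_left_mono) auto
      finally show "norm (nb_exponent \<eta> p (g n x)) \<le> \<kappa>\<^sup>2 * g 0 x" by simp
    qed
  qed
  ultimately have "expectation (\<lambda>\<omega>. exp (- (t * measure (\<gamma> \<omega>) B))) = exp (\<integral>x. nb_exponent \<eta> p (t * indicator B x) \<partial>lborel)"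
    by (rule LIMSEQ_unique)
  moreover have "nb_exponent \<eta> p (t * indicator B x) = nb_exponent \<eta> p t * indicator B x" for x
    by (simp add: indicator_def nb_exponent_0[OF nb])
  ultimately show ?thesis using Bb by simp
qed

text \<open>The law of the mass depends only on the volume, so \<open>A\<close> is exchanged for a
  compact box, whose Laplace transform is known; uniqueness of Laplace transforms then identifies
  the law.\<close>

lemma negative_binomial_marginal:
  assumes A: "A \<in> sets borel" "bounded A"
  shows "distr P borel (\<lambda>\<omega>. measure (\<gamma> \<omega>) A) = neg_binomial_distribution \<eta> \<kappa> (measure lborel A)"
proof -
  define v where "v = measure lborel A"
  let ?Q = "neg_binomial_distribution \<eta> \<kappa> v"
  have v: "v \<ge> 0" by (simp add: v_def)
  have ev: "emeasure lborel A = ennreal v"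
    unfolding v_def using emeasure_bounded_finite[OF A(2)] by (intro emeasure_eq_ennreal_measure) (simp add: less_top)
  obtain B :: "'a set" where B: "compact B" "B \<noteq> {}" "emeasure lborel B = ennreal v" using box_of_volume[OF v] by blast
  have Bb: "B \<in> sets borel" "bounded B" using B(1) by (auto intro: compact_imp_bounded borel_compact)
  have mB: "measure lborel B = v" using B(3) v by (simp add: measure_def)
  have "distr P borel (\<lambda>\<omega>. measure (\<gamma> \<omega>) A) = distr P borel (\<lambda>\<omega>. measure (\<gamma> \<omega>) B)"
  proof (rule NB[unfolded negative_binomial_process_def measure_valued_levy_process_def,
        THEN conjunct1, THEN conjunct2, THEN conjunct2, rule_format, OF A(1) Bb(1)])
    show "bounded A \<and> bounded B \<and> emeasure lborel A = emeasure lborel B" using A(2) Bb(2) ev B(3) by simp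
  qed
  \<comment> \<open>The uniqueness lemma asks for nonnegativity at every point, while the identity
    is nonnegative only almost everywhere under \<open>?Q\<close>.\<close>
  also have "\<dots> = distr ?Q borel (max 0)"
  proof (rule laplace_transform_unique)
    show "prob_space P" using negative_binomial_random_measure by (simp add: random_measure_def)
    show "prob_space ?Q" by (rule prob_space_neg_binomial[OF nb v])
    show "(\<lambda>\<omega>. measure (\<gamma> \<omega>) B) \<in> borel_measurable P" by (rule negative_binomial_mass_measurable[OF Bb])
    show m: "max 0 \<in> borel_measurable ?Q"
      unfolding measurable_cong_sets[OF sets_neg_binomial[OF nb] refl] by measurable
    fix n :: nat
    have "(\<integral>x. exp (- real n * max 0 x) \<partial>?Q) = (\<integral>x. exp (- real n * x) \<partial>?Q)"
    proof (rule integral_cong_AE)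
      show "AE x in ?Q. exp (- real n * max 0 x) = exp (- real n * x)"
        using neg_binomial_nonneg[OF nb v] by eventually_elim simp
      show "(\<lambda>x. exp (- real n * max 0 x)) \<in> borel_measurable ?Q" "(\<lambda>x. exp (- real n * x)) \<in> borel_measurable ?Q"
        unfolding measurable_cong_sets[OF sets_neg_binomial[OF nb] refl] by measurable
    qed
    then show "(\<integral>\<omega>. exp (- real n * measure (\<gamma> \<omega>) B) \<partial>P) = (\<integral>x. exp (- real n * max 0 x) \<partial>?Q)"
      using negative_binomial_compact_laplace[OF B(1,2), of "real n"] neg_binomial_laplace[OF nb v, of "real n"]
      by (simp add: mB mult.commute)
  qed auto
  also have "\<dots> = distr ?Q borel (\<lambda>x. x)"
  proof (rule distr_cong_AE)
    show "AE x in ?Q. max 0 x = x" using neg_binomial_nonneg[OF nb v] by eventually_elim simp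
    show "max 0 \<in> ?Q \<rightarrow>\<^sub>M borel" "(\<lambda>x. x) \<in> ?Q \<rightarrow>\<^sub>M borel"
      unfolding measurable_cong_sets[OF sets_neg_binomial[OF nb] refl] by measurable
  qed simp_all
  also have "\<dots> = ?Q" by (rule distr_id2) (simp add: sets_neg_binomial[OF nb])
  finally show ?thesis by (simp add: v_def)
qed

text \<open>The integral of \<open>f\<close> is at most \<open>C\<close> times the mass of a ball
  containing the support, and the law of that mass is now known.\<close>

lemma negative_binomial_exponential_moment:
  assumes f: "f \<in> C_0" "\<And>x. f x \<ge> 0"
  shows "\<exists>\<epsilon>>0. integrable P (\<lambda>\<omega>. exp (\<epsilon> * (\<integral>x. f x \<partial>\<gamma> \<omega>)))"
proof -
  obtain K where K: "\<And>x. norm x \<ge> real K \<Longrightarrow> f x = 0" using C_0_support[OF f(1)] by blast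
  obtain C0 where C0: "\<And>x. \<bar>f x\<bar> \<le> C0" using C_0_bounded[OF f(1)] by blast
  define C where "C = max C0 1"
  have C: "f x \<le> C" "C > 0" for x using C0[of x] by (auto simp: C_def)
  define A where "A = ball (0::'a) (real K)"
  have A: "A \<in> sets borel" "bounded A" by (auto simp: A_def)
  \<comment> \<open>Chosen so that \<open>p * exp (\<epsilon> * C)\<close> is the square root of
    \<open>p\<close>, hence below 1.\<close>
  define \<epsilon> where "\<epsilon> = - ln p / (2 * C)"
  have \<epsilon>: "\<epsilon> > 0" using p_bounds[OF nb] C(2) by (simp add: \<epsilon>_def divide_neg_pos)
  have "p * exp (\<epsilon> * C) = exp (ln p / 2)"
  proof -
    have "p * exp (\<epsilon> * C) = exp (ln p + - ln p / 2)"
      using p_bounds[OF nb] C(2) by (simp only: exp_add) (simp add: \<epsilon>_def)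
    then show ?thesis by simp
  qed
  also have "\<dots> < 1" using p_bounds[OF nb] by simp
  finally have lt: "p * exp (\<epsilon> * C) < 1" .
  have int: "integrable P (\<lambda>\<omega>. exp (\<epsilon> * C * measure (\<gamma> \<omega>) A))"
  proof (rule integrable_distr[OF negative_binomial_mass_measurable[OF A]])
    show "integrable (distr P borel (\<lambda>\<omega>. measure (\<gamma> \<omega>) A)) (\<lambda>x. exp (\<epsilon> * C * x))"
      unfolding negative_binomial_marginal[OF A] by (rule neg_binomial_exponential_moment[OF nb _ lt]) simp
  qed
  have "integrable P (\<lambda>\<omega>. exp (\<epsilon> * (\<integral>x. f x \<partial>\<gamma> \<omega>)))"
  proof (rule Bochner_Integration.integrable_bound[OF int])
    show "(\<lambda>\<omega>. exp (\<epsilon> * (\<integral>x. f x \<partial>\<gamma> \<omega>))) \<in> borel_measurable P"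
      using random_measure_integral_measurable[OF negative_binomial_random_measure f(1)] by measurable
    show "AE \<omega> in P. norm (exp (\<epsilon> * (\<integral>x. f x \<partial>\<gamma> \<omega>))) \<le> norm (exp (\<epsilon> * C * measure (\<gamma> \<omega>) A))"
    proof (rule AE_I2)
      fix \<omega> assume "\<omega> \<in> space P"
      then have r: "\<gamma> \<omega> \<in> radon_measures" by (rule random_measure_radon[OF negative_binomial_random_measure])
      have "(\<integral>x. f x \<partial>\<gamma> \<omega>) \<le> (\<integral>x. C * indicator A x \<partial>\<gamma> \<omega>)"
      proof (rule integral_mono)
        show "integrable (\<gamma> \<omega>) f" by (rule C_0_integrable_radon[OF f(1) r])
        show "integrable (\<gamma> \<omega>) (\<lambda>x. C * indicator A x)"
          using radon_bounded_finite[OF r A(2)] A(1) r by (intro integrable_mult_right) (auto simp: radon_measures_def)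
        show "f x \<le> C * indicator A x" for x
          using C K[of x] by (cases "x \<in> A") (auto simp: A_def)
      qed
      also have "\<dots> = C * measure (\<gamma> \<omega>) A"
        unfolding integral_mult_right_zero integral_indicator_radon[OF r A(1)] ..
      finally have "\<epsilon> * (\<integral>x. f x \<partial>\<gamma> \<omega>) \<le> \<epsilon> * (C * measure (\<gamma> \<omega>) A)"
        using \<epsilon> by (intro mult_left_mono) auto
      then show "norm (exp (\<epsilon> * (\<integral>x. f x \<partial>\<gamma> \<omega>))) \<le> norm (exp (\<epsilon> * C * measure (\<gamma> \<omega>) A))"
        by (simp add: mult.assoc)
    qed
  qed
  then show ?thesis using \<epsilon> by blast
qed

lemma negative_binomial_moments:
  assumes fs: "fs \<in> lists test_functions"
  shows "integrable P (\<lambda>\<omega>. \<Prod>f\<leftarrow>fs. \<integral>x. f x \<partial>\<gamma> \<omega>) \<and>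
    tau (rho_prod \<eta> \<kappa> fs) = (\<integral>\<omega>. (\<Prod>f\<leftarrow>fs. \<integral>x. f x \<partial>\<gamma> \<omega>) \<partial>P)"
proof -
  interpret linear_statistics P "\<lambda>f \<omega>. \<integral>x. f x \<partial>\<gamma> \<omega>"
    by (rule random_measure_linear_statistics[OF negative_binomial_random_measure negative_binomial_exponential_moment])
  interpret tilted_statistics P "\<lambda>f \<omega>. \<integral>x. f x \<partial>\<gamma> \<omega>" \<eta> \<kappa> p "nb_exponent \<eta> p"
  proof
    show "0 \<le> p" "p < 1" "\<eta> * \<kappa>\<^sup>2 = p / (1 - p)" using p_bounds[OF nb] p_ratio[OF nb] by simp_all
  qed (simp_all add: nb_exponent_0[OF nb] nb_exponent_derivative[OF nb] negative_binomial_laplace)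
  show ?thesis
    using nb(1,2) by (intro moments_eq_tau fs) (simp_all add: add_pos_pos)
qed

text \<open>The marginal laws live on the natural numbers, so almost surely all bounded sets of a
  countable basis have integer mass at the same time.\<close>

lemma negative_binomial_point_process: "point_process P \<gamma>"
proof -
  obtain B :: "'a set set" where B: "countable B" "topological_basis B" using ex_countable_basis by blast
  have "AE \<omega> in P. \<forall>U\<in>{U\<in>B. bounded U}. measure (\<gamma> \<omega>) U \<in> \<nat>"
  proof (rule AE_ball_countable'[rotated])
    show "countable {U\<in>B. bounded U}" using B(1) by (rule countable_subset[rotated]) auto
    fix U assume "U \<in> {U\<in>B. bounded U}"
    then have U: "U \<in> sets borel" "bounded U" using topological_basis_open[OF B(2)] by auto
    have "AE x in distr P borel (\<lambda>\<omega>. measure (\<gamma> \<omega>) U). x \<in> \<nat>"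
      unfolding negative_binomial_marginal[OF U] by (rule AE_neg_binomial_nat[OF nb]) simp
    then show "AE \<omega> in P. measure (\<gamma> \<omega>) U \<in> \<nat>"
      by (rule AE_distrD[OF negative_binomial_mass_measurable[OF U]])
  qed
  then have "AE \<omega> in P. \<exists>(I::nat set) (s::nat \<Rightarrow> nat) x. \<gamma> \<omega> = dirac_sum I (\<lambda>i. real (s i)) x"
  proof (rule AE_mp, intro AE_I2 impI)
    fix \<omega> assume "\<omega> \<in> space P" "\<forall>U\<in>{U\<in>B. bounded U}. measure (\<gamma> \<omega>) U \<in> \<nat>"
    then show "\<exists>(I::nat set) (s::nat \<Rightarrow> nat) x. \<gamma> \<omega> = dirac_sum I (\<lambda>i. real (s i)) x"
      by (intro dirac_sum_of_integer_valued[OF random_measure_radon[OF negative_binomial_random_measure] B]) auto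
  qed
  then show ?thesis using negative_binomial_random_measure by (simp add: point_process_def)
qed

end

theorem theorem29:
  fixes q :: complex and \<eta> \<kappa> :: real
  assumes dim: "CARD('d::finite) \<ge> 2"
    and q: "norm q = 1" and eta: "\<eta> = Re q"
    and kappa: "\<kappa> > 0" "\<eta> < 0 \<Longrightarrow> \<kappa>\<^sup>2 < - 1 / \<eta>"
  shows
    "((\<forall>r \<in> (density_algebra \<eta> \<kappa> :: ((real^'d) fock \<Rightarrow> (real^'d) fock) set).
         tau (compose fock_fin r r) \<ge> 0) \<longleftrightarrow> \<eta> \<ge> 0)
     \<and> (\<eta> = 0 \<longrightarrow>
         (\<exists>(P :: (real^'d) measure measure) (\<gamma> :: (real^'d) measure \<Rightarrow> (real^'d) measure).
            poisson_point_process (\<kappa>\<^sup>2) P \<gamma>)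
         \<and> (\<forall>(P :: 'w measure) (\<gamma> :: 'w \<Rightarrow> (real^'d) measure).
              poisson_point_process (\<kappa>\<^sup>2) P \<gamma> \<longrightarrow>
              (\<forall>fs \<in> lists test_functions.
                 integrable P (\<lambda>\<omega>. \<Prod>f\<leftarrow>fs. \<integral>x. f x \<partial>\<gamma> \<omega>) \<and>
                 tau (rho_prod \<eta> \<kappa> fs) = (\<integral>\<omega>. (\<Prod>f\<leftarrow>fs. \<integral>x. f x \<partial>\<gamma> \<omega>) \<partial>P))))
     \<and> (\<eta> > 0 \<longrightarrow>
         (\<exists>(P :: (real^'d) measure measure) (\<gamma> :: (real^'d) measure \<Rightarrow> (real^'d) measure).
            negative_binomial_process \<eta> \<kappa> P \<gamma>)
         \<and> (\<forall>(P :: 'w measure) (\<gamma> :: 'w \<Rightarrow> (real^'d) measure).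
              negative_binomial_process \<eta> \<kappa> P \<gamma> \<longrightarrow>
              point_process P \<gamma> \<and>
              (\<forall>fs \<in> lists test_functions.
                 integrable P (\<lambda>\<omega>. \<Prod>f\<leftarrow>fs. \<integral>x. f x \<partial>\<gamma> \<omega>) \<and>
                 tau (rho_prod \<eta> \<kappa> fs) = (\<integral>\<omega>. (\<Prod>f\<leftarrow>fs. \<integral>x. f x \<partial>\<gamma> \<omega>) \<partial>P)) \<and>
              (\<forall>A \<in> sets borel. bounded A \<longrightarrow>
                 distr P borel (\<lambda>\<omega>. measure (\<gamma> \<omega>) A)
                   = neg_binomial_distribution \<eta> \<kappa> (measure lborel A))))"
proof (intro conjI impI allI ballI)
  \<comment> \<open>The upper bound on \<open>\<kappa>\<^sup>2\<close> for negative \<eta> is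
    exactly what makes \<beta> the root of a positive number.\<close>
  have pos: "\<eta> + 1 / \<kappa>\<^sup>2 > 0"
  proof (cases "\<eta> < 0")
    case True
    have "\<kappa>\<^sup>2 > 0" using kappa(1) by simp
    then show ?thesis using kappa(2)[OF True] True by (simp add: field_simps)
  qed (use kappa(1) in \<open>simp add: add_nonneg_pos\<close>)
  note moments_nonneg = tau_nonneg_of_moments[OF kappa(1) pos refl]
  show "(\<forall>r\<in>(density_algebra \<eta> \<kappa> :: ((real^'d) fock \<Rightarrow> (real^'d) fock) set). tau (compose fock_fin r r) \<ge> 0) \<longleftrightarrow> \<eta> \<ge> 0"
  proof
    assume nonneg: "\<forall>r\<in>(density_algebra \<eta> \<kappa> :: ((real^'d) fock \<Rightarrow> (real^'d) fock) set). tau (compose fock_fin r r) \<ge> 0"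
    show "\<eta> \<ge> 0"
    proof (rule ccontr)
      assume "\<not> \<eta> \<ge> 0"
      then have "\<exists>r\<in>(density_algebra \<eta> \<kappa> :: ((real^'d) fock \<Rightarrow> (real^'d) fock) set). tau (compose fock_fin r r) < 0"
        by (intro tau_negative[OF kappa(1) pos refl]) simp
      then show False using nonneg by fastforce
    qed
  next
    assume "\<eta> \<ge> 0"
    then consider "\<eta> = 0" | "\<eta> > 0" by fastforce
    then show "\<forall>r\<in>(density_algebra \<eta> \<kappa> :: ((real^'d) fock \<Rightarrow> (real^'d) fock) set). tau (compose fock_fin r r) \<ge> 0"
    proof cases
      case 1
      obtain P :: "(real^'d) measure measure" where P: "poisson_point_process (\<kappa>\<^sup>2) P (\<lambda>\<mu>. \<mu>)"
        using poisson_point_process_exists[OF kappa(1)] by blast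
      have "integrable P (\<lambda>\<mu>. \<Prod>f\<leftarrow>fs. \<integral>x. f x \<partial>\<mu>) \<and> tau (rho_prod \<eta> \<kappa> fs) = (\<integral>\<mu>. (\<Prod>f\<leftarrow>fs. \<integral>x. f x \<partial>\<mu>) \<partial>P)"
        if "fs \<in> lists test_functions" for fs
        unfolding 1 by (rule poisson_moments[OF kappa(1) P that])
      then show ?thesis by (intro ballI) (rule moments_nonneg)
    next
      case 2
      obtain P :: "(real^'d) measure measure" where P: "negative_binomial_process \<eta> \<kappa> P (\<lambda>\<mu>. \<mu>)"
        using negative_binomial_process_exists[OF 2 kappa(1) refl] by blast
      show ?thesis
        by (intro ballI) (rule moments_nonneg[OF negative_binomial_moments[OF 2 kappa(1) refl P]])
    qed
  qed
next
  assume eta0: "\<eta> = 0"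
  show "\<exists>(P :: (real^'d) measure measure) (\<gamma> :: (real^'d) measure \<Rightarrow> (real^'d) measure). poisson_point_process (\<kappa>\<^sup>2) P \<gamma>"
    using poisson_point_process_exists[OF kappa(1)] by blast
  fix P :: "'w measure" and \<gamma> :: "'w \<Rightarrow> (real^'d) measure" and fs :: "(real^'d \<Rightarrow> real) list"
  assume "poisson_point_process (\<kappa>\<^sup>2) P \<gamma>" "fs \<in> lists test_functions"
  note moments = poisson_moments[OF kappa(1) this]
  show "integrable P (\<lambda>\<omega>. \<Prod>f\<leftarrow>fs. \<integral>x. f x \<partial>\<gamma> \<omega>)"
    by (rule conjunct1[OF moments])
  show "tau (rho_prod \<eta> \<kappa> fs) = (\<integral>\<omega>. (\<Prod>f\<leftarrow>fs. \<integral>x. f x \<partial>\<gamma> \<omega>) \<partial>P)"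
    unfolding eta0 by (rule conjunct2[OF moments])
next
  assume "\<eta> > 0"
  note nb = this kappa(1) refl
  show "\<exists>(P :: (real^'d) measure measure) (\<gamma> :: (real^'d) measure \<Rightarrow> (real^'d) measure). negative_binomial_process \<eta> \<kappa> P \<gamma>"
    using negative_binomial_process_exists[OF nb] by blast
  fix P :: "'w measure" and \<gamma> :: "'w \<Rightarrow> (real^'d) measure"
  assume NB: "negative_binomial_process \<eta> \<kappa> P \<gamma>"
  show "point_process P \<gamma>" by (rule negative_binomial_point_process[OF nb NB])
  show "distr P borel (\<lambda>\<omega>. measure (\<gamma> \<omega>) A) = neg_binomial_distribution \<eta> \<kappa> (measure lborel A)"
    if "A \<in> sets borel" "bounded A" for A
    by (rule negative_binomial_marginal[OF nb NB that])
  fix fs :: "(real^'d \<Rightarrow> real) list" assume "fs \<in> lists test_functions"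
  note moments = negative_binomial_moments[OF nb NB this]
  show "integrable P (\<lambda>\<omega>. \<Prod>f\<leftarrow>fs. \<integral>x. f x \<partial>\<gamma> \<omega>)"
    by (rule conjunct1[OF moments])
  show "tau (rho_prod \<eta> \<kappa> fs) = (\<integral>\<omega>. (\<Prod>f\<leftarrow>fs. \<integral>x. f x \<partial>\<gamma> \<omega>) \<partial>P)"
    by (rule conjunct2[OF moments])
qed

end
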